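(* Let $\Upsilon$ be a gain signed graph. (a) If $S\subseteq E$ is hyperbalanced, let $\zeta: V\setminus U_\Sigma(S)\to\{\pm1\}$ be a sign potential for $S{:}(V\setminus U_\Sigma(S))$ and let $\theta:V\to\mathbb{K}$ be such that $-\theta$ is a gain potential for $S$. Then $$\mathrm{clos}_\Upsilon(S)=\mathrm{bcl}_\Upsilon(S)=[E(\theta){:}U_\Sigma(S)]\cup[E(\theta,\zeta){:}\pi_b(S)]\cup E^{00};$$ this closure is hyperbalanced and equals the closure of $S$ in $M_\infty(\Upsilon)$. (b) If $S$ is hyperfrustrated, then in $M(\Upsilon)$ $$\mathrm{clos}_\Upsilon(S)=\mathrm{clos}_\Sigma(S)=[E{:}U_\Sigma(S)]\cup[E(\zeta){:}\pi_b(S)]\cup E^0,$$ where $\zeta$ is a sign potential for $S{:}(V\setminus U_\Sigma(S))$; and the closure $\mathrm{clos}_\infty(S)$ in $M_\infty(\Upsilon)$ is the same set with $e_\infty$ added.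
   Context: Let $\mathbb{K}$ be a field of characteristic $\ne2$. A graph $\Gamma=(V,E)$ has vertex set $V=\{v_1,\dots,v_n\}$ and finite edge set $E$; edges are links (two ends at distinct vertices), loops (two ends at one vertex), half edges (one end) or loose edges (no ends); parallel edges allowed. A gain signed graph $\Upsilon=(\Gamma,\sigma,\varphi)$: $\sigma:E\to\{\pm1\}$ (half edges negative, loose edges positive); with an orientation $\tau$ (signs $\tau(v,e)\in\{\pm1\}$ on edge ends, $\tau(v,e)\tau(w,e)=-\sigma(e)$ for a link or loop with ends $v,w$) each edge has gain $\varphi(e)\in\mathbb{K}$, negated on reorientation. Neutral = gain $0$. Walk gain of $W=u_0e_1\cdots e_lu_l$: $\varphi(W)=-\sum_i\varphi(e_i)\sigma(W_{0,i-1})\tau(u_{i-1},e_i)$ with $\sigma(W_{0,j})=\prod_{i\le j}\sigma(e_i)$. Ultrawalks may begin with a half edge $e_0$ at $u_0$ and/or end with a half edge $e_{l+1}$ at $u_l$; their gain adds $\tau(u_0,e_0)\varphi(e_0)$ and/or $-\varphi(e_{l+1})\sigma(W_{0,l})\tau(u_l,e_{l+1})$ to $\varphi(W_{0,l})$. Circles are connected 2-regular subgraphs with sign the product of edge signs; a negative figure is a negative circle or a half edge. A sign circuit is a positive circle, a loose edge, or a handcuff (two negative figures with exactly one common vertex, or two disjoint negative figures plus a path joining them meeting them only at its ends). Its gain: the edge gain for a loose edge; else $\varphi(W)$ for a circuit walk $W$ (once around a positive circle; for a handcuff with figures $C_1,C_2$, connecting path $P$ of length $\ge0$: around $C_1$,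 along $P$, around $C_2$, back along $P$ if both circles; from half edge $C_1$ along $P$, around $C_2$, back, ending with $C_1$ if $C_1$ half edge and $C_2$ circle; from one half edge along $P$ to the other if both half edges); well defined up to sign; neutral if $0$. $S$ is hyperbalanced if all sign circuits in $S$ are neutral, hyperfrustrated otherwise; sign balanced if it has no negative circle and no half edge. Components of $S$: connected components of $(V,S)$ (loose edges excluded, isolated vertices included); $b_\Sigma(S)$: number of sign-balanced components. $M(\Upsilon)$ is the matroid on $E$ with rank $n-b_\Sigma(S)+\delta(S)$, $\delta(S)=0$ if $S$ hyperbalanced and $1$ otherwise; $M_\infty(\Upsilon)$ is the matroid on $E\cup\{e_\infty\}$ with the same rank formula, $e_\infty$ treated as a non-neutral loose edge. The frame matroid $F(\Sigma)$ is the matroid on $E$ with rank $n-b_\Sigma(S)$. $\mathrm{clos}_\Upsilon$, $\mathrm{clos}_\infty$, $\mathrm{clos}_\Sigma$ are the closures in $M(\Upsilon)$, $M_\infty(\Upsilon)$, $F(\Sigma)$. Notation: for $X\subseteq V$, $E{:}X$ is the set of links, loops and half edges all of whose endpoints are in $X$; for a partial partition $\pi$ of $V$, $E{:}\pi=\bigcup_{B\in\pi}E{:}B$, and similarly $A{:}X$, $A{:}\pi$ for $A\subseteq E$. $E^0$ = loose edges, $E^{00}$ = neutral loose edges. $\pi_b(S)$ = set of vertex sets of sign-balanced components of $S$; $U_\Sigma(S)=V\setminus\bigcup\pi_b(S)$. For $\zeta:X\to\{\pm1\}$, $E(\zeta)$ = links and loops $e$ with ends $v,w\in X$ and $\sigma(e)=\zeta(v)\zeta(w)$;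 $\zeta$ is a sign potential for an edge set $A$ if $A\subseteq E(\zeta)$. A gain switcher $\theta:V\to\mathbb{K}$ gives $\varphi^\theta(e)=\tau(v,e)\theta(v)+\varphi(e)+\tau(w,e)\theta(w)$ for a link/loop with ends $v,w$, $\varphi^\theta(e)=\tau(v,e)\theta(v)+\varphi(e)$ for a half edge at $v$, $\varphi^\theta(e)=\varphi(e)$ for loose $e$; $E(\theta)=\{e:\varphi^\theta(e)=0\}$; $E(\theta,\zeta)=E(\theta)\cap E(\zeta)$; $\bar\theta$ is a gain potential for $A$ if $A\subseteq E(-\bar\theta)$. $\mathrm{bcl}_\Upsilon(S)=S\cup\{e\notin S:\exists$ neutral sign circuit $C$, $e\in C\subseteq S\cup\{e\}\}$. *)

theory Defs
  imports "HOL-Computational_Algebra.Computational_Algebra"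
begin

text \<open>
  The list \<open>ends \<Upsilon> e\<close> contains the vertices of the edge ends of \<open>e\<close>: a loose edge has none, a half
  edge has one, a link or a loop has two (equal vertices for a loop).  Edge ends, rather than
  incident vertices, carry the orientation: \<open>orient \<Upsilon> e i\<close> is $\tau$ at the \<open>i\<close>-th end of \<open>e\<close>
  (a positive loop has two ends with different signs at the same vertex).  \<open>edge_gain\<close> is the gain
  with respect to this orientation.
\<close>

record ('v, 'e, 'k) gsgraph =
  verts :: "'v set"
  edges :: "'e set"
  ends :: "'e \<Rightarrow> 'v list"
  edge_sign :: "'e \<Rightarrow> int"
  orient :: "'e \<Rightarrow> nat \<Rightarrow> int"
  edge_gain :: "'e \<Rightarrow> 'k"

locale gain_signed_graph =
  fixes \<Upsilon> :: "('v, 'e, 'k::field) gsgraph"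
  assumes finite_verts: "finite (verts \<Upsilon>)"
    and finite_edges: "finite (edges \<Upsilon>)"
    and length_ends: "e \<in> edges \<Upsilon> \<Longrightarrow> length (ends \<Upsilon> e) \<le> 2"
    and ends_in_verts: "e \<in> edges \<Upsilon> \<Longrightarrow> set (ends \<Upsilon> e) \<subseteq> verts \<Upsilon>"
    and edge_sign_values: "e \<in> edges \<Upsilon> \<Longrightarrow> edge_sign \<Upsilon> e \<in> {1, -1}"
    and half_edge_negative: "e \<in> edges \<Upsilon> \<Longrightarrow> length (ends \<Upsilon> e) = 1 \<Longrightarrow> edge_sign \<Upsilon> e = -1"
    and loose_edge_positive: "e \<in> edges \<Upsilon> \<Longrightarrow> length (ends \<Upsilon> e) = 0 \<Longrightarrow> edge_sign \<Upsilon> e = 1"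
    and orient_values: "e \<in> edges \<Upsilon> \<Longrightarrow> i < length (ends \<Upsilon> e) \<Longrightarrow> orient \<Upsilon> e i \<in> {1, -1}"
    and orient_sign:
      "e \<in> edges \<Upsilon> \<Longrightarrow> length (ends \<Upsilon> e) = 2 \<Longrightarrow> orient \<Upsilon> e 0 * orient \<Upsilon> e 1 = - edge_sign \<Upsilon> e"

definition loose_edges :: "('v, 'e, 'k) gsgraph \<Rightarrow> 'e set" where
  "loose_edges \<Upsilon> = {e \<in> edges \<Upsilon>. length (ends \<Upsilon> e) = 0}"

definition half_edges :: "('v, 'e, 'k) gsgraph \<Rightarrow> 'e set" where
  "half_edges \<Upsilon> = {e \<in> edges \<Upsilon>. length (ends \<Upsilon> e) = 1}"

definition links_loops :: "('v, 'e, 'k) gsgraph \<Rightarrow> 'e set" where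
  "links_loops \<Upsilon> = {e \<in> edges \<Upsilon>. length (ends \<Upsilon> e) = 2}"

definition neutral_loose_edges :: "('v, 'e, 'k::field) gsgraph \<Rightarrow> 'e set" where
  "neutral_loose_edges \<Upsilon> = {e \<in> loose_edges \<Upsilon>. edge_gain \<Upsilon> e = 0}"


section \<open>Walks and their gains\<close>

text \<open>
  A walk $u_0 e_1 u_1 \cdots e_l u_l$ is given by its initial vertex and the list of its steps
  \<open>(e, i)\<close>, where \<open>i \<in> {0, 1}\<close> is the end of \<open>e\<close> at which the step leaves; it arrives at end
  \<open>1 - i\<close>.  So $\tau(u_{i-1}, e_i)$ makes sense for loops also.
\<close>

fun step_tail :: "('v, 'e, 'k) gsgraph \<Rightarrow> 'e \<times> nat \<Rightarrow> 'v" where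
  "step_tail \<Upsilon> (e, i) = ends \<Upsilon> e ! i"

fun step_head :: "('v, 'e, 'k) gsgraph \<Rightarrow> 'e \<times> nat \<Rightarrow> 'v" where
  "step_head \<Upsilon> (e, i) = ends \<Upsilon> e ! (1 - i)"

fun walk :: "('v, 'e, 'k) gsgraph \<Rightarrow> 'v \<Rightarrow> ('e \<times> nat) list \<Rightarrow> 'v \<Rightarrow> bool" where
  "walk \<Upsilon> u [] w \<longleftrightarrow> u \<in> verts \<Upsilon> \<and> u = w"
| "walk \<Upsilon> u (d # ds) w \<longleftrightarrow>
     fst d \<in> links_loops \<Upsilon> \<and> snd d < 2 \<and> step_tail \<Upsilon> d = u \<and> walk \<Upsilon> (step_head \<Upsilon> d) ds w"

definition walk_verts :: "('v, 'e, 'k) gsgraph \<Rightarrow> 'v \<Rightarrow> ('e \<times> nat) list \<Rightarrow> 'v list" where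
  "walk_verts \<Upsilon> u ds = u # map (step_head \<Upsilon>) ds"

definition walk_edges :: "('e \<times> nat) list \<Rightarrow> 'e set" where
  "walk_edges ds = fst ` set ds"

definition is_path :: "('v, 'e, 'k) gsgraph \<Rightarrow> 'v \<Rightarrow> ('e \<times> nat) list \<Rightarrow> 'v \<Rightarrow> bool" where
  "is_path \<Upsilon> u ds w \<longleftrightarrow> walk \<Upsilon> u ds w \<and> distinct (walk_verts \<Upsilon> u ds)"

definition reverse_walk :: "('e \<times> nat) list \<Rightarrow> ('e \<times> nat) list" where
  "reverse_walk ds = rev (map (\<lambda>(e, i). (e, 1 - i)) ds)"

definition walk_sign :: "('v, 'e, 'k) gsgraph \<Rightarrow> ('e \<times> nat) list \<Rightarrow> int" where
  "walk_sign \<Upsilon> ds = (\<Prod>j<length ds. edge_sign \<Upsilon> (fst (ds ! j)))"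

definition walk_gain :: "('v, 'e, 'k::field) gsgraph \<Rightarrow> ('e \<times> nat) list \<Rightarrow> 'k" where
  "walk_gain \<Upsilon> ds =
     - (\<Sum>j<length ds. edge_gain \<Upsilon> (fst (ds ! j)) * of_int (walk_sign \<Upsilon> (take j ds))
          * of_int (orient \<Upsilon> (fst (ds ! j)) (snd (ds ! j))))"

text \<open>
  The first and last argument of \<open>ultrawalk_gain\<close> are the optional initial and final half edge of
  the ultrawalk.
\<close>

definition ultrawalk_gain ::
    "('v, 'e, 'k::field) gsgraph \<Rightarrow> 'e option \<Rightarrow> ('e \<times> nat) list \<Rightarrow> 'e option \<Rightarrow> 'k" where
  "ultrawalk_gain \<Upsilon> h ds h' =
     (case h of None \<Rightarrow> 0 | Some e \<Rightarrow> of_int (orient \<Upsilon> e 0) * edge_gain \<Upsilon> e)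
     + walk_gain \<Upsilon> ds
     + (case h' of None \<Rightarrow> 0
        | Some e \<Rightarrow> - edge_gain \<Upsilon> e * of_int (walk_sign \<Upsilon> ds) * of_int (orient \<Upsilon> e 0))"


section \<open>Circles, sign circuits, balance\<close>

definition verts_of :: "('v, 'e, 'k) gsgraph \<Rightarrow> 'e set \<Rightarrow> 'v set" where
  "verts_of \<Upsilon> A = (\<Union>e\<in>A. set (ends \<Upsilon> e))"

definition degree_in :: "('v, 'e, 'k) gsgraph \<Rightarrow> 'e set \<Rightarrow> 'v \<Rightarrow> nat" where
  "degree_in \<Upsilon> A v = card {(e, i). e \<in> A \<and> i < length (ends \<Upsilon> e) \<and> ends \<Upsilon> e ! i = v}"

definition joined_in :: "('v, 'e, 'k) gsgraph \<Rightarrow> 'e set \<Rightarrow> 'v \<Rightarrow> 'v \<Rightarrow> bool" where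
  "joined_in \<Upsilon> A u w \<longleftrightarrow> (\<exists>ds. walk \<Upsilon> u ds w \<and> walk_edges ds \<subseteq> A)"

definition circle :: "('v, 'e, 'k) gsgraph \<Rightarrow> 'e set \<Rightarrow> bool" where
  "circle \<Upsilon> C \<longleftrightarrow> C \<noteq> {} \<and> C \<subseteq> links_loops \<Upsilon>
     \<and> (\<forall>u\<in>verts_of \<Upsilon> C. \<forall>w\<in>verts_of \<Upsilon> C. joined_in \<Upsilon> C u w)
     \<and> (\<forall>v\<in>verts_of \<Upsilon> C. degree_in \<Upsilon> C v = 2)"

definition positive_circle :: "('v, 'e, 'k) gsgraph \<Rightarrow> 'e set \<Rightarrow> bool" where
  "positive_circle \<Upsilon> C \<longleftrightarrow> circle \<Upsilon> C \<and> (\<Prod>e\<in>C. edge_sign \<Upsilon> e) = 1"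

definition negative_circle :: "('v, 'e, 'k) gsgraph \<Rightarrow> 'e set \<Rightarrow> bool" where
  "negative_circle \<Upsilon> C \<longleftrightarrow> circle \<Upsilon> C \<and> (\<Prod>e\<in>C. edge_sign \<Upsilon> e) = -1"

definition negative_figure :: "('v, 'e, 'k) gsgraph \<Rightarrow> 'e set \<Rightarrow> bool" where
  "negative_figure \<Upsilon> C \<longleftrightarrow> negative_circle \<Upsilon> C \<or> (\<exists>h\<in>half_edges \<Upsilon>. C = {h})"

text \<open>
  A handcuff with figures \<open>C\<^sub>1\<close>, \<open>C\<^sub>2\<close> and connecting path \<open>p\<close> from \<open>u\<close> to \<open>w\<close>; the path has
  length 0 if the figures have a common vertex.  The condition \<open>C\<^sub>1 \<noteq> C\<^sub>2\<close> matters when the figures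
  share a vertex: a single negative loop or half edge has just one vertex.
\<close>

definition handcuff ::
    "('v, 'e, 'k) gsgraph \<Rightarrow> 'e set \<Rightarrow> 'v \<Rightarrow> ('e \<times> nat) list \<Rightarrow> 'v \<Rightarrow> 'e set \<Rightarrow> bool" where
  "handcuff \<Upsilon> C\<^sub>1 u p w C\<^sub>2 \<longleftrightarrow>
     negative_figure \<Upsilon> C\<^sub>1 \<and> negative_figure \<Upsilon> C\<^sub>2 \<and> C\<^sub>1 \<noteq> C\<^sub>2 \<and> is_path \<Upsilon> u p w \<and>
     (verts_of \<Upsilon> C\<^sub>1 \<inter> verts_of \<Upsilon> C\<^sub>2 = {u} \<and> p = [] \<or>
      verts_of \<Upsilon> C\<^sub>1 \<inter> verts_of \<Upsilon> C\<^sub>2 = {} \<and>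
      set (walk_verts \<Upsilon> u p) \<inter> verts_of \<Upsilon> C\<^sub>1 = {u} \<and>
      set (walk_verts \<Upsilon> u p) \<inter> verts_of \<Upsilon> C\<^sub>2 = {w})"

definition sign_circuit :: "('v, 'e, 'k) gsgraph \<Rightarrow> 'e set \<Rightarrow> bool" where
  "sign_circuit \<Upsilon> C \<longleftrightarrow>
     positive_circle \<Upsilon> C \<or> (\<exists>e\<in>loose_edges \<Upsilon>. C = {e}) \<or>
     (\<exists>C\<^sub>1 u p w C\<^sub>2. handcuff \<Upsilon> C\<^sub>1 u p w C\<^sub>2 \<and> C = C\<^sub>1 \<union> walk_edges p \<union> C\<^sub>2)"

definition walk_around :: "('v, 'e, 'k) gsgraph \<Rightarrow> 'e set \<Rightarrow> 'v \<Rightarrow> ('e \<times> nat) list \<Rightarrow> bool" where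
  "walk_around \<Upsilon> C u ds \<longleftrightarrow> walk \<Upsilon> u ds u \<and> distinct (map fst ds) \<and> walk_edges ds = C"

text \<open>
  \<open>circuit_gain \<Upsilon> C g\<close>: some circuit walk of the sign circuit \<open>C\<close> has gain \<open>g\<close>.  The gain depends on
  the circuit walk only up to sign, so neutrality does not depend on it.
\<close>

inductive circuit_gain :: "('v, 'e, 'k::field) gsgraph \<Rightarrow> 'e set \<Rightarrow> 'k \<Rightarrow> bool" for \<Upsilon> where
  loose: "e \<in> loose_edges \<Upsilon> \<Longrightarrow> circuit_gain \<Upsilon> {e} (edge_gain \<Upsilon> e)"
| positive_circle:
    "positive_circle \<Upsilon> C \<Longrightarrow> walk_around \<Upsilon> C u c \<Longrightarrow> circuit_gain \<Upsilon> C (walk_gain \<Upsilon> c)"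
| circle_circle:
    "handcuff \<Upsilon> C\<^sub>1 u p w C\<^sub>2 \<Longrightarrow> negative_circle \<Upsilon> C\<^sub>1 \<Longrightarrow> negative_circle \<Upsilon> C\<^sub>2 \<Longrightarrow>
     walk_around \<Upsilon> C\<^sub>1 u c\<^sub>1 \<Longrightarrow> walk_around \<Upsilon> C\<^sub>2 w c\<^sub>2 \<Longrightarrow>
     circuit_gain \<Upsilon> (C\<^sub>1 \<union> walk_edges p \<union> C\<^sub>2) (walk_gain \<Upsilon> (c\<^sub>1 @ p @ c\<^sub>2 @ reverse_walk p))"
| half_circle:
    "handcuff \<Upsilon> {h} u p w C\<^sub>2 \<Longrightarrow> h \<in> half_edges \<Upsilon> \<Longrightarrow> negative_circle \<Upsilon> C\<^sub>2 \<Longrightarrow>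
     walk_around \<Upsilon> C\<^sub>2 w c\<^sub>2 \<Longrightarrow>
     circuit_gain \<Upsilon> ({h} \<union> walk_edges p \<union> C\<^sub>2)
       (ultrawalk_gain \<Upsilon> (Some h) (p @ c\<^sub>2 @ reverse_walk p) (Some h))"
| half_half:
    "handcuff \<Upsilon> {h\<^sub>1} u p w {h\<^sub>2} \<Longrightarrow> h\<^sub>1 \<in> half_edges \<Upsilon> \<Longrightarrow> h\<^sub>2 \<in> half_edges \<Upsilon> \<Longrightarrow>
     circuit_gain \<Upsilon> ({h\<^sub>1} \<union> walk_edges p \<union> {h\<^sub>2})
       (ultrawalk_gain \<Upsilon> (Some h\<^sub>1) p (Some h\<^sub>2))"

definition neutral_circuit :: "('v, 'e, 'k::field) gsgraph \<Rightarrow> 'e set \<Rightarrow> bool" where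
  "neutral_circuit \<Upsilon> C \<longleftrightarrow> sign_circuit \<Upsilon> C \<and> circuit_gain \<Upsilon> C 0"

definition hyperbalanced :: "('v, 'e, 'k::field) gsgraph \<Rightarrow> 'e set \<Rightarrow> bool" where
  "hyperbalanced \<Upsilon> S \<longleftrightarrow> (\<forall>C. sign_circuit \<Upsilon> C \<and> C \<subseteq> S \<longrightarrow> neutral_circuit \<Upsilon> C)"

abbreviation hyperfrustrated :: "('v, 'e, 'k::field) gsgraph \<Rightarrow> 'e set \<Rightarrow> bool" where
  "hyperfrustrated \<Upsilon> S \<equiv> \<not> hyperbalanced \<Upsilon> S"

definition sign_balanced :: "('v, 'e, 'k) gsgraph \<Rightarrow> 'e set \<Rightarrow> bool" where
  "sign_balanced \<Upsilon> S \<longleftrightarrow> (\<forall>C. C \<subseteq> S \<longrightarrow> \<not> negative_circle \<Upsilon> C) \<and> S \<inter> half_edges \<Upsilon> = {}"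

definition bal_closure :: "('v, 'e, 'k::field) gsgraph \<Rightarrow> 'e set \<Rightarrow> 'e set" where
  "bal_closure \<Upsilon> S =
     S \<union> {e \<in> edges \<Upsilon>. e \<notin> S \<and> (\<exists>C. neutral_circuit \<Upsilon> C \<and> e \<in> C \<and> C \<subseteq> insert e S)}"


section \<open>Induced edge sets and components\<close>

text \<open>$A{:}X$ and $A{:}\pi$; loose edges never belong to these sets.\<close>

definition induced :: "('v, 'e, 'k) gsgraph \<Rightarrow> 'e set \<Rightarrow> 'v set \<Rightarrow> 'e set" where
  "induced \<Upsilon> A X = {e \<in> A. ends \<Upsilon> e \<noteq> [] \<and> set (ends \<Upsilon> e) \<subseteq> X}"

definition induced_part :: "('v, 'e, 'k) gsgraph \<Rightarrow> 'e set \<Rightarrow> 'v set set \<Rightarrow> 'e set" where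
  "induced_part \<Upsilon> A P = (\<Union>B\<in>P. induced \<Upsilon> A B)"

definition components :: "('v, 'e, 'k) gsgraph \<Rightarrow> 'e set \<Rightarrow> 'v set set" where
  "components \<Upsilon> S = verts \<Upsilon> // {(u, w). u \<in> verts \<Upsilon> \<and> w \<in> verts \<Upsilon> \<and> joined_in \<Upsilon> S u w}"

definition bal_components :: "('v, 'e, 'k) gsgraph \<Rightarrow> 'e set \<Rightarrow> 'v set set" where
  "bal_components \<Upsilon> S = {B \<in> components \<Upsilon> S. sign_balanced \<Upsilon> (induced \<Upsilon> S B)}"

definition unbal_verts :: "('v, 'e, 'k) gsgraph \<Rightarrow> 'e set \<Rightarrow> 'v set" where
  "unbal_verts \<Upsilon> S = verts \<Upsilon> - \<Union> (bal_components \<Upsilon> S)"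


section \<open>Potentials\<close>

text \<open>$E(\zeta)$ for a function $\zeta$ with domain \<open>X\<close>.\<close>

definition sign_edges :: "('v, 'e, 'k) gsgraph \<Rightarrow> 'v set \<Rightarrow> ('v \<Rightarrow> int) \<Rightarrow> 'e set" where
  "sign_edges \<Upsilon> X \<zeta> = {e \<in> links_loops \<Upsilon>. set (ends \<Upsilon> e) \<subseteq> X \<and>
     edge_sign \<Upsilon> e = \<zeta> (ends \<Upsilon> e ! 0) * \<zeta> (ends \<Upsilon> e ! 1)}"

definition sign_potential ::
    "('v, 'e, 'k) gsgraph \<Rightarrow> 'v set \<Rightarrow> ('v \<Rightarrow> int) \<Rightarrow> 'e set \<Rightarrow> bool" where
  "sign_potential \<Upsilon> X \<zeta> A \<longleftrightarrow> \<zeta> \<in> X \<rightarrow> {1, -1} \<and> A \<subseteq> sign_edges \<Upsilon> X \<zeta>"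

text \<open>Summing over edge ends covers links, loops, half edges and loose edges uniformly.\<close>

definition switched_gain :: "('v, 'e, 'k::field) gsgraph \<Rightarrow> ('v \<Rightarrow> 'k) \<Rightarrow> 'e \<Rightarrow> 'k" where
  "switched_gain \<Upsilon> \<theta> e =
     edge_gain \<Upsilon> e + (\<Sum>i<length (ends \<Upsilon> e). of_int (orient \<Upsilon> e i) * \<theta> (ends \<Upsilon> e ! i))"

definition gain_edges :: "('v, 'e, 'k::field) gsgraph \<Rightarrow> ('v \<Rightarrow> 'k) \<Rightarrow> 'e set" where
  "gain_edges \<Upsilon> \<theta> = {e \<in> edges \<Upsilon>. switched_gain \<Upsilon> \<theta> e = 0}"

definition gain_potential :: "('v, 'e, 'k::field) gsgraph \<Rightarrow> ('v \<Rightarrow> 'k) \<Rightarrow> 'e set \<Rightarrow> bool" where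
  "gain_potential \<Upsilon> \<eta> A \<longleftrightarrow> A \<subseteq> gain_edges \<Upsilon> (\<lambda>v. - \<eta> v)"

definition gain_sign_edges ::
    "('v, 'e, 'k::field) gsgraph \<Rightarrow> ('v \<Rightarrow> 'k) \<Rightarrow> 'v set \<Rightarrow> ('v \<Rightarrow> int) \<Rightarrow> 'e set" where
  "gain_sign_edges \<Upsilon> \<theta> X \<zeta> = gain_edges \<Upsilon> \<theta> \<inter> sign_edges \<Upsilon> X \<zeta>"


section \<open>Matroids and closures\<close>

text \<open>A matroid is represented by its ground set \<open>E\<close> and rank function \<open>r\<close>.\<close>

definition matroid_closure :: "'a set \<Rightarrow> ('a set \<Rightarrow> int) \<Rightarrow> 'a set \<Rightarrow> 'a set" where
  "matroid_closure E r S = {e \<in> E. r (insert e S) = r S}"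

definition frame_rank :: "('v, 'e, 'k) gsgraph \<Rightarrow> 'e set \<Rightarrow> int" where
  "frame_rank \<Upsilon> S = int (card (verts \<Upsilon>)) - int (card (bal_components \<Upsilon> S))"

definition gsg_rank :: "('v, 'e, 'k::field) gsgraph \<Rightarrow> 'e set \<Rightarrow> int" where
  "gsg_rank \<Upsilon> S = int (card (verts \<Upsilon>)) - int (card (bal_components \<Upsilon> S))
     + (if hyperbalanced \<Upsilon> S then 0 else 1)"

text \<open>
  The graph on the edge set $E \cup \{e_\infty\}$: the edges of \<open>\<Upsilon>\<close> appear as \<open>Some e\<close>, and \<open>None\<close>
  is $e_\infty$, a loose edge whose gain is some nonzero scalar, here 1.
\<close>

definition add_infinity :: "('v, 'e, 'k::field) gsgraph \<Rightarrow> ('v, 'e option, 'k) gsgraph" where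
  "add_infinity \<Upsilon> = \<lparr>
     verts = verts \<Upsilon>,
     edges = insert None (Some ` edges \<Upsilon>),
     ends = case_option [] (ends \<Upsilon>),
     edge_sign = case_option 1 (edge_sign \<Upsilon>),
     orient = case_option (\<lambda>_. 1) (orient \<Upsilon>),
     edge_gain = case_option 1 (edge_gain \<Upsilon>)\<rparr>"

definition clos_gsg :: "('v, 'e, 'k::field) gsgraph \<Rightarrow> 'e set \<Rightarrow> 'e set" where
  "clos_gsg \<Upsilon> = matroid_closure (edges \<Upsilon>) (gsg_rank \<Upsilon>)"

definition clos_frame :: "('v, 'e, 'k) gsgraph \<Rightarrow> 'e set \<Rightarrow> 'e set" where
  "clos_frame \<Upsilon> = matroid_closure (edges \<Upsilon>) (frame_rank \<Upsilon>)"

definition clos_inf :: "('v, 'e, 'k::field) gsgraph \<Rightarrow> 'e option set \<Rightarrow> 'e option set" where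
  "clos_inf \<Upsilon> = matroid_closure (edges (add_infinity \<Upsilon>)) (gsg_rank (add_infinity \<Upsilon>))"

end

theory Submission
  imports Defs
begin

text \<open>
  Every end sum \<open>\<tau>(v,e) x(v) + \<tau>(w,e) x(w)\<close> is a linear form in \<open>x\<close>, and switching by \<open>\<theta>\<close> adds its
  value at \<open>\<theta>\<close> to the gain of \<open>e\<close>.  Over \<open>{-1, 0, 1}\<close> the common zeros of the forms of \<open>S\<close> are the
  multiples of a sign potential on each balanced component, extended by 0; there are \<open>3 ^ b(S)\<close> of
  them, so \<open>e\<close> lies in the frame closure of \<open>S\<close> iff its form vanishes on all of them.  In that case
  a sign circuit runs through \<open>e\<close> in \<open>S \<union> {e}\<close>.  The gain of a sign circuit is a linear form in the
  edge gains which is invariant under switching and, since the characteristic is not 2, has nonzero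
  coefficients on the whole circuit.  Hence \<open>S\<close> is hyperbalanced iff some switching makes all its
  gains zero, and both closures can be read off.
\<close>

text \<open>The values \<open>{-1, 0, 1}\<close> serve two purposes. The kernel becomes a finite
  set, so the effect of a new edge is measured by counting, and no merging of components has to be
  followed. Each form then takes integer values between -2 and 2, so a nonzero integer value stays
  nonzero in \<open>'k\<close> once 2 is nonzero there. The same 2 is the coefficient of the edges
  on the connecting path of a handcuff with a circle, which the circuit walk traverses twice; in
  characteristic 2 they would drop out of the gain. The combinatorial obstacle is to produce a
  circuit through an edge with both ends in unbalanced components: whether it is a circle or a
  handcuff depends on how the paths to negative figures meet. The converse is algebraic: a form with
  full support that no switching changes annihilates the kernel vectors, so a circuit through
  \<open>e\<close> puts \<open>e\<close> into the frame span. The extended matroid needs no separate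
  argument, since the enlarged graph is again a gain signed graph, in which \<open>None\<close> has
  an empty form and a gain that no switching alters.\<close>

declare step_head.simps [simp del] step_tail.simps [simp del]

section \<open>Walks\<close>

lemma walk_edges_simps [simp]:
  "walk_edges [] = {}"
  "walk_edges (d # ds) = insert (fst d) (walk_edges ds)"
  "walk_edges (ds @ ds') = walk_edges ds \<union> walk_edges ds'"
  by (auto simp: walk_edges_def)

lemma walk_edges_eq_set: "walk_edges ds = set (map fst ds)"
  by (simp add: walk_edges_def)

lemma reverse_walk_simps [simp]:
  "reverse_walk [] = []"
  "reverse_walk (d # ds) = reverse_walk ds @ [(fst d, 1 - snd d)]"
  "reverse_walk (ds @ ds') = reverse_walk ds' @ reverse_walk ds"
  by (auto simp: reverse_walk_def split: prod.splits)

lemma walk_edges_reverse_walk [simp]: "walk_edges (reverse_walk ds) = walk_edges ds"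
  by (induction ds) auto

lemma walk_sign_Nil [simp]: "walk_sign \<Upsilon> [] = 1"
  by (simp add: walk_sign_def)

lemma walk_sign_Cons [simp]: "walk_sign \<Upsilon> (d # ds) = edge_sign \<Upsilon> (fst d) * walk_sign \<Upsilon> ds"
  unfolding walk_sign_def by (simp add: prod.lessThan_Suc_shift del: prod.lessThan_Suc)

lemma walk_sign_append [simp]: "walk_sign \<Upsilon> (ds @ ds') = walk_sign \<Upsilon> ds * walk_sign \<Upsilon> ds'"
  by (induction ds) auto

lemma walk_sign_reverse_walk [simp]: "walk_sign \<Upsilon> (reverse_walk ds) = walk_sign \<Upsilon> ds"
  by (induction ds) auto

lemma walk_sign_distinct:
  "distinct (map fst ds) \<Longrightarrow> walk_sign \<Upsilon> ds = (\<Prod>e\<in>walk_edges ds. edge_sign \<Upsilon> e)"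
  by (induction ds) (auto simp: walk_edges_eq_set)

lemma walk_verts_simps [simp]:
  "walk_verts \<Upsilon> u [] = [u]"
  "walk_verts \<Upsilon> u (d # ds) = u # walk_verts \<Upsilon> (step_head \<Upsilon> d) ds"
  by (auto simp: walk_verts_def)

lemma walk_verts_append: "walk_verts \<Upsilon> u (p @ q) = walk_verts \<Upsilon> u p @ map (step_head \<Upsilon>) q"
  by (simp add: walk_verts_def)

lemma start_in_walk_verts [simp]: "u \<in> set (walk_verts \<Upsilon> u ds)"
  by (simp add: walk_verts_def)

lemma end_in_walk_verts: "walk \<Upsilon> u ds w \<Longrightarrow> w \<in> set (walk_verts \<Upsilon> u ds)"
  by (induction ds arbitrary: u) auto

lemma walk_tails_heads:
  "walk \<Upsilon> u ds w \<Longrightarrow> map (step_tail \<Upsilon>) ds @ [w] = u # map (step_head \<Upsilon>) ds"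
  by (induction ds arbitrary: u) auto

lemma walk_split_at:
  assumes "walk \<Upsilon> u ds w" "x \<in> set (walk_verts \<Upsilon> u ds)" "x \<in> verts \<Upsilon>"
  obtains p q where "ds = p @ q" "walk \<Upsilon> u p x" "walk \<Upsilon> x q w"
proof -
  have "\<exists>p q. ds = p @ q \<and> walk \<Upsilon> u p x \<and> walk \<Upsilon> x q w"
    using assms(1,2)
  proof (induction ds arbitrary: u)
    case Nil
    then show ?case by auto
  next
    case (Cons d ds)
    show ?case
    proof (cases "x = u")
      case True
      then show ?thesis using Cons.prems assms(3) by (intro exI[of _ "[]"] exI[of _ "d # ds"]) auto
    next
      case False
      then have "\<exists>p q. ds = p @ q \<and> walk \<Upsilon> (step_head \<Upsilon> d) p x \<and> walk \<Upsilon> x q w"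
        using Cons.prems by (intro Cons.IH) auto
      then obtain p q where "ds = p @ q" "walk \<Upsilon> (step_head \<Upsilon> d) p x" "walk \<Upsilon> x q w" by blast
      then show ?thesis using Cons.prems by (intro exI[of _ "d # p"] exI[of _ q]) auto
    qed
  qed
  with that show thesis by blast
qed

text \<open>The last vertex of a nonempty walk is the head of a step; in a closed walk this repeats
  the start.\<close>

lemma is_path_closed_Nil: "is_path \<Upsilon> u p u \<Longrightarrow> p = []"
  using end_in_walk_verts[of \<Upsilon> _ _ u] by (cases p) (auto simp: is_path_def)

context gain_signed_graph
begin

lemma ends_link_loop:
  assumes "fst d \<in> links_loops \<Upsilon>" "snd d < 2"
  shows "set (ends \<Upsilon> (fst d)) = {step_tail \<Upsilon> d, step_head \<Upsilon> d}"
proof -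
  obtain e i where d: "d = (e, i)" by force
  then obtain a b where "ends \<Upsilon> e = [a, b]"
    using assms by (auto simp: links_loops_def numeral_2_eq_2 length_Suc_conv)
  then show ?thesis using d assms by (cases i) (auto simp: less_Suc_eq numeral_2_eq_2 step_head.simps step_tail.simps)
qed

lemma step_in_verts:
  assumes "fst d \<in> links_loops \<Upsilon>" "snd d < 2"
  shows "step_tail \<Upsilon> d \<in> verts \<Upsilon>" "step_head \<Upsilon> d \<in> verts \<Upsilon>"
  using ends_link_loop[OF assms] ends_in_verts[of "fst d"] assms by (auto simp: links_loops_def)


lemma walk_ends_in_verts:
  assumes "walk \<Upsilon> u ds w"
  shows "u \<in> verts \<Upsilon>" "w \<in> verts \<Upsilon>"
proof -
  show "u \<in> verts \<Upsilon>" using assms step_in_verts by (cases ds) auto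
  show "w \<in> verts \<Upsilon>" using assms
  proof (induction ds arbitrary: u)
    case Nil
    then show ?case by (auto simp only: walk.simps)
  next
    case (Cons d ds)
    then show ?case by (auto simp only: walk.simps)
  qed
qed

lemma walk_append_iff:
  "walk \<Upsilon> u (p @ q) w \<longleftrightarrow> (\<exists>x. walk \<Upsilon> u p x \<and> walk \<Upsilon> x q w)"
  by (induction p arbitrary: u) (auto simp: walk_ends_in_verts)

lemma walk_single:
  assumes "e \<in> links_loops \<Upsilon>" "i < 2"
  shows "walk \<Upsilon> (step_tail \<Upsilon> (e, i)) [(e, i)] (step_head \<Upsilon> (e, i))"
  using assms step_in_verts(2)[of "(e, i)"] by simp

lemma reverse_step:
  assumes "snd d < 2"
  shows "step_tail \<Upsilon> (fst d, 1 - snd d) = step_head \<Upsilon> d"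
    "step_head \<Upsilon> (fst d, 1 - snd d) = step_tail \<Upsilon> d"
  using assms by (cases d; simp add: step_head.simps step_tail.simps)+

lemma walk_reverse:
  "walk \<Upsilon> u ds w \<Longrightarrow> walk \<Upsilon> w (reverse_walk ds) u"
proof (induction ds arbitrary: u)
  case Nil
  then show ?case by auto
next
  case (Cons d ds)
  then have "walk \<Upsilon> w (reverse_walk ds) (step_head \<Upsilon> d)" by simp
  moreover have "walk \<Upsilon> (step_head \<Upsilon> d) [(fst d, 1 - snd d)] u"
    using Cons.prems reverse_step[of d] step_in_verts[of d] by auto
  ultimately show ?case by (auto simp: walk_append_iff simp del: walk.simps)
qed

lemma walk_edges_links: "walk \<Upsilon> u ds w \<Longrightarrow> walk_edges ds \<subseteq> links_loops \<Upsilon>"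
  by (induction ds arbitrary: u) auto

lemma walk_verts_in_verts: "walk \<Upsilon> u ds w \<Longrightarrow> set (walk_verts \<Upsilon> u ds) \<subseteq> verts \<Upsilon>"
  by (induction ds arbitrary: u) (use walk_ends_in_verts in \<open>auto dest: step_in_verts\<close>)

lemma set_walk_verts_append:
  "walk \<Upsilon> u p x \<Longrightarrow>
    set (walk_verts \<Upsilon> u (p @ q)) = set (walk_verts \<Upsilon> u p) \<union> set (walk_verts \<Upsilon> x q)"
  using end_in_walk_verts[of \<Upsilon> u p x] by (simp add: walk_verts_append) (auto simp: walk_verts_def)

lemma walk_verts_eq_verts_of:
  "walk \<Upsilon> u ds w \<Longrightarrow> set (walk_verts \<Upsilon> u ds) = insert u (verts_of \<Upsilon> (walk_edges ds))"
proof (induction ds arbitrary: u)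
  case Nil
  then show ?case by (simp add: verts_of_def)
next
  case (Cons d ds)
  then have "set (walk_verts \<Upsilon> (step_head \<Upsilon> d) ds)
      = insert (step_head \<Upsilon> d) (verts_of \<Upsilon> (walk_edges ds))" by simp
  then show ?case using Cons.prems ends_link_loop[of d] by (auto simp: verts_of_def)
qed

lemma verts_of_walk_edges:
  assumes "walk \<Upsilon> u ds w" "ds \<noteq> []"
  shows "verts_of \<Upsilon> (walk_edges ds) = set (walk_verts \<Upsilon> u ds)"
proof -
  have "u \<in> verts_of \<Upsilon> (walk_edges ds)"
    using assms ends_link_loop by (cases ds) (auto simp: verts_of_def)
  then show ?thesis using walk_verts_eq_verts_of[OF assms(1)] by auto
qed

lemma set_walk_verts_reverse:
  assumes "walk \<Upsilon> u ds w"
  shows "set (walk_verts \<Upsilon> w (reverse_walk ds)) = set (walk_verts \<Upsilon> u ds)"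
  using walk_verts_eq_verts_of[OF assms] walk_verts_eq_verts_of[OF walk_reverse[OF assms]]
    end_in_walk_verts[OF assms] end_in_walk_verts[OF walk_reverse[OF assms]] by auto

lemma walk_verts_reverse:
  assumes "walk \<Upsilon> u ds w"
  shows "walk_verts \<Upsilon> w (reverse_walk ds) = rev (walk_verts \<Upsilon> u ds)"
  using assms
proof (induction ds arbitrary: u)
  case Nil
  then show ?case by simp
next
  case (Cons d ds)
  then have "walk_verts \<Upsilon> w (reverse_walk ds) = rev (walk_verts \<Upsilon> (step_head \<Upsilon> d) ds)" by simp
  then show ?case using Cons.prems reverse_step[of d]
    by (simp add: walk_verts_append del: step_head.simps step_tail.simps)
qed

lemma is_path_reverse: "is_path \<Upsilon> u p w \<Longrightarrow> is_path \<Upsilon> w (reverse_walk p) u"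
  by (auto simp: is_path_def walk_reverse walk_verts_reverse)

text \<open>A path never returns to \<open>u\<close>, while every edge of the first step is incident
  with \<open>u\<close>, so no later step can use it.\<close>

lemma is_path_distinct_edges: "is_path \<Upsilon> u ds w \<Longrightarrow> distinct (map fst ds)"
proof (induction ds arbitrary: u)
  case Nil
  then show ?case by simp
next
  case (Cons d ds)
  have w: "walk \<Upsilon> (step_head \<Upsilon> d) ds w" and d: "fst d \<in> links_loops \<Upsilon>" "snd d < 2" "step_tail \<Upsilon> d = u"
    and u: "u \<notin> set (walk_verts \<Upsilon> (step_head \<Upsilon> d) ds)"
    using Cons.prems by (auto simp: is_path_def)
  have "fst d \<notin> walk_edges ds"
    using u d ends_link_loop[of d] walk_verts_eq_verts_of[OF w] by (auto simp: verts_of_def)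
  moreover have "distinct (map fst ds)"
    using Cons.prems by (intro Cons.IH) (auto simp: is_path_def)
  ultimately show ?case by (auto simp: walk_edges_eq_set)
qed

lemma is_path_append:
  assumes "is_path \<Upsilon> u p x" "is_path \<Upsilon> x q w"
    "set (walk_verts \<Upsilon> u p) \<inter> set (walk_verts \<Upsilon> x q) = {x}"
  shows "is_path \<Upsilon> u (p @ q) w"
proof -
  have x: "walk_verts \<Upsilon> x q = x # map (step_head \<Upsilon>) q" by (simp add: walk_verts_def)
  have "set (walk_verts \<Upsilon> u p) \<inter> set (map (step_head \<Upsilon>) q) \<subseteq> {x}"
    "x \<notin> set (map (step_head \<Upsilon>) q)"
    using assms(2,3) unfolding x is_path_def by auto
  then have "distinct (walk_verts \<Upsilon> u (p @ q))"
    using assms(1,2) unfolding walk_verts_append distinct_append is_path_def x by auto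
  then show ?thesis using assms(1,2) by (auto simp: is_path_def walk_append_iff)
qed

lemma is_path_split_at:
  assumes "is_path \<Upsilon> u p w" "x \<in> set (walk_verts \<Upsilon> u p)"
  obtains p1 p2 where "p = p1 @ p2" "is_path \<Upsilon> u p1 x" "is_path \<Upsilon> x p2 w"
    "set (walk_verts \<Upsilon> u p1) \<inter> set (walk_verts \<Upsilon> x p2) = {x}"
    "set (walk_verts \<Upsilon> u p) = set (walk_verts \<Upsilon> u p1) \<union> set (walk_verts \<Upsilon> x p2)"
proof -
  have w: "walk \<Upsilon> u p w" and dst: "distinct (walk_verts \<Upsilon> u p)"
    using assms by (auto simp: is_path_def)
  obtain p1 p2 where p: "p = p1 @ p2" "walk \<Upsilon> u p1 x" "walk \<Upsilon> x p2 w"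
    using walk_split_at[OF w assms(2)] walk_verts_in_verts[OF w] assms(2) by blast
  have x1: "x \<in> set (walk_verts \<Upsilon> u p1)" by (rule end_in_walk_verts[OF p(2)])
  have d: "distinct (walk_verts \<Upsilon> u p1 @ map (step_head \<Upsilon>) p2)"
    using dst p(1) by (simp add: walk_verts_append)
  have x: "walk_verts \<Upsilon> x p2 = x # map (step_head \<Upsilon>) p2" by (simp add: walk_verts_def)
  show thesis
    by (rule that[of p1 p2]) (use p d x x1 set_walk_verts_append[OF p(2), of p2] in
        \<open>auto simp: is_path_def\<close>)
qed

text \<open>Loop erasure, stopped at the first vertex of \<open>X\<close>. The path for the tail of
  the walk is cut at \<open>u\<close> if it passes through \<open>u\<close>, and otherwise the first
  step is put in front; if \<open>u\<close> is in \<open>X\<close>, the empty path is taken. Both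
  the connecting path of a handcuff and the paths closing circles come from here.\<close>

lemma walk_first_hit:
  assumes "walk \<Upsilon> u ds w" "w \<in> X"
  obtains p a where "is_path \<Upsilon> u p a" "walk_edges p \<subseteq> walk_edges ds"
    "set (walk_verts \<Upsilon> u p) \<inter> X = {a}"
proof -
  have "\<exists>p a. is_path \<Upsilon> u p a \<and> walk_edges p \<subseteq> walk_edges ds \<and> set (walk_verts \<Upsilon> u p) \<inter> X = {a}"
    using assms
  proof (induction ds arbitrary: u)
    case Nil
    then show ?case by (intro exI[of _ "[]"]) (auto simp: is_path_def)
  next
    case (Cons d ds)
    show ?case
    proof (cases "u \<in> X")
      case True
      then show ?thesis using walk_ends_in_verts[OF Cons.prems(1)]
        by (intro exI[of _ "[]"]) (auto simp: is_path_def)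
    next
      case uX: False
      have "\<exists>p a. is_path \<Upsilon> (step_head \<Upsilon> d) p a \<and> walk_edges p \<subseteq> walk_edges ds \<and>
          set (walk_verts \<Upsilon> (step_head \<Upsilon> d) p) \<inter> X = {a}"
        using Cons.prems by (intro Cons.IH) auto
      then obtain p a where p: "is_path \<Upsilon> (step_head \<Upsilon> d) p a" "walk_edges p \<subseteq> walk_edges ds"
        "set (walk_verts \<Upsilon> (step_head \<Upsilon> d) p) \<inter> X = {a}" by blast
      show ?thesis
      proof (cases "u \<in> set (walk_verts \<Upsilon> (step_head \<Upsilon> d) p)")
        case True
        then obtain p1 p2 where q: "p = p1 @ p2" "is_path \<Upsilon> u p2 a"
          "set (walk_verts \<Upsilon> (step_head \<Upsilon> d) p) =
            set (walk_verts \<Upsilon> (step_head \<Upsilon> d) p1) \<union> set (walk_verts \<Upsilon> u p2)"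
          using is_path_split_at[OF p(1)] by metis
        have "a \<in> set (walk_verts \<Upsilon> u p2)" using q(2) by (auto simp: is_path_def end_in_walk_verts)
        then show ?thesis using p q by (intro exI[of _ p2] exI[of _ a]) auto
      next
        case False
        then show ?thesis using p uX Cons.prems
          by (intro exI[of _ "d # p"] exI[of _ a]) (auto simp: is_path_def)
      qed
    qed
  qed
  with that show thesis by blast
qed

lemma walk_sign_values: "walk \<Upsilon> u ds w \<Longrightarrow> walk_sign \<Upsilon> ds \<in> {1, -1}"
proof (induction ds arbitrary: u)
  case (Cons d ds)
  then show ?case using edge_sign_values[of "fst d"] by (fastforce simp: links_loops_def)
qed simp

section \<open>Connectedness inside an edge set\<close>

lemma joined_in_refl: "u \<in> verts \<Upsilon> \<Longrightarrow> joined_in \<Upsilon> A u u"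
  unfolding joined_in_def by (intro exI[of _ "[]"]) auto

lemma joined_in_sym: "joined_in \<Upsilon> A u w \<Longrightarrow> joined_in \<Upsilon> A w u"
  unfolding joined_in_def using walk_reverse by (metis walk_edges_reverse_walk)

lemma joined_in_trans: "joined_in \<Upsilon> A u w \<Longrightarrow> joined_in \<Upsilon> A w x \<Longrightarrow> joined_in \<Upsilon> A u x"
  unfolding joined_in_def using walk_append_iff by (metis Un_least walk_edges_simps(3))

lemma joined_in_mono: "joined_in \<Upsilon> A u w \<Longrightarrow> A \<subseteq> B \<Longrightarrow> joined_in \<Upsilon> B u w"
  unfolding joined_in_def by blast

lemma joined_in_verts: "joined_in \<Upsilon> A u w \<Longrightarrow> u \<in> verts \<Upsilon> \<and> w \<in> verts \<Upsilon>"
  unfolding joined_in_def using walk_ends_in_verts by blast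

lemma walk_verts_joined:
  assumes "walk \<Upsilon> u ds w" "walk_edges ds \<subseteq> A" "x \<in> set (walk_verts \<Upsilon> u ds)"
  shows "joined_in \<Upsilon> A u x"
proof -
  obtain p q where "ds = p @ q" "walk \<Upsilon> u p x"
    using walk_split_at[OF assms(1,3)] walk_verts_in_verts[OF assms(1)] assms(3) by blast
  then show ?thesis using assms(2) unfolding joined_in_def by (intro exI[of _ p]) auto
qed

lemma edge_ends_joined:
  assumes "e \<in> A" "e \<in> edges \<Upsilon>" "x \<in> set (ends \<Upsilon> e)" "y \<in> set (ends \<Upsilon> e)"
  shows "joined_in \<Upsilon> A x y"
proof (cases "x = y")
  case True
  then show ?thesis using assms ends_in_verts joined_in_refl by blast
next
  case False
  obtain i j where ij: "i < length (ends \<Upsilon> e)" "x = ends \<Upsilon> e ! i" "j < length (ends \<Upsilon> e)" "y = ends \<Upsilon> e ! j"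
    using assms(3,4) by (metis in_set_conv_nth)
  have l: "length (ends \<Upsilon> e) = 2" "j = 1 - i"
  proof -
    have "i < 2" "j < 2" "i \<noteq> j" using ij False length_ends[OF assms(2)] by auto
    then show "length (ends \<Upsilon> e) = 2" "j = 1 - i" using ij length_ends[OF assms(2)] by linarith+
  qed
  then have "walk \<Upsilon> x [(e, i)] y"
    using ij assms ends_in_verts[of e] by (auto simp: links_loops_def step_head.simps step_tail.simps)
  then show ?thesis using assms(1) unfolding joined_in_def by (intro exI[of _ "[(e, i)]"]) auto
qed

end

section \<open>Circles\<close>

text \<open>Degrees are counts with multiplicity, so this is how bounds on degrees become statements
  about distinct vertices.\<close>

lemma distinct_iff_count_list_le_1: "distinct xs \<longleftrightarrow> (\<forall>x. count_list xs x \<le> 1)"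
proof (induction xs)
  case (Cons y ys)
  show ?case
  proof
    assume "distinct (y # ys)"
    then show "\<forall>x. count_list (y # ys) x \<le> 1" using Cons by auto
  next
    assume *: "\<forall>x. count_list (y # ys) x \<le> 1"
    then have "count_list ys y = 0" by (auto dest: spec[of _ y])
    moreover have "count_list ys x \<le> 1" for x using *[rule_format, of x] by (auto split: if_splits)
    ultimately show "distinct (y # ys)" using Cons by (auto simp: count_list_0_iff)
  qed
qed simp

context gain_signed_graph
begin

text \<open>Heads are listed because they count the base vertex once. Distinct edges must be
  required separately: going along a link and straight back gives distinct heads.\<close>

definition cycle_walk :: "'v \<Rightarrow> ('e \<times> nat) list \<Rightarrow> bool" where
  "cycle_walk u ds \<longleftrightarrow> walk \<Upsilon> u ds u \<and> ds \<noteq> []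
     \<and> distinct (map (step_head \<Upsilon>) ds) \<and> distinct (map fst ds)"

lemma links_loops_subset: "links_loops \<Upsilon> \<subseteq> edges \<Upsilon>"
  by (auto simp: links_loops_def)

lemma finite_links_loops: "finite (links_loops \<Upsilon>)"
  using finite_edges links_loops_subset finite_subset by blast

section \<open>Degrees as counts of tails and heads along a walk\<close>

lemma degree_in_sum:
  assumes "finite A"
  shows "degree_in \<Upsilon> A v = (\<Sum>e\<in>A. count_list (ends \<Upsilon> e) v)"
proof -
  have "{(e, i). e \<in> A \<and> i < length (ends \<Upsilon> e) \<and> ends \<Upsilon> e ! i = v}
      = (SIGMA e:A. {i. i < length (ends \<Upsilon> e) \<and> v = ends \<Upsilon> e ! i})" by auto
  then have "degree_in \<Upsilon> A v = (\<Sum>e\<in>A. card {i. i < length (ends \<Upsilon> e) \<and> v = ends \<Upsilon> e ! i})"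
    using assms unfolding degree_in_def by simp
  then show ?thesis by (simp add: count_list_eq_length_filter length_filter_conv_card)
qed

lemma count_ends_link_loop:
  assumes "fst d \<in> links_loops \<Upsilon>" "snd d < 2"
  shows "count_list (ends \<Upsilon> (fst d)) v
    = of_bool (step_tail \<Upsilon> d = v) + of_bool (step_head \<Upsilon> d = v)"
proof -
  obtain e i where d: "d = (e, i)" by force
  then obtain a b where "ends \<Upsilon> e = [a, b]"
    using assms by (auto simp: links_loops_def numeral_2_eq_2 length_Suc_conv)
  then show ?thesis using d assms
    by (cases i) (auto simp: less_Suc_eq numeral_2_eq_2 step_head.simps step_tail.simps)
qed

lemma degree_in_walk_edges:
  assumes "walk \<Upsilon> u ds w" "distinct (map fst ds)"
  shows "degree_in \<Upsilon> (walk_edges ds) v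
    = count_list (map (step_tail \<Upsilon>) ds) v + count_list (map (step_head \<Upsilon>) ds) v"
proof -
  have fin: "finite (walk_edges ds)" for ds :: "('e \<times> nat) list" by (simp add: walk_edges_def)
  show ?thesis using assms
  proof (induction ds arbitrary: u)
    case Nil
    then show ?case by (simp add: degree_in_def)
  next
    case (Cons d ds)
    have "fst d \<notin> walk_edges ds" using Cons.prems(2) by (simp add: walk_edges_eq_set)
    then have "degree_in \<Upsilon> (walk_edges (d # ds)) v
        = count_list (ends \<Upsilon> (fst d)) v + degree_in \<Upsilon> (walk_edges ds) v"
      by (simp add: degree_in_sum fin)
    then show ?case using Cons count_ends_link_loop[of d v] by auto
  qed
qed

text \<open>This is the parity argument for trails: the tails followed by \<open>w\<close> and the
  vertex \<open>u\<close> followed by the heads are the same list, so the two counts can differ only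
  at the ends of the walk.\<close>

lemma count_tails_heads:
  assumes "walk \<Upsilon> u ds w"
  shows "count_list (map (step_tail \<Upsilon>) ds) v + of_bool (w = v)
    = of_bool (u = v) + count_list (map (step_head \<Upsilon>) ds) v"
  using arg_cong[OF walk_tails_heads[OF assms], of "\<lambda>xs. count_list xs v"]
  by (simp add: of_bool_def split: if_splits)

lemma degree_in_mono: "finite B \<Longrightarrow> A \<subseteq> B \<Longrightarrow> degree_in \<Upsilon> A v \<le> degree_in \<Upsilon> B v"
  by (simp add: degree_in_sum finite_subset sum_mono2)

text \<open>Each edge at \<open>v\<close> raises the degree by at least one, so equal degrees leave
  no room for an edge of \<open>B\<close> outside \<open>A\<close>.\<close>

lemma degree_in_eq_incident:
  assumes "finite B" "A \<subseteq> B" "degree_in \<Upsilon> A v = degree_in \<Upsilon> B v" "e \<in> B" "v \<in> set (ends \<Upsilon> e)"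
  shows "e \<in> A"
proof (rule ccontr)
  assume e: "e \<notin> A"
  have "degree_in \<Upsilon> (insert e A) v = count_list (ends \<Upsilon> e) v + degree_in \<Upsilon> A v"
    using e assms finite_subset[OF assms(2,1)] by (simp add: degree_in_sum)
  moreover have "count_list (ends \<Upsilon> e) v > 0" using assms(5) by (metis count_list_0_iff gr0I)
  moreover have "degree_in \<Upsilon> (insert e A) v \<le> degree_in \<Upsilon> B v"
    using assms by (intro degree_in_mono) auto
  ultimately show False using assms(3) by simp
qed

lemma closed_walk_joined:
  assumes "walk \<Upsilon> u ds u" "x \<in> set (walk_verts \<Upsilon> u ds)" "y \<in> set (walk_verts \<Upsilon> u ds)"
  shows "joined_in \<Upsilon> (walk_edges ds) x y"
  using joined_in_trans[OF joined_in_sym[OF walk_verts_joined[OF assms(1) order_refl assms(2)]]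
      walk_verts_joined[OF assms(1) order_refl assms(3)]] .

text \<open>Each vertex is the head of exactly one step and, the walk being closed, the tail of
  exactly one; this gives degree 2, also for a loop, which is its own predecessor and
  successor.\<close>

lemma cycle_walk_circle:
  assumes "cycle_walk u ds"
  shows "circle \<Upsilon> (walk_edges ds)" "verts_of \<Upsilon> (walk_edges ds) = set (walk_verts \<Upsilon> u ds)"
    "walk_sign \<Upsilon> ds = (\<Prod>e\<in>walk_edges ds. edge_sign \<Upsilon> e)"
proof -
  have w: "walk \<Upsilon> u ds u" "ds \<noteq> []" "distinct (map (step_head \<Upsilon>) ds)" "distinct (map fst ds)"
    using assms by (auto simp: cycle_walk_def)
  show vo: "verts_of \<Upsilon> (walk_edges ds) = set (walk_verts \<Upsilon> u ds)"
    by (rule verts_of_walk_edges[OF w(1,2)])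
  have hd: "set (walk_verts \<Upsilon> u ds) = set (map (step_head \<Upsilon>) ds)"
  proof -
    have "last (map (step_tail \<Upsilon>) ds @ [u]) = last (u # map (step_head \<Upsilon>) ds)"
      using walk_tails_heads[OF w(1)] by metis
    then have "u \<in> set (map (step_head \<Upsilon>) ds)"
      using w(2) last_in_set[of "map (step_head \<Upsilon>) ds"] by (simp split: if_splits)
    then show ?thesis by (auto simp: walk_verts_def)
  qed
  have "degree_in \<Upsilon> (walk_edges ds) v = 2" if "v \<in> set (walk_verts \<Upsilon> u ds)" for v
  proof -
    have "count_list (map (step_head \<Upsilon>) ds) v = 1"
      using that hd w(3) unfolding distinct_iff_count_list_le_1
      by (metis count_list_0_iff le_antisym less_one linorder_not_less)
    then show ?thesis using degree_in_walk_edges[OF w(1,4), of v] count_tails_heads[OF w(1), of v] by simp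
  qed
  then show "circle \<Upsilon> (walk_edges ds)"
    unfolding circle_def vo using w(2) walk_edges_links[OF w(1)] closed_walk_joined[OF w(1)]
    by (auto simp: walk_edges_def)
  show "walk_sign \<Upsilon> ds = (\<Prod>e\<in>walk_edges ds. edge_sign \<Upsilon> e)"
    by (rule walk_sign_distinct[OF w(4)])
qed

text \<open>A longest trail in the circle starting at \<open>u\<close> must close up, by parity of the degree at its
  last vertex, and then it uses up the degree of each of its vertices.\<close>

lemma circle_cycle_walk:
  assumes C: "circle \<Upsilon> C" and u: "u \<in> verts_of \<Upsilon> C"
  obtains ds where "cycle_walk u ds" "walk_edges ds = C"
proof -
  have CL: "C \<subseteq> links_loops \<Upsilon>" and deg: "\<And>v. v \<in> verts_of \<Upsilon> C \<Longrightarrow> degree_in \<Upsilon> C v = 2"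
    and conn: "\<And>v. v \<in> verts_of \<Upsilon> C \<Longrightarrow> joined_in \<Upsilon> C u v"
    using C u by (auto simp: circle_def)
  have fC: "finite C" using CL finite_links_loops finite_subset by blast
  have uV: "u \<in> verts \<Upsilon>" using joined_in_verts[OF conn[OF u]] by simp
  define trail where
    "trail ds \<longleftrightarrow> (\<exists>w. walk \<Upsilon> u ds w) \<and> distinct (map fst ds) \<and> walk_edges ds \<subseteq> C" for ds
  have bound: "length ds \<le> card C" if "trail ds" for ds
  proof -
    have "length ds = card (walk_edges ds)"
      using that distinct_card[of "map fst ds"] by (simp add: trail_def walk_edges_eq_set del: set_map)
    then show ?thesis using that fC card_mono by (auto simp: trail_def)
  qed
  have "trail []" using uV by (auto simp: trail_def)
  then obtain ds where t: "trail ds" and max: "\<And>es. trail es \<Longrightarrow> length es \<le> length ds"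
    using ex_has_greatest_nat[of trail "[]" length "Suc (card C)"] bound by (metis less_Suc_eq_le)
  obtain w where w: "walk \<Upsilon> u ds w" using t by (auto simp: trail_def)
  have d: "distinct (map fst ds)" and sub: "walk_edges ds \<subseteq> C" using t by (auto simp: trail_def)
  have last: "e \<in> walk_edges ds" if e: "e \<in> C" "w \<in> set (ends \<Upsilon> e)" for e
  proof (rule ccontr)
    assume ne: "e \<notin> walk_edges ds"
    have eL: "e \<in> links_loops \<Upsilon>" using e CL by auto
    obtain i where i: "i < 2" "ends \<Upsilon> e ! i = w"
      using e(2) eL by (auto simp: in_set_conv_nth links_loops_def)
    have "walk \<Upsilon> w [(e, i)] (step_head \<Upsilon> (e, i))"
      using walk_single[OF eL i(1)] i(2) by (simp add: step_tail.simps)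
    then have "walk \<Upsilon> u (ds @ [(e, i)]) (step_head \<Upsilon> (e, i))" using w walk_append_iff by blast
    then have "trail (ds @ [(e, i)])" using d sub ne e by (auto simp: trail_def walk_edges_eq_set)
    from max[OF this] show False by simp
  qed
  have wC: "w \<in> verts_of \<Upsilon> C"
    using walk_verts_eq_verts_of[OF w] end_in_walk_verts[OF w] u sub by (auto simp: verts_of_def)
  have "degree_in \<Upsilon> (walk_edges ds) w = degree_in \<Upsilon> C w"
  proof -
    have "(\<Sum>e\<in>walk_edges ds. count_list (ends \<Upsilon> e) w) = (\<Sum>e\<in>C. count_list (ends \<Upsilon> e) w)"
      using last by (intro sum.mono_neutral_left[OF fC sub]) (auto simp: count_list_0_iff)
    then show ?thesis by (simp add: degree_in_sum fC finite_subset[OF sub fC])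
  qed
  then have degw: "degree_in \<Upsilon> (walk_edges ds) w = 2" using deg[OF wC] by simp
  have wu: "w = u"
  proof (rule ccontr)
    assume "w \<noteq> u"
    then show False using degw degree_in_walk_edges[OF w d, of w] count_tails_heads[OF w, of w]
      by (cases "count_list (map (step_tail \<Upsilon>) ds) w") auto
  qed
  note w = w[unfolded wu]
  have ne: "ds \<noteq> []" using degw by (auto simp: degree_in_def)
  define H where "H v = count_list (map (step_head \<Upsilon>) ds) v" for v
  have degH: "degree_in \<Upsilon> (walk_edges ds) v = 2 * H v" for v
    using degree_in_walk_edges[OF w d, of v] count_tails_heads[OF w, of v] by (simp add: H_def)
  let ?W = "verts_of \<Upsilon> (walk_edges ds)"
  have WC: "?W \<subseteq> verts_of \<Upsilon> C" using sub by (auto simp: verts_of_def)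
  have HW: "H v = 1" if vW: "v \<in> ?W" for v
  proof -
    have "H v \<le> 1"
      using degree_in_mono[OF fC sub, of v] degH[of v] deg[of v] that WC by auto
    moreover have "H v > 0"
    proof -
      obtain e where "e \<in> walk_edges ds" "v \<in> set (ends \<Upsilon> e)" using vW by (auto simp: verts_of_def)
      moreover have "degree_in \<Upsilon> {} v = 0" by (simp add: degree_in_def)
      ultimately have "degree_in \<Upsilon> (walk_edges ds) v \<noteq> 0"
        using degree_in_eq_incident[of "walk_edges ds" "{}" v e] finite_subset[OF sub fC] by auto
      then show ?thesis using degH[of v] by simp
    qed
    ultimately show ?thesis by simp
  qed
  have used: "e \<in> walk_edges ds" if "e \<in> C" "v \<in> ?W" "v \<in> set (ends \<Upsilon> e)" for e v
    using degree_in_eq_incident[OF fC sub _ that(1,3)] degH[of v] HW[OF that(2)] deg[of v] that(2) WC by auto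
  \<comment> \<open>The trail exhausts the degree at each of its vertices, so a walk in
    \<open>C\<close> cannot leave it; connectedness of \<open>C\<close> then shows that nothing of
    \<open>C\<close> is missed.\<close>
  have stay: "x \<in> ?W" if "walk \<Upsilon> y es x" "walk_edges es \<subseteq> C" "y \<in> ?W" for x y es
    using that
  proof (induction es arbitrary: y)
    case Nil
    then show ?case by auto
  next
    case (Cons s es)
    have s: "fst s \<in> C" "fst s \<in> links_loops \<Upsilon>" "snd s < 2" "step_tail \<Upsilon> s = y" using Cons.prems by auto
    have "fst s \<in> walk_edges ds" using used[OF s(1) Cons.prems(3)] ends_link_loop[OF s(2,3)] s(4) by auto
    then have "step_head \<Upsilon> s \<in> ?W" using ends_link_loop[OF s(2,3)] by (auto simp: verts_of_def)
    then show ?case using Cons by auto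
  qed
  have uW: "u \<in> ?W" using verts_of_walk_edges[OF w ne] by simp
  have "C \<subseteq> walk_edges ds"
  proof
    fix e assume e: "e \<in> C"
    then obtain x where x: "x \<in> set (ends \<Upsilon> e)" using CL by (fastforce simp: links_loops_def)
    then have "joined_in \<Upsilon> C u x" using conn e by (auto simp: verts_of_def)
    then have "x \<in> ?W" using stay uW by (auto simp: joined_in_def)
    then show "e \<in> walk_edges ds" using used e x by blast
  qed
  then have eq: "walk_edges ds = C" using sub by blast
  have "distinct (map (step_head \<Upsilon>) ds)"
  proof -
    have "count_list (map (step_head \<Upsilon>) ds) v = of_bool (v \<in> set (map (step_head \<Upsilon>) ds))" for v
    proof (cases "v \<in> set (map (step_head \<Upsilon>) ds)")
      case True
      then have "v \<in> ?W" using verts_of_walk_edges[OF w ne] by (auto simp: walk_verts_def)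
      then show ?thesis using HW[of v] True by (simp add: H_def)
    qed (simp add: count_list_0_iff)
    then show ?thesis unfolding distinct_iff_count_list_le_1 by simp
  qed
  then show thesis using that[of ds] w ne d eq by (simp add: cycle_walk_def)
qed

lemma closed_walk_end_in_heads:
  assumes "walk \<Upsilon> u ds w" "ds \<noteq> []"
  shows "w \<in> set (map (step_head \<Upsilon>) ds)"
  using assms
proof (induction ds arbitrary: u)
  case (Cons d ds)
  then show ?case by (cases "ds = []") auto
qed simp

text \<open>A step along \<open>e\<close> has tail and head \<open>u\<close>. A nonempty piece of
  the cycle walk before or after it would also end at \<open>u\<close> and repeat that head.\<close>

lemma circle_loop:
  assumes C: "circle \<Upsilon> C" and e: "e \<in> C" "set (ends \<Upsilon> e) = {u}"
  shows "C = {e}"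
proof -
  have "u \<in> verts_of \<Upsilon> C" using e by (auto simp: verts_of_def)
  then obtain ds where ds: "cycle_walk u ds" "walk_edges ds = C" using circle_cycle_walk[OF C] by metis
  have w: "walk \<Upsilon> u ds u" and dst: "distinct (map (step_head \<Upsilon>) ds)" using ds by (auto simp: cycle_walk_def)
  obtain d where d: "d \<in> set ds" "fst d = e" using ds(2) e(1) by (auto simp: walk_edges_def)
  then obtain p q where pq: "ds = p @ d # q" by (meson split_list)
  have wd: "walk \<Upsilon> u p (step_tail \<Upsilon> d)" "walk \<Upsilon> (step_head \<Upsilon> d) q u"
    "fst d \<in> links_loops \<Upsilon>" "snd d < 2" using w pq by (auto simp: walk_append_iff)
  have th: "step_tail \<Upsilon> d = u" "step_head \<Upsilon> d = u" using ends_link_loop[OF wd(3,4)] d e(2) by auto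
  have "p = []"
    using closed_walk_end_in_heads[OF wd(1)] dst pq th by auto
  moreover have "q = []"
    using closed_walk_end_in_heads[OF wd(2)] dst pq th by auto
  ultimately show ?thesis using ds(2) pq d(2) by simp
qed

text \<open>A shortest counterexample is split at a repeated head or edge into two shorter closed
  walks. Their signs multiply to -1, so one of them is negative. A walk that cannot be split is
  already a cycle walk.\<close>

lemma negative_closed_walk:
  assumes "walk \<Upsilon> u ds u" "walk_sign \<Upsilon> ds = -1"
  obtains C where "C \<subseteq> walk_edges ds" "negative_circle \<Upsilon> C"
proof -
  have "\<exists>C. C \<subseteq> walk_edges ds \<and> negative_circle \<Upsilon> C"
    using assms
  proof (induction "length ds" arbitrary: u ds rule: less_induct)
    case less
    have split: ?case
      if "walk \<Upsilon> x q x" "walk \<Upsilon> u (p @ r) u" "length q < length ds" "length (p @ r) < length ds"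
        "walk_edges q \<subseteq> walk_edges ds" "walk_edges (p @ r) \<subseteq> walk_edges ds"
        "walk_sign \<Upsilon> q * walk_sign \<Upsilon> (p @ r) = walk_sign \<Upsilon> ds" for x p q r
    proof (cases "walk_sign \<Upsilon> q = -1")
      case True
      then show ?thesis using less.hyps[OF that(3,1)] that(5) by blast
    next
      case False
      then have "walk_sign \<Upsilon> (p @ r) = -1"
        using that(7) less.prems(2) walk_sign_values[OF that(1)] by auto
      then show ?thesis using less.hyps[OF that(4,2)] that(6) by blast
    qed
    show ?case
    proof (cases "distinct (map (step_head \<Upsilon>) ds)")
      case False
      then obtain as bs cs y where "map (step_head \<Upsilon>) ds = as @ [y] @ bs @ [y] @ cs"
        using not_distinct_decomp by blast
      then obtain p d q d' r where ds: "ds = p @ d # q @ d' # r" "step_head \<Upsilon> d = step_head \<Upsilon> d'"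
        by (auto simp: map_eq_append_conv map_eq_Cons_conv Cons_eq_map_conv append_eq_map_conv)
      have wd: "walk \<Upsilon> u (p @ [d]) (step_head \<Upsilon> d)" "walk \<Upsilon> (step_head \<Upsilon> d) (q @ [d']) (step_head \<Upsilon> d)"
        "walk \<Upsilon> (step_head \<Upsilon> d) r u"
        using less.prems(1) ds walk_ends_in_verts by (auto simp: walk_append_iff)
      show ?thesis
        by (rule split[of "step_head \<Upsilon> d" "q @ [d']" "p @ [d]" r])
          (use ds wd in \<open>auto simp: walk_append_iff\<close>)
    next
      case dh: True
      show ?thesis
      proof (cases "distinct (map fst ds)")
        case False
        then obtain as bs cs y where "map fst ds = as @ [y] @ bs @ [y] @ cs"
          using not_distinct_decomp by blast
        then obtain p d q d' r where ds: "ds = p @ d # q @ d' # r" "fst d = fst d'"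
          by (auto simp: map_eq_append_conv map_eq_Cons_conv Cons_eq_map_conv append_eq_map_conv)
        have wd: "walk \<Upsilon> u p (step_tail \<Upsilon> d)" "walk \<Upsilon> (step_head \<Upsilon> d) q (step_tail \<Upsilon> d')"
          "walk \<Upsilon> (step_head \<Upsilon> d') r u" "snd d < 2" "snd d' < 2" "fst d \<in> links_loops \<Upsilon>"
          using less.prems(1) ds by (auto simp: walk_append_iff)
        \<comment> \<open>Heads are distinct by now, so the repeated edge is traversed in opposite
          directions. Dropping both traversals leaves two closed walks and changes the sign only by
          a square.\<close>
        have "step_head \<Upsilon> d \<noteq> step_head \<Upsilon> d'" using dh ds by auto
        then have "snd d \<noteq> snd d'" using ds(2) prod_eqI by blast
        then have "d' = (fst d, 1 - snd d)" using ds(2) wd(4,5) by (auto simp: prod_eq_iff)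
        then have th: "step_tail \<Upsilon> d' = step_head \<Upsilon> d" "step_head \<Upsilon> d' = step_tail \<Upsilon> d"
          using reverse_step[OF wd(4)] by auto
        have "edge_sign \<Upsilon> (fst d) * edge_sign \<Upsilon> (fst d) = 1"
          using edge_sign_values[of "fst d"] wd(6) links_loops_subset by fastforce
        then have "walk_sign \<Upsilon> q * walk_sign \<Upsilon> (p @ r) = walk_sign \<Upsilon> ds"
          using ds by (simp add: algebra_simps)
        moreover have "walk \<Upsilon> u (p @ r) u" using wd th unfolding walk_append_iff by auto
        ultimately show ?thesis
          by (intro split[of "step_head \<Upsilon> d" q p r])
            (use ds wd th in auto)
      next
        case True
        have "ds \<noteq> []" using less.prems(2) by auto
        then have c: "cycle_walk u ds" using less.prems(1) dh True by (simp add: cycle_walk_def)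
        then show ?thesis using cycle_walk_circle[OF c] less.prems(2)
          by (auto simp: negative_circle_def)
      qed
    qed
  qed
  with that show thesis by blast
qed

lemma negative_figure_joined:
  assumes "negative_figure \<Upsilon> N" "u \<in> verts_of \<Upsilon> N" "w \<in> verts_of \<Upsilon> N"
  shows "joined_in \<Upsilon> N u w"
proof (cases "negative_circle \<Upsilon> N")
  case True
  then show ?thesis using assms by (auto simp: negative_circle_def circle_def)
next
  case False
  then obtain h where h: "h \<in> half_edges \<Upsilon>" "N = {h}" using assms(1) by (auto simp: negative_figure_def)
  then show ?thesis using assms(2,3) edge_ends_joined[of h N u w] by (auto simp: verts_of_def half_edges_def)
qed

lemma negative_figure_verts:
  assumes "negative_figure \<Upsilon> N"
  obtains x where "x \<in> verts_of \<Upsilon> N"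
proof (cases "negative_circle \<Upsilon> N")
  case True
  then obtain e where "e \<in> N" "length (ends \<Upsilon> e) = 2"
    by (auto simp: negative_circle_def circle_def links_loops_def)
  then have "ends \<Upsilon> e ! 0 \<in> set (ends \<Upsilon> e)" by simp
  then show thesis using that \<open>e \<in> N\<close> unfolding verts_of_def by blast
next
  case False
  then obtain h where "h \<in> half_edges \<Upsilon>" "N = {h}" using assms(1) by (auto simp: negative_figure_def)
  then show thesis using that[of "ends \<Upsilon> h ! 0"] by (auto simp: verts_of_def half_edges_def)
qed

lemma negative_figure_subset: "negative_figure \<Upsilon> N \<Longrightarrow> N \<subseteq> edges \<Upsilon>"
  using links_loops_subset by (auto simp: negative_figure_def negative_circle_def circle_def half_edges_def)

end

section \<open>Sign circuits through an edge\<close>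

lemma handcuff_commonI:
  assumes "negative_figure \<Upsilon> C" "negative_figure \<Upsilon> D" "C \<noteq> D" "is_path \<Upsilon> u [] u"
    "verts_of \<Upsilon> C \<inter> verts_of \<Upsilon> D = {u}"
  shows "handcuff \<Upsilon> C u [] u D"
  unfolding handcuff_def by (intro conjI disjI1 refl assms)

lemma handcuff_disjointI:
  assumes "negative_figure \<Upsilon> C" "negative_figure \<Upsilon> D" "C \<noteq> D" "is_path \<Upsilon> u p w"
    "verts_of \<Upsilon> C \<inter> verts_of \<Upsilon> D = {}" "set (walk_verts \<Upsilon> u p) \<inter> verts_of \<Upsilon> C = {u}"
    "set (walk_verts \<Upsilon> u p) \<inter> verts_of \<Upsilon> D = {w}"
  shows "handcuff \<Upsilon> C u p w D"
  unfolding handcuff_def by (intro conjI disjI2 assms)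

context gain_signed_graph
begin

lemma joined_first_hit:
  assumes "joined_in \<Upsilon> A u w" "w \<in> X"
  obtains p a where "is_path \<Upsilon> u p a" "walk_edges p \<subseteq> A" "set (walk_verts \<Upsilon> u p) \<inter> X = {a}"
proof -
  obtain ds where ds: "walk \<Upsilon> u ds w" "walk_edges ds \<subseteq> A" using assms(1) by (auto simp: joined_in_def)
  show thesis by (rule walk_first_hit[OF ds(1) assms(2)]) (use that ds(2) in blast)
qed

text \<open>Appending the closing step turns the path into a cycle walk. The condition on
  \<open>fst d\<close> excludes a path of length one that is merely walked back.\<close>

lemma path_edge_circle:
  assumes p: "is_path \<Upsilon> v p w" and d: "walk \<Upsilon> w [d] v" and new: "fst d \<notin> walk_edges p"
  shows "circle \<Upsilon> (insert (fst d) (walk_edges p))"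
    "verts_of \<Upsilon> (insert (fst d) (walk_edges p)) = set (walk_verts \<Upsilon> v p)"
    "(\<Prod>e\<in>insert (fst d) (walk_edges p). edge_sign \<Upsilon> e) = edge_sign \<Upsilon> (fst d) * walk_sign \<Upsilon> p"
proof -
  have w: "walk \<Upsilon> v p w" using p by (simp add: is_path_def)
  have "walk \<Upsilon> v (p @ [d]) v" unfolding walk_append_iff using w d by blast
  moreover have "distinct (map (step_head \<Upsilon>) (p @ [d]))"
    using p d by (auto simp: is_path_def walk_verts_def)
  moreover have "distinct (map fst (p @ [d]))"
    using is_path_distinct_edges[OF p] new by (auto simp: walk_edges_eq_set)
  ultimately have c: "cycle_walk v (p @ [d])" by (simp add: cycle_walk_def)
  have e: "walk_edges (p @ [d]) = insert (fst d) (walk_edges p)" by simp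
  note cc = cycle_walk_circle[OF c, unfolded e]
  show "circle \<Upsilon> (insert (fst d) (walk_edges p))" by (rule cc(1))
  show "verts_of \<Upsilon> (insert (fst d) (walk_edges p)) = set (walk_verts \<Upsilon> v p)"
    using cc(2) d by (simp add: walk_verts_append) (auto simp: walk_verts_def)
  show "(\<Prod>e\<in>insert (fst d) (walk_edges p). edge_sign \<Upsilon> e) = edge_sign \<Upsilon> (fst d) * walk_sign \<Upsilon> p"
    using cc(3) by (simp add: mult.commute)
qed

lemma path_edge_circle_cases:
  assumes "is_path \<Upsilon> v p w" "walk \<Upsilon> w [d] v" "fst d \<notin> walk_edges p"
  shows "positive_circle \<Upsilon> (insert (fst d) (walk_edges p)) \<or>
    negative_circle \<Upsilon> (insert (fst d) (walk_edges p)) \<and> edge_sign \<Upsilon> (fst d) * walk_sign \<Upsilon> p = -1"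
proof -
  have "walk_sign \<Upsilon> (d # p) \<in> {1, -1}"
    using assms by (intro walk_sign_values[of w _ w]) (auto simp: is_path_def)
  then show ?thesis using path_edge_circle[OF assms]
    by (auto simp: positive_circle_def negative_circle_def)
qed

text \<open>The arcs come from cutting a walk around \<open>N\<close> at \<open>b\<close> and
  reversing the second piece, which keeps its sign. Since their signs are opposite, exactly one arc
  completes a given outer path to a positive closed walk.\<close>

lemma negative_circle_arcs:
  assumes N: "negative_circle \<Upsilon> N" and ab: "a \<in> verts_of \<Upsilon> N" "b \<in> verts_of \<Upsilon> N" "a \<noteq> b"
  obtains q r where "is_path \<Upsilon> a q b" "walk_edges q \<subseteq> N" "set (walk_verts \<Upsilon> a q) \<subseteq> verts_of \<Upsilon> N"
    "is_path \<Upsilon> a r b" "walk_edges r \<subseteq> N" "set (walk_verts \<Upsilon> a r) \<subseteq> verts_of \<Upsilon> N"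
    "walk_sign \<Upsilon> q * walk_sign \<Upsilon> r = -1"
proof -
  obtain ds where ds: "cycle_walk a ds" "walk_edges ds = N"
    using circle_cycle_walk[of N a] N ab by (auto simp: negative_circle_def)
  have w: "walk \<Upsilon> a ds a" "distinct (map (step_head \<Upsilon>) ds)" using ds by (auto simp: cycle_walk_def)
  have vN: "verts_of \<Upsilon> N = set (walk_verts \<Upsilon> a ds)" using cycle_walk_circle(2)[OF ds(1)] ds(2) by simp
  obtain q r where qr: "ds = q @ r" "walk \<Upsilon> a q b" "walk \<Upsilon> b r a"
    using walk_split_at[OF w(1)] vN ab(2) walk_verts_in_verts[OF w(1)] by blast
  have "q \<noteq> []" "r \<noteq> []" using qr ab(3) by auto
  then have "b \<in> set (map (step_head \<Upsilon>) q)" "a \<in> set (map (step_head \<Upsilon>) r)"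
    using closed_walk_end_in_heads qr(2,3) by blast+
  then have "is_path \<Upsilon> a q b" and r: "is_path \<Upsilon> b r a"
    using w(2) qr by (auto simp: is_path_def walk_verts_def)
  moreover have "set (walk_verts \<Upsilon> a q) \<subseteq> verts_of \<Upsilon> N" "set (walk_verts \<Upsilon> b r) \<subseteq> verts_of \<Upsilon> N"
    unfolding vN qr(1) set_walk_verts_append[OF qr(2)] by auto
  moreover have "walk_sign \<Upsilon> q * walk_sign \<Upsilon> r = -1"
    using cycle_walk_circle(3)[OF ds(1)] ds(2) N qr(1) by (simp add: negative_circle_def)
  ultimately show thesis
    using that[of q "reverse_walk r"] is_path_reverse[OF r] set_walk_verts_reverse[OF qr(3)] ds(2) qr(1)
    by auto
qed

text \<open>The half edge is a negative figure in its own right, and a path from \<open>v\<close>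
  stopped at \<open>N\<close> joins the two; it has length 0 when \<open>v\<close> already lies on
  \<open>N\<close>.\<close>

lemma half_edge_circuit:
  assumes e: "e \<in> half_edges \<Upsilon>" "e \<notin> A" "v \<in> set (ends \<Upsilon> e)"
    and N: "negative_figure \<Upsilon> N" "N \<subseteq> A" "x \<in> verts_of \<Upsilon> N" "joined_in \<Upsilon> A v x"
  obtains C where "sign_circuit \<Upsilon> C" "e \<in> C" "C \<subseteq> insert e A"
proof -
  obtain p a where p: "is_path \<Upsilon> v p a" "walk_edges p \<subseteq> A" "set (walk_verts \<Upsilon> v p) \<inter> verts_of \<Upsilon> N = {a}"
    by (rule joined_first_hit[OF N(4,3)])
  have vs: "verts_of \<Upsilon> {e} = {v}"
  proof -
    have "length (ends \<Upsilon> e) = 1" using e(1) by (simp add: half_edges_def)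
    then obtain z where "ends \<Upsilon> e = [z]" by (auto simp: length_Suc_conv)
    then show ?thesis using e(3) by (simp add: verts_of_def)
  qed
  have ne: "{e} \<noteq> N" "negative_figure \<Upsilon> {e}" using e N(2) by (auto simp: negative_figure_def)
  have "handcuff \<Upsilon> {e} v p a N"
  proof (cases "v = a")
    case True
    have "p = []" by (rule is_path_closed_Nil[OF p(1)[folded True]])
    moreover have "verts_of \<Upsilon> {e} \<inter> verts_of \<Upsilon> N = {v}" using vs p(3) True by blast
    ultimately show ?thesis using handcuff_commonI[OF ne(2) N(1) ne(1)] p(1) True by simp
  next
    case False
    have "v \<notin> verts_of \<Upsilon> N"
    proof
      assume "v \<in> verts_of \<Upsilon> N"
      then have "v \<in> set (walk_verts \<Upsilon> v p) \<inter> verts_of \<Upsilon> N" by simp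
      then show False unfolding p(3) using False by simp
    qed
    then have "verts_of \<Upsilon> {e} \<inter> verts_of \<Upsilon> N = {}"
      "set (walk_verts \<Upsilon> v p) \<inter> verts_of \<Upsilon> {e} = {v}" using vs by auto
    then show ?thesis by (rule handcuff_disjointI[OF ne(2) N(1) ne(1) p(1) _ _ p(3)])
  qed
  then have "sign_circuit \<Upsilon> ({e} \<union> walk_edges p \<union> N)" unfolding sign_circuit_def by blast
  then show thesis using p N by (intro that) auto
qed

text \<open>Let \<open>p\<close> be a path from \<open>v\<close> to a negative figure \<open>N\<close> and \<open>r\<close> a path from \<open>w\<close> to \<open>N \<union> p\<close>; where
  \<open>r\<close> arrives decides which circuit closes up.  If it arrives at \<open>N\<close> away from the end of \<open>p\<close>, one of
  the two arcs of \<open>N\<close> gives a positive circle.\<close>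

lemma edge_circuit_common_figure:
  assumes d: "walk \<Upsilon> w [d] v" "fst d \<notin> A"
    and N: "negative_figure \<Upsilon> N" "N \<subseteq> A"
    and p: "is_path \<Upsilon> v p a" "walk_edges p \<subseteq> A" "set (walk_verts \<Upsilon> v p) \<inter> verts_of \<Upsilon> N = {a}"
    and r: "is_path \<Upsilon> w r b" "walk_edges r \<subseteq> A"
      "set (walk_verts \<Upsilon> w r) \<inter> (set (walk_verts \<Upsilon> v p) \<union> verts_of \<Upsilon> N) = {b}"
  obtains C where "sign_circuit \<Upsilon> C" "fst d \<in> C" "C \<subseteq> insert (fst d) A"
proof -
  note circuit = that
  have wr: "walk \<Upsilon> w r b" using r(1) by (simp add: is_path_def)
  have rr: "is_path \<Upsilon> b (reverse_walk r) w" by (rule is_path_reverse[OF r(1)])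
  have rv: "set (walk_verts \<Upsilon> b (reverse_walk r)) = set (walk_verts \<Upsilon> w r)"
    by (rule set_walk_verts_reverse[OF wr])
  have pa: "a \<in> set (walk_verts \<Upsilon> v p)" "a \<in> verts_of \<Upsilon> N" using p(3) by auto
  have br: "b \<in> set (walk_verts \<Upsilon> w r)" using r(3) by auto
  have pN: "z = a" if "z \<in> set (walk_verts \<Upsilon> v p)" "z \<in> verts_of \<Upsilon> N" for z
    using that p(3) by auto
  have rp: "z = b" if "z \<in> set (walk_verts \<Upsilon> w r)" "z \<in> set (walk_verts \<Upsilon> v p)" for z
    using that r(3) by auto
  have rN: "z = b" if "z \<in> set (walk_verts \<Upsilon> w r)" "z \<in> verts_of \<Upsilon> N" for z
    using that r(3) by auto
  have pos: thesis if "is_path \<Upsilon> v q w" "walk_edges q \<subseteq> A"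
      "positive_circle \<Upsilon> (insert (fst d) (walk_edges q))" for q
    using circuit[of "insert (fst d) (walk_edges q)"] that(2,3) by (auto simp: sign_circuit_def)
  show thesis
  proof (cases "b \<in> verts_of \<Upsilon> N")
    case bN: False
    then have "b \<in> set (walk_verts \<Upsilon> v p)" using r(3) by auto
    then obtain p1 p2 where sp: "p = p1 @ p2" "is_path \<Upsilon> v p1 b" "is_path \<Upsilon> b p2 a"
      "set (walk_verts \<Upsilon> v p1) \<inter> set (walk_verts \<Upsilon> b p2) = {b}"
      "set (walk_verts \<Upsilon> v p) = set (walk_verts \<Upsilon> v p1) \<union> set (walk_verts \<Upsilon> b p2)"
      using is_path_split_at[OF p(1)] by metis
    \<comment> \<open>Here \<open>r\<close> meets \<open>p\<close> before \<open>p\<close> reaches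
      \<open>N\<close>. The initial piece \<open>p1\<close>, the path \<open>r\<close> and the new
      edge close up; if that circle is negative, the remaining piece \<open>p2\<close> connects it
      to \<open>N\<close>.\<close>
    define q where "q = p1 @ reverse_walk r"
    have w1: "walk \<Upsilon> v p1 b" using sp(2) by (simp add: is_path_def)
    have b12: "b \<in> set (walk_verts \<Upsilon> v p1)" by (rule end_in_walk_verts[OF w1])
    have int: "set (walk_verts \<Upsilon> v p1) \<inter> set (walk_verts \<Upsilon> w r) = {b}"
      using rp sp(5) b12 br by blast
    then have q: "is_path \<Upsilon> v q w"
      unfolding q_def by (intro is_path_append[OF sp(2) rr]) (simp add: rv)
    have qA: "walk_edges q \<subseteq> A" using p(2) r(2) sp(1) by (auto simp: q_def)
    have qv: "set (walk_verts \<Upsilon> v q) = set (walk_verts \<Upsilon> v p1) \<union> set (walk_verts \<Upsilon> w r)"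
      unfolding q_def set_walk_verts_append[OF w1] rv ..
    have new: "fst d \<notin> walk_edges q" using qA d(2) by auto
    let ?C = "insert (fst d) (walk_edges q)"
    have vC: "verts_of \<Upsilon> ?C = set (walk_verts \<Upsilon> v q)" by (rule path_edge_circle(2)[OF q d(1) new])
    show thesis
    proof (cases "positive_circle \<Upsilon> ?C")
      case True
      then show thesis using pos q qA by blast
    next
      case False
      then have neg: "negative_circle \<Upsilon> ?C" using path_edge_circle_cases[OF q d(1) new] by blast
      have a2: "a \<in> set (walk_verts \<Upsilon> b p2)" using sp(3) by (auto simp: is_path_def end_in_walk_verts)
      have a1: "a \<notin> set (walk_verts \<Upsilon> v p1)" using a2 sp(4) bN pa by auto
      have "verts_of \<Upsilon> ?C \<inter> verts_of \<Upsilon> N = {}" unfolding vC qv using a1 pN sp(5) rN bN by blast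
      moreover have "set (walk_verts \<Upsilon> b p2) \<inter> verts_of \<Upsilon> ?C = {b}"
        unfolding vC qv using sp(4,5) rp b12 by blast
      moreover have "set (walk_verts \<Upsilon> b p2) \<inter> verts_of \<Upsilon> N = {a}" using a2 pa(2) pN sp(5) by blast
      moreover have "?C \<noteq> N" using N(2) d(2) by blast
      ultimately have "handcuff \<Upsilon> ?C b p2 a N"
        using neg N(1) sp(3) by (intro handcuff_disjointI) (simp_all add: negative_figure_def)
      then have "sign_circuit \<Upsilon> (?C \<union> walk_edges p2 \<union> N)" unfolding sign_circuit_def by blast
      then show thesis using qA p(2) N sp(1) by (intro circuit[of "?C \<union> walk_edges p2 \<union> N"]) auto
    qed
  next
    case bN: True
    show thesis
    proof (cases "b = a")
      case True
      define q where "q = p @ reverse_walk r"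
      have int: "set (walk_verts \<Upsilon> v p) \<inter> set (walk_verts \<Upsilon> w r) = {a}" using rp True pa br by blast
      then have q: "is_path \<Upsilon> v q w"
        unfolding q_def using True rr rv by (intro is_path_append[OF p(1)]) auto
      have qA: "walk_edges q \<subseteq> A" using p(2) r(2) by (auto simp: q_def)
      have "walk \<Upsilon> v p a" using p(1) by (simp add: is_path_def)
      then have qv: "set (walk_verts \<Upsilon> v q) = set (walk_verts \<Upsilon> v p) \<union> set (walk_verts \<Upsilon> w r)"
        unfolding q_def using set_walk_verts_append True rv by metis
      have new: "fst d \<notin> walk_edges q" using qA d(2) by auto
      let ?C = "insert (fst d) (walk_edges q)"
      have vC: "verts_of \<Upsilon> ?C = set (walk_verts \<Upsilon> v q)" by (rule path_edge_circle(2)[OF q d(1) new])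
      show thesis
      proof (cases "positive_circle \<Upsilon> ?C")
        case True
        then show thesis using pos q qA by blast
      next
        case False
        then have neg: "negative_circle \<Upsilon> ?C" using path_edge_circle_cases[OF q d(1) new] by blast
        \<comment> \<open>Both paths end at the same vertex \<open>a\<close> of \<open>N\<close>, so
          a negative circle formed by them touches \<open>N\<close> there and only there: a handcuff
          with connecting path of length 0.\<close>
        have "verts_of \<Upsilon> ?C \<inter> verts_of \<Upsilon> N = {a}" unfolding vC qv using pN rN True pa by blast
        moreover have "is_path \<Upsilon> a [] a" using walk_ends_in_verts wr True by (auto simp: is_path_def)
        moreover have "?C \<noteq> N" using N(2) d(2) by blast
        ultimately have "handcuff \<Upsilon> ?C a [] a N"
          using neg N(1) by (intro handcuff_commonI) (simp_all add: negative_figure_def)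
        then have "sign_circuit \<Upsilon> (?C \<union> walk_edges [] \<union> N)" unfolding sign_circuit_def by blast
        then show thesis using qA N by (intro circuit[of "?C \<union> walk_edges [] \<union> N"]) auto
      qed
    next
      case ba: False
      \<comment> \<open>A half edge has a single vertex, whereas \<open>N\<close> contains the
        distinct vertices \<open>a\<close> and \<open>b\<close>.\<close>
      have "negative_circle \<Upsilon> N"
      proof (rule ccontr)
        assume "\<not> negative_circle \<Upsilon> N"
        then obtain h where "h \<in> half_edges \<Upsilon>" "N = {h}" using N(1) by (auto simp: negative_figure_def)
        then have "card (verts_of \<Upsilon> N) = 1"
          by (auto simp: verts_of_def half_edges_def length_Suc_conv)
        then show False using bN pa(2) ba by (auto simp: card_1_singleton_iff)
      qed
      then obtain q1 q2 where arcs: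
        "is_path \<Upsilon> a q1 b" "walk_edges q1 \<subseteq> N" "set (walk_verts \<Upsilon> a q1) \<subseteq> verts_of \<Upsilon> N"
        "is_path \<Upsilon> a q2 b" "walk_edges q2 \<subseteq> N" "set (walk_verts \<Upsilon> a q2) \<subseteq> verts_of \<Upsilon> N"
        "walk_sign \<Upsilon> q1 * walk_sign \<Upsilon> q2 = -1"
        using negative_circle_arcs[OF _ pa(2) bN] ba by metis
      have bp: "set (walk_verts \<Upsilon> v p) \<inter> set (walk_verts \<Upsilon> w r) = {}" using pN rp bN ba by blast
      have path: "is_path \<Upsilon> v (p @ q @ reverse_walk r) w"
        if q: "is_path \<Upsilon> a q b" "set (walk_verts \<Upsilon> a q) \<subseteq> verts_of \<Upsilon> N" for q
      proof -
        have wq: "walk \<Upsilon> a q b" using q(1) by (simp add: is_path_def)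
        have "set (walk_verts \<Upsilon> a q) \<inter> set (walk_verts \<Upsilon> w r) = {b}"
          using q(2) rN br end_in_walk_verts[OF wq] by blast
        then have "is_path \<Upsilon> a (q @ reverse_walk r) w"
          by (intro is_path_append[OF q(1) rr]) (simp add: rv)
        moreover have "set (walk_verts \<Upsilon> a (q @ reverse_walk r))
            = set (walk_verts \<Upsilon> a q) \<union> set (walk_verts \<Upsilon> w r)"
          unfolding set_walk_verts_append[OF wq] rv ..
        moreover have "set (walk_verts \<Upsilon> v p) \<inter> (set (walk_verts \<Upsilon> a q) \<union> set (walk_verts \<Upsilon> w r)) = {a}"
          using pN q(2) bp pa(1) start_in_walk_verts[of a \<Upsilon> q] by blast
        ultimately show ?thesis by (intro is_path_append[OF p(1)]) auto
      qed
      let ?q = "\<lambda>q. p @ q @ reverse_walk r"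
      have sub: "walk_edges (?q q) \<subseteq> A" "fst d \<notin> walk_edges (?q q)" if "walk_edges q \<subseteq> N" for q
        using that p(2) r(2) N(2) d(2) by auto
      have "positive_circle \<Upsilon> (insert (fst d) (walk_edges (?q q1))) \<or>
          positive_circle \<Upsilon> (insert (fst d) (walk_edges (?q q2)))"
      proof (rule ccontr)
        \<comment> \<open>\<open>?s\<close> is the sign of what both candidate circles share outside
          \<open>N\<close>. If both were negative, multiplying their signs would give
          \<open>?s * ?s = -1\<close>, because the arcs have opposite signs.\<close>
        let ?s = "edge_sign \<Upsilon> (fst d) * (walk_sign \<Upsilon> p * walk_sign \<Upsilon> r)"
        assume "\<not> ?thesis"
        then have "?s * walk_sign \<Upsilon> q1 = -1" "?s * walk_sign \<Upsilon> q2 = -1"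
          using path_edge_circle_cases[OF path[OF arcs(1,3)] d(1) sub(2)[OF arcs(2)]]
            path_edge_circle_cases[OF path[OF arcs(4,6)] d(1) sub(2)[OF arcs(5)]]
          by (auto simp: mult_ac)
        then have "(?s * walk_sign \<Upsilon> q1) * (?s * walk_sign \<Upsilon> q2) = 1" by simp
        then have "(?s * ?s) * (walk_sign \<Upsilon> q1 * walk_sign \<Upsilon> q2) = 1" by (simp only: mult_ac)
        then have "?s * ?s = -1" using arcs(7) by simp
        then show False using zero_le_square[of ?s] by linarith
      qed
      then show thesis
        using pos[OF path[OF arcs(1,3)] sub(1)[OF arcs(2)]] pos[OF path[OF arcs(4,6)] sub(1)[OF arcs(5)]]
        by (elim disjE)
    qed
  qed
qed

text \<open>If \<open>w\<close> reaches \<open>p\<close> or \<open>N\<close> inside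
  \<open>A\<close>, one figure suffices. Otherwise everything that \<open>w\<close> reaches,
  including \<open>M\<close>, is disjoint from \<open>p\<close> and \<open>N\<close>, and the new
  edge becomes part of the connecting path of a handcuff with figures \<open>N\<close> and
  \<open>M\<close>.\<close>

lemma edge_circuit_unbalanced:
  assumes d: "walk \<Upsilon> w [d] v" "fst d \<notin> A"
    and N: "negative_figure \<Upsilon> N" "N \<subseteq> A" "x \<in> verts_of \<Upsilon> N" "joined_in \<Upsilon> A v x"
    and M: "negative_figure \<Upsilon> M" "M \<subseteq> A" "y \<in> verts_of \<Upsilon> M" "joined_in \<Upsilon> A w y"
  obtains C where "sign_circuit \<Upsilon> C" "fst d \<in> C" "C \<subseteq> insert (fst d) A"
proof -
  obtain p a where p: "is_path \<Upsilon> v p a" "walk_edges p \<subseteq> A" "set (walk_verts \<Upsilon> v p) \<inter> verts_of \<Upsilon> N = {a}"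
    by (rule joined_first_hit[OF N(4,3)])
  let ?X = "set (walk_verts \<Upsilon> v p) \<union> verts_of \<Upsilon> N"
  have wp: "walk \<Upsilon> v p a" using p(1) by (simp add: is_path_def)
  show thesis
  proof (cases "\<exists>b\<in>?X. joined_in \<Upsilon> A w b")
    case True
    then obtain b' where b': "b' \<in> ?X" "joined_in \<Upsilon> A w b'" by blast
    obtain r b where r: "is_path \<Upsilon> w r b" "walk_edges r \<subseteq> A" "set (walk_verts \<Upsilon> w r) \<inter> ?X = {b}"
      by (rule joined_first_hit[OF b'(2,1)])
    show thesis by (rule edge_circuit_common_figure[OF d N(1,2) p r that])
  next
    case False
      obtain r b where r: "is_path \<Upsilon> w r b" "walk_edges r \<subseteq> A" "set (walk_verts \<Upsilon> w r) \<inter> verts_of \<Upsilon> M = {b}"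
      by (rule joined_first_hit[OF M(4,3)])
    have wr: "walk \<Upsilon> w r b" using r(1) by (simp add: is_path_def)
    have jr: "joined_in \<Upsilon> A w z" if "z \<in> set (walk_verts \<Upsilon> w r)" for z
      by (rule walk_verts_joined[OF wr r(2) that])
    then have rX: "set (walk_verts \<Upsilon> w r) \<inter> ?X = {}" using False by blast
    have "joined_in \<Upsilon> A w z" if "z \<in> verts_of \<Upsilon> M" for z
      using joined_in_trans[OF M(4) joined_in_mono[OF negative_figure_joined[OF M(1,3) that] M(2)]] .
    then have MX: "verts_of \<Upsilon> M \<inter> ?X = {}" using False by blast
    have pa: "a \<in> set (walk_verts \<Upsilon> v p)" "a \<in> verts_of \<Upsilon> N" using p(3) by auto
    \<comment> \<open>The connecting path crosses the new edge from \<open>v\<close> to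
      \<open>w\<close>, against the direction of \<open>d\<close>.\<close>
    define d' where d': "d' = (fst d, 1 - snd d)"
    have wd': "walk \<Upsilon> v [d'] w"
      using walk_reverse[OF d(1)] unfolding d' reverse_walk_simps append_Nil .
    have hd': "step_head \<Upsilon> d' = w" using wd' by auto
    have dr: "is_path \<Upsilon> v (d' # r) b"
      using wd' wr rX r(1) hd' by (auto simp: is_path_def)
    have vdr: "set (walk_verts \<Upsilon> v (d' # r)) = insert v (set (walk_verts \<Upsilon> w r))" using hd' by simp
    have rp: "is_path \<Upsilon> a (reverse_walk p) v" by (rule is_path_reverse[OF p(1)])
    have wrp: "walk \<Upsilon> a (reverse_walk p) v" using rp by (simp add: is_path_def)
    let ?q = "reverse_walk p @ d' # r"
    have "is_path \<Upsilon> a ?q b"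
      using set_walk_verts_reverse[OF wp] rX vdr by (intro is_path_append[OF rp dr]) auto
    moreover have vq: "set (walk_verts \<Upsilon> a ?q) = set (walk_verts \<Upsilon> v p) \<union> set (walk_verts \<Upsilon> w r)"
      unfolding set_walk_verts_append[OF wrp] set_walk_verts_reverse[OF wp] vdr by auto
    moreover have "(set (walk_verts \<Upsilon> v p) \<union> set (walk_verts \<Upsilon> w r)) \<inter> verts_of \<Upsilon> N = {a}"
      "(set (walk_verts \<Upsilon> v p) \<union> set (walk_verts \<Upsilon> w r)) \<inter> verts_of \<Upsilon> M = {b}"
      using p(3) r(3) rX MX by auto
    moreover have "verts_of \<Upsilon> N \<inter> verts_of \<Upsilon> M = {}" "N \<noteq> M" using MX pa by auto
    ultimately have "handcuff \<Upsilon> N a ?q b M"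
      unfolding vq[symmetric] using N(1) M(1) by (intro handcuff_disjointI) simp_all
    then have "sign_circuit \<Upsilon> (N \<union> walk_edges ?q \<union> M)" unfolding sign_circuit_def by blast
    then show thesis using N M p r d' by (intro that[of "N \<union> walk_edges ?q \<union> M"]) auto
  qed
qed

end

section \<open>Circuit gains as linear forms in the edge gains\<close>

text \<open>A linear form whose support is exactly \<open>A\<close>. With no coefficient zero,
  knowing the form and the values at all but one element determines the remaining value.\<close>

definition support_form :: "'e set \<Rightarrow> (('e \<Rightarrow> 'k::field) \<Rightarrow> 'k) \<Rightarrow> bool" where
  "support_form A L \<longleftrightarrow> (\<exists>c. (\<forall>e\<in>A. c e \<noteq> 0) \<and> (\<forall>\<phi>. L \<phi> = (\<Sum>e\<in>A. c e * \<phi> e)))"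

lemma support_form_empty: "support_form {} (\<lambda>\<phi>. 0)"
  by (simp add: support_form_def)

lemma support_form_single: "k \<noteq> 0 \<Longrightarrow> support_form {e} (\<lambda>\<phi>. k * \<phi> e)"
  unfolding support_form_def by (intro exI[of _ "\<lambda>_. k"]) simp

lemma support_form_scale:
  assumes "support_form A L" "k \<noteq> 0"
  shows "support_form A (\<lambda>\<phi>. k * L \<phi>)"
proof -
  obtain c where "\<forall>e\<in>A. c e \<noteq> 0" "\<forall>\<phi>. L \<phi> = (\<Sum>e\<in>A. c e * \<phi> e)"
    using assms(1) by (auto simp: support_form_def)
  then show ?thesis unfolding support_form_def using assms(2)
    by (intro exI[of _ "\<lambda>e. k * c e"]) (simp add: sum_distrib_left mult.assoc)
qed

lemma support_form_union:
  assumes "support_form A L" "support_form B M" "A \<inter> B = {}" "finite A" "finite B"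
  shows "support_form (A \<union> B) (\<lambda>\<phi>. L \<phi> + M \<phi>)"
proof -
  obtain c where c: "\<forall>e\<in>A. c e \<noteq> 0" "\<forall>\<phi>. L \<phi> = (\<Sum>e\<in>A. c e * \<phi> e)"
    using assms(1) by (auto simp: support_form_def)
  obtain d where d: "\<forall>e\<in>B. d e \<noteq> 0" "\<forall>\<phi>. M \<phi> = (\<Sum>e\<in>B. d e * \<phi> e)"
    using assms(2) by (auto simp: support_form_def)
  let ?c = "\<lambda>e. if e \<in> A then c e else d e"
  have "(\<Sum>e\<in>A \<union> B. ?c e * \<phi> e) = L \<phi> + M \<phi>" for \<phi>
  proof -
    have "(\<Sum>e\<in>B. ?c e * \<phi> e) = (\<Sum>e\<in>B. d e * \<phi> e)"
      using assms(3) by (intro sum.cong) auto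
    then show ?thesis using c d assms(3-5) by (simp add: sum.union_disjoint)
  qed
  then show ?thesis unfolding support_form_def using c d by (intro exI[of _ ?c]) auto
qed

text \<open>The way in which full support is used, once for switched gains and once for kernel
  vectors: if all other entries on \<open>C\<close> vanish, the form sees only \<open>e\<close>, and
  with a nonzero factor.\<close>

lemma support_form_isolate:
  assumes "support_form C L" "e \<in> C" "finite C"
  obtains k where "k \<noteq> 0" "\<And>\<phi>. (\<And>f. f \<in> C \<Longrightarrow> f \<noteq> e \<Longrightarrow> \<phi> f = 0) \<Longrightarrow> L \<phi> = k * \<phi> e"
proof -
  obtain c where c: "\<forall>e\<in>C. c e \<noteq> 0" "\<forall>\<phi>. L \<phi> = (\<Sum>e\<in>C. c e * \<phi> e)"
    using assms(1) by (auto simp: support_form_def)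
  show thesis
  proof (rule that[of "c e"])
    show "c e \<noteq> 0" using c assms(2) by auto
    fix \<phi> :: "'a \<Rightarrow> 'b" assume z: "\<And>f. f \<in> C \<Longrightarrow> f \<noteq> e \<Longrightarrow> \<phi> f = 0"
    have "(\<Sum>f\<in>C. c f * \<phi> f) = (\<Sum>f\<in>{e}. c f * \<phi> f)"
      using z assms(2,3) by (intro sum.mono_neutral_right) auto
    then show "L \<phi> = c e * \<phi> e" using c(2) by simp
  qed
qed

section \<open>Walk gains under reversal and switching\<close>

context gain_signed_graph
begin

text \<open>The walk gain with the gain function as an argument, so that it can be evaluated at
  switched gains; the recursion pulls the sign of the first edge out of the rest.\<close>

fun walk_form :: "('e \<times> nat) list \<Rightarrow> ('e \<Rightarrow> 'k) \<Rightarrow> 'k" where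
  "walk_form [] \<phi> = 0"
| "walk_form (d # ds) \<phi> =
    - \<phi> (fst d) * of_int (orient \<Upsilon> (fst d) (snd d)) + of_int (edge_sign \<Upsilon> (fst d)) * walk_form ds \<phi>"

lemma walk_gain_eq_walk_form: "walk_gain \<Upsilon> ds = walk_form ds (edge_gain \<Upsilon>)"
proof (induction ds)
  case Nil
  then show ?case by (simp add: walk_gain_def)
next
  case (Cons d ds)
  have "walk_gain \<Upsilon> (d # ds) = - edge_gain \<Upsilon> (fst d) * of_int (orient \<Upsilon> (fst d) (snd d))
      + of_int (edge_sign \<Upsilon> (fst d)) * walk_gain \<Upsilon> ds"
    unfolding walk_gain_def
    by (simp add: sum.lessThan_Suc_shift sum_distrib_left mult_ac del: sum.lessThan_Suc)
  then show ?case using Cons by simp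
qed

lemma walk_form_append:
  "walk_form (p @ q) \<phi> = walk_form p \<phi> + of_int (walk_sign \<Upsilon> p) * walk_form q \<phi>"
  by (induction p) (auto simp: algebra_simps)

lemma orient_cases:
  assumes "fst d \<in> links_loops \<Upsilon>" "snd d < 2"
  shows "orient \<Upsilon> (fst d) (snd d) \<in> {1, -1}"
    "orient \<Upsilon> (fst d) (snd d) * orient \<Upsilon> (fst d) (1 - snd d) = - edge_sign \<Upsilon> (fst d)"
proof -
  have e: "fst d \<in> edges \<Upsilon>" "length (ends \<Upsilon> (fst d)) = 2" using assms(1) by (auto simp: links_loops_def)
  show "orient \<Upsilon> (fst d) (snd d) \<in> {1, -1}" using orient_values[OF e(1)] e(2) assms(2) by auto
  show "orient \<Upsilon> (fst d) (snd d) * orient \<Upsilon> (fst d) (1 - snd d) = - edge_sign \<Upsilon> (fst d)"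
    using orient_sign[OF e] assms(2)
    by (cases "snd d") (auto simp: less_Suc_eq numeral_2_eq_2 mult.commute)
qed

lemma orient_reverse:
  assumes "fst d \<in> links_loops \<Upsilon>" "snd d < 2"
  shows "orient \<Upsilon> (fst d) (1 - snd d) = - edge_sign \<Upsilon> (fst d) * orient \<Upsilon> (fst d) (snd d)"
  using orient_cases[OF assms] by auto

lemma edge_sign_square: "e \<in> edges \<Upsilon> \<Longrightarrow> edge_sign \<Upsilon> e * edge_sign \<Upsilon> e = 1"
  using edge_sign_values[of e] by auto

lemma walk_sign_square:
  assumes "walk \<Upsilon> u ds w"
  shows "walk_sign \<Upsilon> ds * walk_sign \<Upsilon> ds = 1"
  using walk_sign_values[OF assms] by auto

lemma walk_form_reverse:
  assumes "walk \<Upsilon> u p w"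
  shows "walk_form (reverse_walk p) \<phi> = - of_int (walk_sign \<Upsilon> p) * walk_form p \<phi>"
  using assms
proof (induction p arbitrary: u)
  case Nil
  then show ?case by simp
next
  case (Cons d ds)
  have d: "fst d \<in> links_loops \<Upsilon>" "snd d < 2" and w: "walk \<Upsilon> (step_head \<Upsilon> d) ds w"
    using Cons.prems by auto
  let ?s = "of_int (edge_sign \<Upsilon> (fst d)) :: 'k" and ?t = "of_int (walk_sign \<Upsilon> ds) :: 'k"
  let ?o = "of_int (orient \<Upsilon> (fst d) (snd d)) :: 'k"
  have ss: "?s * ?s = 1"
    using edge_sign_square[of "fst d"] d links_loops_subset by (metis of_int_1 of_int_mult subsetD)
  have "walk_form (reverse_walk (d # ds)) \<phi> = - ?t * walk_form ds \<phi> + ?t * (\<phi> (fst d) * (?s * ?o))"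
    using Cons.IH[OF w] orient_reverse[OF d] by (simp add: walk_form_append)
  \<comment> \<open>The square of the edge sign is inserted so that the sign of the whole walk
    factors out of both summands.\<close>
  also have "\<dots> = - (?s * ?s) * ?t * walk_form ds \<phi> + ?t * (\<phi> (fst d) * (?s * ?o))" using ss by simp
  also have "\<dots> = - of_int (walk_sign \<Upsilon> (d # ds)) * walk_form (d # ds) \<phi>" by (simp add: algebra_simps)
  finally show ?case .
qed

text \<open>Multiplication by the orientation at the tail leaves the tail with coefficient 1 and the
  head with minus the edge sign. In this form the switching terms telescope along a walk.\<close>

lemma switched_gain_step:
  assumes "fst d \<in> links_loops \<Upsilon>" "snd d < 2"
  shows "of_int (orient \<Upsilon> (fst d) (snd d)) * switched_gain \<Upsilon> \<theta> (fst d)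
    = of_int (orient \<Upsilon> (fst d) (snd d)) * edge_gain \<Upsilon> (fst d)
      + \<theta> (step_tail \<Upsilon> d) - of_int (edge_sign \<Upsilon> (fst d)) * \<theta> (step_head \<Upsilon> d)"
proof -
  obtain e i where d: "d = (e, i)" by force
  have len: "length (ends \<Upsilon> e) = 2" using assms d by (simp add: links_loops_def)
  have "switched_gain \<Upsilon> \<theta> e = edge_gain \<Upsilon> e + (of_int (orient \<Upsilon> e i) * \<theta> (ends \<Upsilon> e ! i)
      + of_int (orient \<Upsilon> e (1 - i)) * \<theta> (ends \<Upsilon> e ! (1 - i)))"
    using assms(2) d len
    by (cases i) (auto simp: switched_gain_def numeral_2_eq_2 less_Suc_eq)
  moreover have "(of_int (orient \<Upsilon> e i) * of_int (orient \<Upsilon> e i) :: 'k) = 1"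
  proof -
    have "orient \<Upsilon> e i * orient \<Upsilon> e i = 1" using orient_cases(1)[OF assms] d by auto
    then show ?thesis by (metis of_int_1 of_int_mult)
  qed
  moreover have "of_int (orient \<Upsilon> e i) * of_int (orient \<Upsilon> e (1 - i)) = (- of_int (edge_sign \<Upsilon> e) :: 'k)"
    using orient_cases(2)[OF assms] d by (metis fst_conv of_int_minus of_int_mult snd_conv)
  ultimately show ?thesis
    by (simp add: d step_head.simps step_tail.simps distrib_left flip: mult.assoc)
qed

text \<open>The telescoped sum. For a closed walk of sign 1 the switching terms cancel, while for
  one of sign -1 the term \<open>-2 * \<theta> u\<close> remains.\<close>

lemma walk_form_switched:
  "walk \<Upsilon> u ds w \<Longrightarrow> walk_form ds (switched_gain \<Upsilon> \<theta>)
    = walk_form ds (edge_gain \<Upsilon>) - \<theta> u + of_int (walk_sign \<Upsilon> ds) * \<theta> w"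
proof (induction ds arbitrary: u)
  case Nil
  then show ?case by auto
next
  case (Cons d ds)
  have d: "fst d \<in> links_loops \<Upsilon>" "snd d < 2" "step_tail \<Upsilon> d = u" and w: "walk \<Upsilon> (step_head \<Upsilon> d) ds w"
    using Cons.prems by auto
  show ?case unfolding walk_form.simps Cons.IH[OF w] walk_sign_Cons
    using switched_gain_step[OF d(1,2), of \<theta>] d(3) by (simp add: algebra_simps)
qed

lemma of_int_unit: "s \<in> {1, -1} \<Longrightarrow> (of_int s :: 'k) \<noteq> 0"
  by auto

lemma support_walk_form:
  assumes "walk \<Upsilon> u ds w" "distinct (map fst ds)"
  shows "support_form (walk_edges ds) (walk_form ds)"
  using assms
proof (induction ds arbitrary: u)
  case Nil
  have "walk_form [] = (\<lambda>\<phi>. 0)" by auto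
  then show ?case using support_form_empty by simp
next
  case (Cons d ds)
  have d: "fst d \<in> links_loops \<Upsilon>" "snd d < 2" and w: "walk \<Upsilon> (step_head \<Upsilon> d) ds w"
    using Cons.prems by auto
  have IH: "support_form (walk_edges ds) (walk_form ds)" using Cons.IH[OF w] Cons.prems(2) by simp
  have e: "edge_sign \<Upsilon> (fst d) \<in> {1, -1}" using edge_sign_values d(1) links_loops_subset by auto
  have "support_form ({fst d} \<union> walk_edges ds) (\<lambda>\<phi>. - of_int (orient \<Upsilon> (fst d) (snd d)) * \<phi> (fst d)
      + of_int (edge_sign \<Upsilon> (fst d)) * walk_form ds \<phi>)"
    using Cons.prems(2) of_int_unit[OF orient_cases(1)[OF d]]
    by (intro support_form_union support_form_scale IH of_int_unit[OF e] support_form_single)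
      (auto simp: walk_edges_eq_set)
  moreover have "walk_form (d # ds) = (\<lambda>\<phi>. - of_int (orient \<Upsilon> (fst d) (snd d)) * \<phi> (fst d)
      + of_int (edge_sign \<Upsilon> (fst d)) * walk_form ds \<phi>)" by (simp add: fun_eq_iff)
  ultimately show ?case by simp
qed

section \<open>The edge sets making up a handcuff\<close>

lemma path_edge_not_loop:
  "is_path \<Upsilon> u p w \<Longrightarrow> e \<in> walk_edges p \<Longrightarrow> \<exists>x y. x \<noteq> y \<and> set (ends \<Upsilon> e) = {x, y}"
proof (induction p arbitrary: u)
  case (Cons d ds)
  show ?case
  proof (cases "e \<in> walk_edges ds")
    case True
    then show ?thesis using Cons by (auto simp: is_path_def)
  next
    case False
    then have "e = fst d" using Cons.prems by auto
    moreover have "step_tail \<Upsilon> d \<noteq> step_head \<Upsilon> d" using Cons.prems(1) by (auto simp: is_path_def)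
    ultimately show ?thesis using ends_link_loop[of d] Cons.prems(1) by (auto simp: is_path_def)
  qed
qed simp

lemma ends_half_edge: "h \<in> half_edges \<Upsilon> \<Longrightarrow> ends \<Upsilon> h = [ends \<Upsilon> h ! 0]"
  by (cases "ends \<Upsilon> h") (auto simp: half_edges_def)

lemma negative_figure_ends:
  assumes "negative_figure \<Upsilon> N" "e \<in> N"
  shows "set (ends \<Upsilon> e) \<noteq> {}" "e \<in> half_edges \<Upsilon> \<Longrightarrow> N = {e}" "e \<notin> half_edges \<Upsilon> \<Longrightarrow> negative_circle \<Upsilon> N"
  using assms by (auto simp: negative_figure_def negative_circle_def circle_def links_loops_def half_edges_def)

text \<open>A path edge has two distinct ends, but the path meets each figure in one vertex only. An
  edge common to both figures would have all its ends at their single common vertex; being a half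
  edge or a loop there, it would be all of each figure.\<close>

lemma handcuff_disjoint:
  assumes "handcuff \<Upsilon> C u p w D"
  shows "C \<inter> walk_edges p = {}" "D \<inter> walk_edges p = {}" "C \<inter> D = {}"
proof -
  have N: "negative_figure \<Upsilon> C" "negative_figure \<Upsilon> D" "C \<noteq> D" and p: "is_path \<Upsilon> u p w"
    using assms by (auto simp: handcuff_def)
  have w: "walk \<Upsilon> u p w" using p by (simp add: is_path_def)
  have one: "F \<inter> walk_edges p = {}"
    if "set (walk_verts \<Upsilon> u p) \<inter> verts_of \<Upsilon> F = {z}" for F z
  proof (rule ccontr)
    assume "F \<inter> walk_edges p \<noteq> {}"
    then obtain e where e: "e \<in> F" "e \<in> walk_edges p" by blast
    have "set (ends \<Upsilon> e) \<subseteq> set (walk_verts \<Upsilon> u p) \<inter> verts_of \<Upsilon> F"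
      using e walk_verts_eq_verts_of[OF w] by (auto simp: verts_of_def)
    then show False using path_edge_not_loop[OF p e(2)] unfolding that by auto
  qed
  show "C \<inter> walk_edges p = {}" "D \<inter> walk_edges p = {}"
    using assms one unfolding handcuff_def by (metis Int_empty_right walk_edges_simps(1))+
  show "C \<inter> D = {}"
  proof (rule ccontr)
    assume "C \<inter> D \<noteq> {}"
    then obtain e where e: "e \<in> C" "e \<in> D" by blast
    have ends: "set (ends \<Upsilon> e) \<noteq> {}" "set (ends \<Upsilon> e) \<subseteq> verts_of \<Upsilon> C \<inter> verts_of \<Upsilon> D"
      using negative_figure_ends(1)[OF N(1) e(1)] e by (auto simp: verts_of_def)
    then have "verts_of \<Upsilon> C \<inter> verts_of \<Upsilon> D \<noteq> {}" by (metis subset_empty)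
    then have "verts_of \<Upsilon> C \<inter> verts_of \<Upsilon> D = {u}" using assms by (simp add: handcuff_def)
    then have eu: "set (ends \<Upsilon> e) = {u}" using ends subset_singletonD by metis
    have "C = {e}" "D = {e}"
      using negative_figure_ends(2,3)[OF N(1) e(1)] negative_figure_ends(2,3)[OF N(2) e(2)]
        circle_loop[OF _ e(1) eu] circle_loop[OF _ e(2) eu] by (auto simp: negative_circle_def)
    then show False using N(3) by simp
  qed
qed

lemma handcuff_sym: "handcuff \<Upsilon> C u p w D \<Longrightarrow> handcuff \<Upsilon> D w (reverse_walk p) u C"
  unfolding handcuff_def
  using is_path_reverse set_walk_verts_reverse[of u p w] is_path_closed_Nil
  by (auto simp: is_path_def Int_commute)

lemma handcuff_half_edge:
  assumes "handcuff \<Upsilon> {h} u p w D" "h \<in> half_edges \<Upsilon>"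
  shows "ends \<Upsilon> h = [u]"
proof -
  have "u \<in> verts_of \<Upsilon> {h}" using assms(1) unfolding handcuff_def by blast
  moreover obtain x where "ends \<Upsilon> h = [x]" using ends_half_edge[OF assms(2)] by blast
  ultimately show ?thesis by (simp add: verts_of_def)
qed

lemma walk_around_negative:
  assumes "negative_circle \<Upsilon> C" "walk_around \<Upsilon> C u c"
  shows "walk \<Upsilon> u c u" "walk_sign \<Upsilon> c = -1" "support_form C (walk_form c)"
  using assms walk_sign_distinct[of c \<Upsilon>] support_walk_form[of u c u]
  by (auto simp: negative_circle_def walk_around_def)

text \<open>Each circuit walk is arranged so that its switching terms cancel. The coefficients are
  units, except for the factor 2 on whatever the walk traverses twice; this is where characteristic
  2 has to be excluded.\<close>

lemma circuit_gain_form: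
  assumes two: "(2::'k) \<noteq> 0" and "circuit_gain \<Upsilon> C g"
  obtains L where "support_form C L" "\<And>\<theta>. L (switched_gain \<Upsilon> \<theta>) = g"
proof -
  have fin: "finite (walk_edges ds)" for ds :: "('e \<times> nat) list" by (simp add: walk_edges_def)
  have finN: "negative_figure \<Upsilon> N \<Longrightarrow> finite N" for N
    using negative_figure_subset finite_edges finite_subset by blast
  have unit: "(of_int s * of_int s :: 'k) = 1" if "s \<in> {1, -1::int}" for s using that by auto
  have half: "orient \<Upsilon> h 0 \<in> {1, -1}"
    "of_int (orient \<Upsilon> h 0) * switched_gain \<Upsilon> \<theta> h = of_int (orient \<Upsilon> h 0) * edge_gain \<Upsilon> h + \<theta> u"
    if "h \<in> half_edges \<Upsilon>" "ends \<Upsilon> h = [u]" for h u \<theta>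
  proof -
    show o: "orient \<Upsilon> h 0 \<in> {1, -1}" using that orient_values[of h 0] by (simp add: half_edges_def)
    show "of_int (orient \<Upsilon> h 0) * switched_gain \<Upsilon> \<theta> h = of_int (orient \<Upsilon> h 0) * edge_gain \<Upsilon> h + \<theta> u"
      using that(2) unit[OF o] by (simp add: switched_gain_def distrib_left flip: mult.assoc)
  qed
  have "\<exists>L. support_form C L \<and> (\<forall>\<theta>. L (switched_gain \<Upsilon> \<theta>) = g)"
    using assms(2)
  proof cases
    case (loose e)
    then show ?thesis using support_form_single[of "1::'k" e]
      by (intro exI[of _ "\<lambda>\<phi>. 1 * \<phi> e"]) (auto simp: switched_gain_def loose_edges_def)
  next
    case (positive_circle u c)
    have w: "walk \<Upsilon> u c u" "distinct (map fst c)" "walk_edges c = C"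
      using positive_circle by (auto simp: walk_around_def)
    have "walk_sign \<Upsilon> c = 1" using positive_circle(2) w(3) walk_sign_distinct[OF w(2), of \<Upsilon>]
      by (simp add: positive_circle_def)
    then show ?thesis using support_walk_form[OF w(1,2)] w(3) walk_form_switched[OF w(1)] positive_circle(1)
      by (intro exI[of _ "walk_form c"]) (simp add: walk_gain_eq_walk_form)
  next
    case (circle_circle C1 u p w C2 c1 c2)
    note c1 = walk_around_negative[OF circle_circle(4,6)]
    note c2 = walk_around_negative[OF circle_circle(5,7)]
    have p: "walk \<Upsilon> u p w" "distinct (map fst p)"
      using circle_circle(3) is_path_distinct_edges[of u p w] by (auto simp: handcuff_def is_path_def)
    let ?q = "c1 @ p @ c2 @ reverse_walk p"
    have wq: "walk \<Upsilon> u ?q u"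
      unfolding walk_append_iff using c1(1) p(1) c2(1) walk_reverse[OF p(1)] by blast
    have sq: "walk_sign \<Upsilon> ?q = 1" using c1(2) c2(2) walk_sign_square[OF p(1)] by simp
    \<comment> \<open>The return along \<open>p\<close> follows two negative circles and
      \<open>p\<close> itself; together with the factor \<open>- walk_sign\<close> from reversal it
      adds up with the first passage, which already carries -1 from \<open>c1\<close>, to
      coefficient -2.\<close>
    have "walk_form ?q \<phi> = (walk_form c1 \<phi> + (- 2) * walk_form p \<phi>)
        + (- of_int (walk_sign \<Upsilon> p)) * walk_form c2 \<phi>" for \<phi>
    proof -
      have "(of_int (walk_sign \<Upsilon> p) * of_int (walk_sign \<Upsilon> p) :: 'k) = 1"
        by (rule unit[OF walk_sign_values[OF p(1)]])
      then have "of_int (walk_sign \<Upsilon> p) * (of_int (walk_sign \<Upsilon> p) * x) = x" for x :: 'k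
        by (simp flip: mult.assoc)
      then show ?thesis
        using c1(2) c2(2) by (simp add: walk_form_append walk_form_reverse[OF p(1)] algebra_simps)
    qed
    moreover have "support_form (C1 \<union> walk_edges p \<union> C2)
        (\<lambda>\<phi>. (walk_form c1 \<phi> + (- 2) * walk_form p \<phi>) + (- of_int (walk_sign \<Upsilon> p)) * walk_form c2 \<phi>)"
      using handcuff_disjoint[OF circle_circle(3)] two of_int_unit[OF walk_sign_values[OF p(1)]]
        finN[of C1] finN[of C2] circle_circle(4,5)
      by (intro support_form_union support_form_scale c1(3) c2(3) support_walk_form[OF p])
        (auto simp: fin negative_figure_def)
    ultimately have "support_form C (walk_form ?q)" using circle_circle(1) by presburger
    then show ?thesis
      using walk_form_switched[OF wq] circle_circle(2) walk_gain_eq_walk_form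
      unfolding sq by (intro exI[of _ "walk_form ?q"]) simp
  next
    case (half_circle h u p w C2 c2)
    note c2 = walk_around_negative[OF half_circle(5,6)]
    have p: "walk \<Upsilon> u p w" "distinct (map fst p)"
      using half_circle(3) is_path_distinct_edges[of u p w] by (auto simp: handcuff_def is_path_def)
    note h = half[OF half_circle(4) handcuff_half_edge[OF half_circle(3,4)]]
    let ?q = "p @ c2 @ reverse_walk p"
    have wq: "walk \<Upsilon> u ?q u"
      unfolding walk_append_iff using p(1) c2(1) walk_reverse[OF p(1)] by blast
    have sq: "walk_sign \<Upsilon> ?q = -1" using c2(2) walk_sign_square[OF p(1)] by simp
    \<comment> \<open>The final passage of \<open>h\<close> is subtracted with the sign of a
      negative closed walk, so it adds to the initial one and doubles the coefficient.\<close>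
    let ?L = "\<lambda>\<phi>. 2 * of_int (orient \<Upsilon> h 0) * \<phi> h + walk_form ?q \<phi>"
    have "?L \<phi> = (2 * of_int (orient \<Upsilon> h 0) * \<phi> h + 2 * walk_form p \<phi>)
        + of_int (walk_sign \<Upsilon> p) * walk_form c2 \<phi>" for \<phi>
    proof -
      have "(of_int (walk_sign \<Upsilon> p) * of_int (walk_sign \<Upsilon> p) :: 'k) = 1"
        by (rule unit[OF walk_sign_values[OF p(1)]])
      then have "of_int (walk_sign \<Upsilon> p) * (of_int (walk_sign \<Upsilon> p) * x) = x" for x :: 'k
        by (simp flip: mult.assoc)
      then show ?thesis
        using c2(2) by (simp add: walk_form_append walk_form_reverse[OF p(1)] algebra_simps)
    qed
    moreover have "support_form ({h} \<union> walk_edges p \<union> C2)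
        (\<lambda>\<phi>. (2 * of_int (orient \<Upsilon> h 0) * \<phi> h + 2 * walk_form p \<phi>)
          + of_int (walk_sign \<Upsilon> p) * walk_form c2 \<phi>)"
      using handcuff_disjoint[OF half_circle(3)] two of_int_unit[OF walk_sign_values[OF p(1)]]
        finN[of C2] half_circle(5) of_int_unit[OF h(1)]
      by (intro support_form_union support_form_scale c2(3) support_walk_form[OF p] support_form_single)
        (auto simp: fin negative_figure_def)
    ultimately have "support_form C ?L" using half_circle(1) by presburger
    \<comment> \<open>Switching adds \<open>-2 * \<theta> u\<close> to the form of the negative
      closed walk and \<open>2 * \<theta> u\<close> through the two passages of
      \<open>h\<close>.\<close>
    moreover have "?L (switched_gain \<Upsilon> \<theta>) = g" for \<theta>
      using walk_form_switched[OF wq, of \<theta>] sq half_circle(2) h(2)[of \<theta>]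
      by (simp add: ultrawalk_gain_def walk_gain_eq_walk_form algebra_simps del: walk_sign_append)
    ultimately show ?thesis by (intro exI[of _ ?L]) simp
  next
    case (half_half h1 u p w h2)
    have p: "walk \<Upsilon> u p w" "distinct (map fst p)"
      using half_half(3) is_path_distinct_edges[of u p w] by (auto simp: handcuff_def is_path_def)
    note h1 = half[OF half_half(4) handcuff_half_edge[OF half_half(3,4)]]
    note h2 = half[OF half_half(5) handcuff_half_edge[OF handcuff_sym[OF half_half(3)] half_half(5)]]
    let ?L = "\<lambda>\<phi>. (of_int (orient \<Upsilon> h1 0) * \<phi> h1 + walk_form p \<phi>)
        + (- of_int (walk_sign \<Upsilon> p) * of_int (orient \<Upsilon> h2 0)) * \<phi> h2"
    have "support_form ({h1} \<union> walk_edges p \<union> {h2}) ?L"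
      using handcuff_disjoint[OF half_half(3)] of_int_unit[OF walk_sign_values[OF p(1)]]
        of_int_unit[OF h1(1)] of_int_unit[OF h2(1)]
      by (intro support_form_union support_walk_form[OF p] support_form_single) (auto simp: fin)
    \<comment> \<open>The half edge \<open>h1\<close> cancels the switching term of \<open>p\<close>
      at \<open>u\<close>; \<open>h2\<close>, weighted by the sign of \<open>p\<close>, cancels the
      one at \<open>w\<close>.\<close>
    moreover have "?L (switched_gain \<Upsilon> \<theta>) = g" for \<theta>
    proof -
      have "?L (switched_gain \<Upsilon> \<theta>)
          = (of_int (orient \<Upsilon> h1 0) * switched_gain \<Upsilon> \<theta> h1 + walk_form p (switched_gain \<Upsilon> \<theta>))
            - of_int (walk_sign \<Upsilon> p) * (of_int (orient \<Upsilon> h2 0) * switched_gain \<Upsilon> \<theta> h2)"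
        by (simp add: mult.assoc)
      also have "\<dots> = g"
        unfolding h1(2) h2(2) walk_form_switched[OF p(1)]
        using half_half(2) by (simp add: ultrawalk_gain_def walk_gain_eq_walk_form algebra_simps)
      finally show ?thesis .
    qed
    ultimately show ?thesis using half_half(1) by (intro exI[of _ ?L]) simp
  qed
  with that show thesis by blast
qed

section \<open>Existence of circuit walks and the effect of making gains zero\<close>

lemma circle_walk_around:
  assumes "circle \<Upsilon> C" "u \<in> verts_of \<Upsilon> C"
  obtains c where "walk_around \<Upsilon> C u c"
  using circle_cycle_walk[OF assms] that by (auto simp: cycle_walk_def walk_around_def)

lemma handcuff_ends:
  assumes "handcuff \<Upsilon> C u p w D"
  shows "u \<in> verts_of \<Upsilon> C" "w \<in> verts_of \<Upsilon> D"
proof -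
  show "u \<in> verts_of \<Upsilon> C" using assms unfolding handcuff_def by blast
  have "p = [] \<Longrightarrow> u = w" using assms by (simp add: handcuff_def is_path_def)
  then show "w \<in> verts_of \<Upsilon> D" using assms unfolding handcuff_def by blast
qed

lemma sign_circuit_has_gain:
  assumes "sign_circuit \<Upsilon> C"
  obtains g where "circuit_gain \<Upsilon> C g"
proof -
  have hc: "\<exists>g. circuit_gain \<Upsilon> (C1 \<union> walk_edges p \<union> C2) g"
    if H: "handcuff \<Upsilon> C1 u p w C2" and C2: "negative_circle \<Upsilon> C2" for C1 u p w C2
  proof -
    obtain c2 where c2: "walk_around \<Upsilon> C2 w c2"
      using circle_walk_around handcuff_ends(2)[OF H] C2 by (auto simp: negative_circle_def)
    show ?thesis
    proof (cases "negative_circle \<Upsilon> C1")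
      case True
      then obtain c1 where "walk_around \<Upsilon> C1 u c1"
        using circle_walk_around handcuff_ends(1)[OF H] by (auto simp: negative_circle_def)
      then show ?thesis using circuit_gain.circle_circle[OF H True C2 _ c2] by blast
    next
      case False
      then obtain h where h: "h \<in> half_edges \<Upsilon>" "C1 = {h}"
        using H by (auto simp: handcuff_def negative_figure_def)
      show ?thesis using circuit_gain.half_circle[OF H[unfolded h(2)] h(1) C2 c2] h(2) by blast
    qed
  qed
  have "\<exists>g. circuit_gain \<Upsilon> C g"
    using assms unfolding sign_circuit_def
  proof (elim disjE)
    assume C: "positive_circle \<Upsilon> C"
    then have "C \<noteq> {}" "C \<subseteq> links_loops \<Upsilon>" by (auto simp: positive_circle_def circle_def)
    then obtain e where "e \<in> C" "length (ends \<Upsilon> e) = 2" by (auto simp: links_loops_def)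
    then have v: "ends \<Upsilon> e ! 0 \<in> verts_of \<Upsilon> C"
      unfolding verts_of_def by (intro UN_I[of e] nth_mem) simp_all
    have "circle \<Upsilon> C" using C by (simp add: positive_circle_def)
    then obtain c where "walk_around \<Upsilon> C (ends \<Upsilon> e ! 0) c" by (rule circle_walk_around[OF _ v])
    then show ?thesis using circuit_gain.positive_circle[OF C] by blast
  next
    assume "\<exists>e\<in>loose_edges \<Upsilon>. C = {e}"
    then show ?thesis by (auto intro: circuit_gain.loose)
  next
    assume "\<exists>C1 u p w C2. handcuff \<Upsilon> C1 u p w C2 \<and> C = C1 \<union> walk_edges p \<union> C2"
    then obtain C1 u p w C2 where H: "handcuff \<Upsilon> C1 u p w C2" and C: "C = C1 \<union> walk_edges p \<union> C2"
      by blast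
    consider "negative_circle \<Upsilon> C2" | "negative_circle \<Upsilon> C1"
      | h1 h2 where "h1 \<in> half_edges \<Upsilon>" "C1 = {h1}" "h2 \<in> half_edges \<Upsilon>" "C2 = {h2}"
      using H by (auto simp: handcuff_def negative_figure_def)
    then show ?thesis
    proof cases
      case 1
      then show ?thesis using hc[OF H] C by simp
    next
      case 2
      \<comment> \<open>The half edge comes first in the rule \<open>half_circle\<close>, so a
        handcuff whose circle is its first figure is read backwards.\<close>
      then show ?thesis using hc[OF handcuff_sym[OF H]] C by (simp add: Un_ac)
    next
      case 3
      show ?thesis
        using circuit_gain.half_half[OF H[unfolded 3(2,4)] 3(1,3)] unfolding C 3(2,4) by (rule exI)
    qed
  qed
  with that show thesis by blast
qed

lemma sign_circuit_subset: "sign_circuit \<Upsilon> C \<Longrightarrow> C \<subseteq> edges \<Upsilon>"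
  unfolding sign_circuit_def
proof (elim disjE exE conjE)
  assume "positive_circle \<Upsilon> C"
  then show ?thesis using links_loops_subset by (auto simp: positive_circle_def circle_def)
next
  assume "\<exists>e\<in>loose_edges \<Upsilon>. C = {e}"
  then show ?thesis by (auto simp: loose_edges_def)
next
  fix C1 u p w C2 assume H: "handcuff \<Upsilon> C1 u p w C2" and C: "C = C1 \<union> walk_edges p \<union> C2"
  have "negative_figure \<Upsilon> C1" "negative_figure \<Upsilon> C2" "walk \<Upsilon> u p w"
    using H by (simp_all add: handcuff_def is_path_def)
  then show ?thesis
    unfolding C using negative_figure_subset[of C1] negative_figure_subset[of C2]
      order_trans[OF walk_edges_links[of u p w] links_loops_subset] by (intro Un_least) simp_all
qed

text \<open>The circuit gain may be evaluated after switching by \<open>\<theta>\<close>, where it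
  is a combination of zeros.\<close>

lemma hyperbalanced_if_switched:
  assumes "(2::'k) \<noteq> 0" "S \<subseteq> gain_edges \<Upsilon> \<theta>"
  shows "hyperbalanced \<Upsilon> S"
  unfolding hyperbalanced_def
proof (intro allI impI)
  fix C assume C: "sign_circuit \<Upsilon> C \<and> C \<subseteq> S"
  then obtain g where g: "circuit_gain \<Upsilon> C g" using sign_circuit_has_gain by blast
  obtain L where L: "support_form C L" "\<And>\<theta>. L (switched_gain \<Upsilon> \<theta>) = g"
    using circuit_gain_form[OF assms(1) g] by blast
  have "L (switched_gain \<Upsilon> \<theta>) = 0"
    using L(1) C assms(2) by (fastforce simp: support_form_def gain_edges_def intro!: sum.neutral)
  then show "neutral_circuit \<Upsilon> C" using C g L(2)[of \<theta>] by (simp add: neutral_circuit_def)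
qed

text \<open>After switching by \<open>\<theta>\<close> only \<open>e\<close> can contribute to the
  gain of \<open>C\<close>, and its coefficient is nonzero.\<close>

lemma neutral_circuit_switched:
  assumes "(2::'k) \<noteq> 0" "A \<subseteq> gain_edges \<Upsilon> \<theta>" "neutral_circuit \<Upsilon> C" "e \<in> C" "C \<subseteq> insert e A"
  shows "e \<in> gain_edges \<Upsilon> \<theta>"
proof -
  have C: "sign_circuit \<Upsilon> C" "circuit_gain \<Upsilon> C 0" using assms(3) by (auto simp: neutral_circuit_def)
  obtain L where L: "support_form C L" "\<And>\<theta>. L (switched_gain \<Upsilon> \<theta>) = 0"
    using circuit_gain_form[OF assms(1) C(2)] by blast
  have "finite C" using sign_circuit_subset[OF C(1)] finite_edges finite_subset by blast
  then obtain k where k: "k \<noteq> 0" "\<And>\<phi>. (\<And>f. f \<in> C \<Longrightarrow> f \<noteq> e \<Longrightarrow> \<phi> f = 0) \<Longrightarrow> L \<phi> = k * \<phi> e"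
    using support_form_isolate[OF L(1) assms(4)] by metis
  have "L (switched_gain \<Upsilon> \<theta>) = k * switched_gain \<Upsilon> \<theta> e"
    using assms(2,5) by (intro k(2)) (auto simp: gain_edges_def)
  then have "switched_gain \<Upsilon> \<theta> e = 0" using L(2)[of \<theta>] k(1) by simp
  then show ?thesis using sign_circuit_subset[OF C(1)] assms(4) by (auto simp: gain_edges_def)
qed

end

section \<open>Components and sign potentials\<close>

context gain_signed_graph
begin

lemma components_eq: "components \<Upsilon> A = (\<lambda>v. {w. joined_in \<Upsilon> A v w}) ` verts \<Upsilon>"
  unfolding components_def quotient_def using joined_in_verts by (fastforce simp: Image_def)

lemma component_class_eq:
  assumes "joined_in \<Upsilon> A v w"
  shows "{x. joined_in \<Upsilon> A v x} = {x. joined_in \<Upsilon> A w x}"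
  using joined_in_trans[OF assms] joined_in_trans[OF joined_in_sym[OF assms]] by blast

lemma not_sign_balanced_iff:
  "\<not> sign_balanced \<Upsilon> A \<longleftrightarrow> (\<exists>N. N \<subseteq> A \<and> negative_figure \<Upsilon> N)"
  unfolding sign_balanced_def negative_figure_def by blast

text \<open>A negative figure is connected and has no loose edge, so as soon as it meets the class
  of \<open>v\<close> it lies entirely in the edge set induced there.\<close>

lemma negative_figure_in_class:
  assumes "A \<subseteq> edges \<Upsilon>"
  shows "\<not> sign_balanced \<Upsilon> (induced \<Upsilon> A {w. joined_in \<Upsilon> A v w}) \<longleftrightarrow>
    (\<exists>N x. negative_figure \<Upsilon> N \<and> N \<subseteq> A \<and> x \<in> verts_of \<Upsilon> N \<and> joined_in \<Upsilon> A v x)"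
    (is "_ \<longleftrightarrow> ?R")
proof
  assume "\<not> sign_balanced \<Upsilon> (induced \<Upsilon> A {w. joined_in \<Upsilon> A v w})"
  then obtain N where N: "N \<subseteq> induced \<Upsilon> A {w. joined_in \<Upsilon> A v w}" "negative_figure \<Upsilon> N"
    unfolding not_sign_balanced_iff by blast
  obtain x where "x \<in> verts_of \<Upsilon> N" by (rule negative_figure_verts[OF N(2)])
  moreover have "N \<subseteq> A" "verts_of \<Upsilon> N \<subseteq> {w. joined_in \<Upsilon> A v w}"
    using N(1) by (auto simp: induced_def verts_of_def)
  ultimately show ?R using N(2) by blast
next
  assume ?R
  then obtain N x where N: "negative_figure \<Upsilon> N" "N \<subseteq> A" "x \<in> verts_of \<Upsilon> N" "joined_in \<Upsilon> A v x"
    by blast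
  have "joined_in \<Upsilon> A v y" if "y \<in> verts_of \<Upsilon> N" for y
    by (rule joined_in_trans[OF N(4) joined_in_mono[OF negative_figure_joined[OF N(1,3) that] N(2)]])
  then have "N \<subseteq> induced \<Upsilon> A {w. joined_in \<Upsilon> A v w}"
    using N(2) negative_figure_ends(1)[OF N(1)] by (fastforce simp: induced_def verts_of_def)
  then show "\<not> sign_balanced \<Upsilon> (induced \<Upsilon> A {w. joined_in \<Upsilon> A v w})"
    unfolding not_sign_balanced_iff using N(1) by blast
qed

text \<open>From here on, being unbalanced means reaching a negative figure inside \<open>A\<close>;
  the quotient that defines the components is no longer needed to speak about single
  vertices.\<close>

lemma unbal_verts_iff:
  assumes "A \<subseteq> edges \<Upsilon>"
  shows "v \<in> unbal_verts \<Upsilon> A \<longleftrightarrow> v \<in> verts \<Upsilon> \<and>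
    (\<exists>N x. negative_figure \<Upsilon> N \<and> N \<subseteq> A \<and> x \<in> verts_of \<Upsilon> N \<and> joined_in \<Upsilon> A v x)"
proof -
  have "v \<in> \<Union> (bal_components \<Upsilon> A) \<longleftrightarrow>
      sign_balanced \<Upsilon> (induced \<Upsilon> A {w. joined_in \<Upsilon> A v w})" if v: "v \<in> verts \<Upsilon>"
  proof
    assume "v \<in> \<Union> (bal_components \<Upsilon> A)"
    then obtain u where "joined_in \<Upsilon> A u v" "sign_balanced \<Upsilon> (induced \<Upsilon> A {w. joined_in \<Upsilon> A u w})"
      by (auto simp: bal_components_def components_eq)
    then show "sign_balanced \<Upsilon> (induced \<Upsilon> A {w. joined_in \<Upsilon> A v w})"
      using component_class_eq by simp
  next
    assume "sign_balanced \<Upsilon> (induced \<Upsilon> A {w. joined_in \<Upsilon> A v w})"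
    then show "v \<in> \<Union> (bal_components \<Upsilon> A)"
      using v joined_in_refl by (auto simp: bal_components_def components_eq)
  qed
  then show ?thesis unfolding unbal_verts_def negative_figure_in_class[OF assms, symmetric] by blast
qed

lemma bal_components_iff:
  assumes "A \<subseteq> edges \<Upsilon>"
  shows "B \<in> bal_components \<Upsilon> A \<longleftrightarrow>
    (\<exists>v. v \<in> verts \<Upsilon> - unbal_verts \<Upsilon> A \<and> B = {w. joined_in \<Upsilon> A v w})"
  unfolding bal_components_def components_eq
  using unbal_verts_iff[OF assms] negative_figure_in_class[OF assms] by blast

lemma bal_verts_joined:
  assumes "A \<subseteq> edges \<Upsilon>" "joined_in \<Upsilon> A v w" "v \<in> verts \<Upsilon> - unbal_verts \<Upsilon> A"
  shows "w \<in> verts \<Upsilon> - unbal_verts \<Upsilon> A"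
proof -
  have "joined_in \<Upsilon> A v x" if "joined_in \<Upsilon> A w x" for x by (rule joined_in_trans[OF assms(2) that])
  then show ?thesis using assms(3) joined_in_verts[OF assms(2)] unfolding unbal_verts_iff[OF assms(1)] Diff_iff
    by blast
qed

lemma bal_closed_walk_sign:
  assumes A: "A \<subseteq> edges \<Upsilon>" and v: "v \<in> verts \<Upsilon> - unbal_verts \<Upsilon> A"
    and w: "walk \<Upsilon> v ds v" "walk_edges ds \<subseteq> A"
  shows "walk_sign \<Upsilon> ds = 1"
proof (rule ccontr)
  assume "walk_sign \<Upsilon> ds \<noteq> 1"
  then have s: "walk_sign \<Upsilon> ds = -1" using walk_sign_values[OF w(1)] by auto
  obtain C where C: "C \<subseteq> walk_edges ds" "negative_circle \<Upsilon> C"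
    by (rule negative_closed_walk[OF w(1) s])
  have N: "negative_figure \<Upsilon> C" using C(2) by (simp add: negative_figure_def)
  obtain x where x: "x \<in> verts_of \<Upsilon> C" by (rule negative_figure_verts[OF N])
  then have "x \<in> set (walk_verts \<Upsilon> v ds)"
    using C(1) walk_verts_eq_verts_of[OF w(1)] by (auto simp: verts_of_def)
  then have "joined_in \<Upsilon> A v x" by (rule walk_verts_joined[OF w])
  then show False using v N x C(1) w(2) unfolding unbal_verts_iff[OF A] Diff_iff by blast
qed

lemma edge_cases:
  assumes "e \<in> edges \<Upsilon>"
  obtains "e \<in> loose_edges \<Upsilon>" | "e \<in> half_edges \<Upsilon>" | "e \<in> links_loops \<Upsilon>"
proof -
  have "length (ends \<Upsilon> e) = 0 \<or> length (ends \<Upsilon> e) = 1 \<or> length (ends \<Upsilon> e) = 2"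
    using length_ends[OF assms] by linarith
  then show thesis using that assms by (auto simp: loose_edges_def half_edges_def links_loops_def)
qed

text \<open>A half edge is itself a negative figure and makes its own vertex unbalanced.\<close>

lemma bal_induced_link_loop:
  assumes A: "A \<subseteq> edges \<Upsilon>" and e: "e \<in> induced \<Upsilon> A (verts \<Upsilon> - unbal_verts \<Upsilon> A)"
  shows "e \<in> links_loops \<Upsilon>"
proof -
  have eE: "e \<in> edges \<Upsilon>" "e \<in> A" "ends \<Upsilon> e \<noteq> []" "set (ends \<Upsilon> e) \<subseteq> verts \<Upsilon> - unbal_verts \<Upsilon> A"
    using e A by (auto simp: induced_def)
  have "e \<notin> half_edges \<Upsilon>"
  proof
    assume h: "e \<in> half_edges \<Upsilon>"
    let ?v = "ends \<Upsilon> e ! 0"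
    have v: "?v \<in> set (ends \<Upsilon> e)" using eE(3) by simp
    have "?v \<in> verts_of \<Upsilon> {e}" "joined_in \<Upsilon> A ?v ?v" "negative_figure \<Upsilon> {e}"
      using v h eE joined_in_refl[of ?v A] subsetD[OF eE(4) v] by (auto simp: verts_of_def negative_figure_def)
    then have "?v \<in> unbal_verts \<Upsilon> A"
      using unbal_verts_iff[OF A, of ?v] eE(2) subsetD[OF eE(4) v] by auto
    then show False using eE(4) v by auto
  qed
  moreover have "e \<notin> loose_edges \<Upsilon>" using eE(3) by (simp add: loose_edges_def)
  ultimately show ?thesis using edge_cases[OF eE(1)] by blast
qed

text \<open>Each vertex gets the sign of a chosen walk from the root of its class. An edge of a
  balanced class closes two such walks to a closed walk, whose sign must be 1.\<close>

lemma sign_potential_exists: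
  assumes A: "A \<subseteq> edges \<Upsilon>"
  obtains \<zeta> where "sign_potential \<Upsilon> (verts \<Upsilon> - unbal_verts \<Upsilon> A) \<zeta>
      (induced \<Upsilon> A (verts \<Upsilon> - unbal_verts \<Upsilon> A))"
proof -
  let ?X = "verts \<Upsilon> - unbal_verts \<Upsilon> A"
  \<comment> \<open>The choice depends only on the class as a set, so joined vertices receive the
    same root.\<close>
  define root where "root v = (SOME r. r \<in> {w. joined_in \<Upsilon> A v w})" for v
  have root: "joined_in \<Upsilon> A (root v) v" if "v \<in> verts \<Upsilon>" for v
    unfolding root_def mem_Collect_eq by (rule joined_in_sym, rule someI, rule joined_in_refl[OF that])
  have root_eq: "root v = root w" if "joined_in \<Upsilon> A v w" for v w
    unfolding root_def component_class_eq[OF that] ..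
  have "\<exists>ds. walk \<Upsilon> (root v) ds v \<and> walk_edges ds \<subseteq> A" if "v \<in> verts \<Upsilon>" for v
    using root[OF that] by (simp add: joined_in_def)
  then obtain P where P: "\<And>v. v \<in> verts \<Upsilon> \<Longrightarrow> walk \<Upsilon> (root v) (P v) v \<and> walk_edges (P v) \<subseteq> A" by metis
  define \<zeta> where "\<zeta> v = walk_sign \<Upsilon> (P v)" for v
  have \<zeta>: "\<zeta> v \<in> {1, -1}" if "v \<in> verts \<Upsilon>" for v
    unfolding \<zeta>_def using P[OF that] walk_sign_values by blast
  have "edge_sign \<Upsilon> e = \<zeta> (ends \<Upsilon> e ! 0) * \<zeta> (ends \<Upsilon> e ! 1)" if e: "e \<in> induced \<Upsilon> A ?X" for e
  proof -
    have eL: "e \<in> links_loops \<Upsilon>" by (rule bal_induced_link_loop[OF A e])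
    have eA: "e \<in> A" using e by (simp add: induced_def)
    let ?d = "(e, 0::nat)"
    let ?v = "step_tail \<Upsilon> ?d" and ?w = "step_head \<Upsilon> ?d"
    have vw: "?v \<in> ?X" "?w \<in> ?X"
      using e ends_link_loop[of ?d] eL by (auto simp: induced_def)
    have d: "walk \<Upsilon> ?v [?d] ?w" by (rule walk_single[OF eL]) simp
    have j: "joined_in \<Upsilon> A ?v ?w" using d eA unfolding joined_in_def by (intro exI[of _ "[?d]"]) simp
    have Pv: "walk \<Upsilon> (root ?v) (P ?v) ?v" "walk_edges (P ?v) \<subseteq> A" using P vw by auto
    have Pw: "walk \<Upsilon> (root ?v) (P ?w) ?w" "walk_edges (P ?w) \<subseteq> A" using P vw root_eq[OF j] by auto
    have rw: "walk \<Upsilon> (root ?v) (P ?v @ [?d] @ reverse_walk (P ?w)) (root ?v)"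
      unfolding walk_append_iff using Pv(1) d walk_reverse[OF Pw(1)] by blast
    have rX: "root ?v \<in> ?X" using bal_verts_joined[OF A joined_in_sym[OF root] vw(1)] vw(1) by blast
    have "walk_edges (P ?v @ [?d] @ reverse_walk (P ?w)) \<subseteq> A" using Pv(2) Pw(2) eA by simp
    from bal_closed_walk_sign[OF A rX rw this]
    have "\<zeta> ?v * edge_sign \<Upsilon> e * \<zeta> ?w = 1" by (simp add: \<zeta>_def mult.assoc)
    moreover have "\<zeta> ?v \<in> {1, -1}" "\<zeta> ?w \<in> {1, -1}" using \<zeta> vw by auto
    ultimately have "edge_sign \<Upsilon> e = \<zeta> ?v * \<zeta> ?w" by auto
    then show ?thesis by (simp add: step_tail.simps step_head.simps)
  qed
  then have "sign_potential \<Upsilon> ?X \<zeta> (induced \<Upsilon> A ?X)"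
    unfolding sign_potential_def sign_edges_def using \<zeta> bal_induced_link_loop[OF A]
    by (auto simp: induced_def)
  with that show thesis by blast
qed

section \<open>The signed kernel and the rank of the frame matroid\<close>

text \<open>The column of \<open>e\<close> in the incidence matrix of the oriented signed graph. It
  is kept over the integers and does not involve the gains.\<close>

definition signed_form :: "('v \<Rightarrow> int) \<Rightarrow> 'e \<Rightarrow> int" where
  "signed_form x e = (\<Sum>i<length (ends \<Upsilon> e). orient \<Upsilon> e i * x (ends \<Upsilon> e ! i))"

text \<open>Not a subgroup, only the solutions with entries in three values. Forcing 0 outside the
  vertex set makes it finite and its elements determined by their values on vertices.\<close>

definition signed_kernel :: "'e set \<Rightarrow> ('v \<Rightarrow> int) set" where
  "signed_kernel A = {x. (\<forall>v. x v \<in> (if v \<in> verts \<Upsilon> then {-1, 0, 1} else {0})) \<and>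
     (\<forall>e\<in>A. signed_form x e = 0)}"

definition frame_span :: "'e set \<Rightarrow> 'e set" where
  "frame_span A = {e \<in> edges \<Upsilon>. \<forall>x\<in>signed_kernel A. signed_form x e = 0}"

lemma signed_kernel_values: "x \<in> signed_kernel A \<Longrightarrow> x v \<in> {-1, 0, 1}"
  unfolding signed_kernel_def by (auto split: if_splits dest: spec[of _ v])

lemma signed_kernel_antimono: "A \<subseteq> B \<Longrightarrow> signed_kernel B \<subseteq> signed_kernel A"
  by (auto simp: signed_kernel_def)

lemma signed_form_loose: "e \<in> loose_edges \<Upsilon> \<Longrightarrow> signed_form x e = 0"
  by (simp add: signed_form_def loose_edges_def)

lemma signed_form_half: "e \<in> half_edges \<Upsilon> \<Longrightarrow> signed_form x e = orient \<Upsilon> e 0 * x (ends \<Upsilon> e ! 0)"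
  by (simp add: signed_form_def half_edges_def)

lemma signed_form_link:
  "e \<in> links_loops \<Upsilon> \<Longrightarrow>
    signed_form x e = orient \<Upsilon> e 0 * x (ends \<Upsilon> e ! 0) + orient \<Upsilon> e 1 * x (ends \<Upsilon> e ! 1)"
  by (simp add: signed_form_def links_loops_def numeral_2_eq_2)

text \<open>Individual orientations drop out because only their product, minus the edge sign,
  matters for vanishing.\<close>

lemma signed_form_link_zero_iff:
  assumes "e \<in> links_loops \<Upsilon>"
  shows "signed_form x e = 0 \<longleftrightarrow> x (ends \<Upsilon> e ! 0) = edge_sign \<Upsilon> e * x (ends \<Upsilon> e ! 1)"
proof -
  have e: "e \<in> edges \<Upsilon>" "length (ends \<Upsilon> e) = 2" using assms by (auto simp: links_loops_def)
  have "orient \<Upsilon> e 0 \<in> {1, -1}" "orient \<Upsilon> e 1 \<in> {1, -1}" using orient_values[OF e(1)] e(2) by auto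
  then show ?thesis using orient_sign[OF e] unfolding signed_form_link[OF assms] by auto
qed

lemma signed_kernel_step:
  assumes "x \<in> signed_kernel A" "fst d \<in> A" "fst d \<in> links_loops \<Upsilon>" "snd d < 2"
  shows "x (step_tail \<Upsilon> d) = edge_sign \<Upsilon> (fst d) * x (step_head \<Upsilon> d)"
proof -
  obtain e i where d: "d = (e, i)" by force
  have "signed_form x e = 0" using assms(1,2) d by (simp add: signed_kernel_def)
  then have "x (ends \<Upsilon> e ! 0) = edge_sign \<Upsilon> e * x (ends \<Upsilon> e ! 1)"
    using signed_form_link_zero_iff assms(3) d by simp
  moreover have "edge_sign \<Upsilon> e \<in> {1, -1}" using edge_sign_values assms(3) d links_loops_subset by auto
  ultimately show ?thesis using assms(4) d
    by (cases i) (auto simp: step_tail.simps step_head.simps less_Suc_eq numeral_2_eq_2)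
qed

lemma signed_kernel_walk:
  assumes "x \<in> signed_kernel A" "walk \<Upsilon> u ds w" "walk_edges ds \<subseteq> A"
  shows "x u = walk_sign \<Upsilon> ds * x w"
  using assms(2,3)
proof (induction ds arbitrary: u)
  case Nil
  then show ?case by auto
next
  case (Cons d ds)
  then have "x (step_head \<Upsilon> d) = walk_sign \<Upsilon> ds * x w" by simp
  moreover have "x u = edge_sign \<Upsilon> (fst d) * x (step_head \<Upsilon> d)"
    using signed_kernel_step[OF assms(1), of d] Cons.prems by auto
  ultimately show ?case by simp
qed

text \<open>Once around a negative circle gives \<open>x z = - x z\<close>, and the form of a half
  edge is plus or minus the value at its vertex. A walk carries the zero from the figure back to
  \<open>v\<close>.\<close>

lemma signed_kernel_unbal:
  assumes A: "A \<subseteq> edges \<Upsilon>" and x: "x \<in> signed_kernel A" and v: "v \<in> unbal_verts \<Upsilon> A"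
  shows "x v = 0"
proof -
  obtain N z where N: "negative_figure \<Upsilon> N" "N \<subseteq> A" "z \<in> verts_of \<Upsilon> N" "joined_in \<Upsilon> A v z"
    using v unfolding unbal_verts_iff[OF A] by blast
  have "x z = 0"
  proof (cases "negative_circle \<Upsilon> N")
    case True
    then obtain ds where ds: "cycle_walk z ds" "walk_edges ds = N"
      using circle_cycle_walk[of N z] N(3) by (auto simp: negative_circle_def)
    have "walk_sign \<Upsilon> ds = -1"
      using cycle_walk_circle(3)[OF ds(1)] ds(2) True by (simp add: negative_circle_def)
    then show ?thesis using signed_kernel_walk[OF x, of z ds z] ds N(2) by (simp add: cycle_walk_def)
  next
    case False
    then obtain h where h: "h \<in> half_edges \<Upsilon>" "N = {h}" using N(1) by (auto simp: negative_figure_def)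
    obtain y where y: "ends \<Upsilon> h = [y]" using ends_half_edge[OF h(1)] by blast
    have zy: "z = y" using N(3) h(2) y by (simp add: verts_of_def)
    have "signed_form x h = 0" using x N(2) h(2) by (auto simp: signed_kernel_def)
    moreover have "orient \<Upsilon> h 0 \<noteq> 0" using h(1) orient_values[of h 0] by (auto simp: half_edges_def)
    ultimately show ?thesis using signed_form_half[OF h(1)] y zy by simp
  qed
  moreover obtain ds where "walk \<Upsilon> v ds z" "walk_edges ds \<subseteq> A" using N(4) by (auto simp: joined_in_def)
  ultimately show ?thesis using signed_kernel_walk[OF x] by simp
qed

section \<open>The kernel relative to an arbitrary sign potential\<close>

context
  fixes A \<zeta>
  assumes A: "A \<subseteq> edges \<Upsilon>"
    and \<zeta>: "sign_potential \<Upsilon> (verts \<Upsilon> - unbal_verts \<Upsilon> A) \<zeta> (induced \<Upsilon> A (verts \<Upsilon> - unbal_verts \<Upsilon> A))"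
begin

lemma potential_values: "v \<in> verts \<Upsilon> - unbal_verts \<Upsilon> A \<Longrightarrow> \<zeta> v \<in> {1, -1}"
  using \<zeta> by (auto simp: sign_potential_def)

lemma potential_walk:
  assumes "walk \<Upsilon> u ds w" "walk_edges ds \<subseteq> A" "u \<in> verts \<Upsilon> - unbal_verts \<Upsilon> A"
  shows "\<zeta> u = walk_sign \<Upsilon> ds * \<zeta> w"
  using assms
proof (induction ds arbitrary: u)
  case Nil
  then show ?case by auto
next
  case (Cons d ds)
  let ?h = "step_head \<Upsilon> d"
  have d: "fst d \<in> A" "fst d \<in> links_loops \<Upsilon>" "snd d < 2" "step_tail \<Upsilon> d = u" "walk \<Upsilon> ?h ds w"
    using Cons.prems by auto
  have "joined_in \<Upsilon> A u ?h"
    using edge_ends_joined[of "fst d" A u ?h] d(1) A ends_link_loop[OF d(2,3)] d(4) by auto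
  then have h: "?h \<in> verts \<Upsilon> - unbal_verts \<Upsilon> A" by (rule bal_verts_joined[OF A _ Cons.prems(3)])
  have "set (ends \<Upsilon> (fst d)) \<subseteq> verts \<Upsilon> - unbal_verts \<Upsilon> A"
    using ends_link_loop[OF d(2,3)] h d(4) Cons.prems(3) by auto
  moreover have "ends \<Upsilon> (fst d) \<noteq> []" using d(2) by (auto simp: links_loops_def)
  ultimately have "fst d \<in> induced \<Upsilon> A (verts \<Upsilon> - unbal_verts \<Upsilon> A)" using d(1) by (simp add: induced_def)
  then have "edge_sign \<Upsilon> (fst d) = \<zeta> (ends \<Upsilon> (fst d) ! 0) * \<zeta> (ends \<Upsilon> (fst d) ! 1)"
    using \<zeta> by (auto simp: sign_potential_def sign_edges_def)
  also have "\<dots> = \<zeta> u * \<zeta> ?h"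
    using d(3,4) by (cases d; cases "snd d")
      (auto simp: step_tail.simps step_head.simps less_Suc_eq numeral_2_eq_2)
  finally have "\<zeta> u = edge_sign \<Upsilon> (fst d) * \<zeta> ?h" using potential_values[OF h] by auto
  moreover have "\<zeta> ?h = walk_sign \<Upsilon> ds * \<zeta> w" using Cons.IH[OF d(5) _ h] Cons.prems(2) by simp
  ultimately show ?case by simp
qed

text \<open>Along a walk both \<open>x\<close> and \<open>\<zeta>\<close> change by the sign of the
  walk, so their product does not change. It is the coefficient of \<open>x\<close> on the
  component.\<close>

lemma signed_kernel_potential_const:
  assumes x: "x \<in> signed_kernel A" and j: "joined_in \<Upsilon> A v w" and v: "v \<in> verts \<Upsilon> - unbal_verts \<Upsilon> A"
  shows "x v * \<zeta> v = x w * \<zeta> w"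
proof -
  obtain ds where ds: "walk \<Upsilon> v ds w" "walk_edges ds \<subseteq> A" using j by (auto simp: joined_in_def)
  have "x v * \<zeta> v = (walk_sign \<Upsilon> ds * walk_sign \<Upsilon> ds) * (x w * \<zeta> w)"
    using signed_kernel_walk[OF x ds] potential_walk[OF ds v] by (simp add: mult_ac)
  then show ?thesis using walk_sign_square[OF ds(1)] by simp
qed

definition kernel_vector :: "('v set \<Rightarrow> int) \<Rightarrow> 'v \<Rightarrow> int" where
  "kernel_vector f v =
    (if v \<in> verts \<Upsilon> - unbal_verts \<Upsilon> A then f {w. joined_in \<Upsilon> A v w} * \<zeta> v else 0)"

lemma kernel_vector_in_kernel:
  assumes f: "\<And>B. B \<in> bal_components \<Upsilon> A \<Longrightarrow> f B \<in> {-1, 0, 1}"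
  shows "kernel_vector f \<in> signed_kernel A"
proof -
  have "kernel_vector f v \<in> (if v \<in> verts \<Upsilon> then {-1, 0, 1} else {0})" for v
  proof (cases "v \<in> verts \<Upsilon> - unbal_verts \<Upsilon> A")
    case True
    then have "f {w. joined_in \<Upsilon> A v w} \<in> {-1, 0, 1}" using f bal_components_iff[OF A] by blast
    then show ?thesis using potential_values[OF True] True by (auto simp: kernel_vector_def)
  next
    case False
    then show ?thesis by (auto simp: kernel_vector_def)
  qed
  moreover have "signed_form (kernel_vector f) e = 0" if e: "e \<in> A" for e
  \<comment> \<open>The ends of an edge of \<open>A\<close> are joined in \<open>A\<close>, so they
    are all unbalanced or all in one balanced class. Loose edges fall vacuously under the first
    case.\<close>
  proof (cases "set (ends \<Upsilon> e) \<subseteq> unbal_verts \<Upsilon> A")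
    case True
    then have "kernel_vector f (ends \<Upsilon> e ! i) = 0" if "i < length (ends \<Upsilon> e)" for i
      using nth_mem[OF that] by (auto simp: kernel_vector_def)
    then show ?thesis by (simp add: signed_form_def)
  next
    case False
    have eE: "e \<in> edges \<Upsilon>" using e A by auto
    obtain v where v: "v \<in> set (ends \<Upsilon> e)" "v \<in> verts \<Upsilon> - unbal_verts \<Upsilon> A"
      using False ends_in_verts[OF eE] by blast
    have j: "joined_in \<Upsilon> A v w" if "w \<in> set (ends \<Upsilon> e)" for w
      by (rule edge_ends_joined[OF e eE v(1) that])
    then have "set (ends \<Upsilon> e) \<subseteq> verts \<Upsilon> - unbal_verts \<Upsilon> A" using bal_verts_joined[OF A _ v(2)] by blast
    then have ei: "e \<in> induced \<Upsilon> A (verts \<Upsilon> - unbal_verts \<Upsilon> A)" using e v(1) by (auto simp: induced_def)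
    have eL: "e \<in> links_loops \<Upsilon>" by (rule bal_induced_link_loop[OF A ei])
    have es: "edge_sign \<Upsilon> e = \<zeta> (ends \<Upsilon> e ! 0) * \<zeta> (ends \<Upsilon> e ! 1)"
      using \<zeta> ei by (auto simp: sign_potential_def sign_edges_def)
    have kv: "kernel_vector f (ends \<Upsilon> e ! i) = f {x. joined_in \<Upsilon> A v x} * \<zeta> (ends \<Upsilon> e ! i)"
      "\<zeta> (ends \<Upsilon> e ! i) \<in> {1, -1}" if "i < 2" for i
    proof -
      have m: "ends \<Upsilon> e ! i \<in> set (ends \<Upsilon> e)" using that eL by (auto simp: links_loops_def)
      then have "ends \<Upsilon> e ! i \<in> verts \<Upsilon> - unbal_verts \<Upsilon> A" using ei by (auto simp: induced_def)
      then show "kernel_vector f (ends \<Upsilon> e ! i) = f {x. joined_in \<Upsilon> A v x} * \<zeta> (ends \<Upsilon> e ! i)"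
        "\<zeta> (ends \<Upsilon> e ! i) \<in> {1, -1}"
        using component_class_eq[OF j[OF m]] potential_values by (auto simp: kernel_vector_def)
    qed
    show ?thesis unfolding signed_form_link_zero_iff[OF eL] es using kv[of 0] kv[of 1] by auto
  qed
  ultimately show ?thesis by (simp add: signed_kernel_def)
qed

lemma bij_kernel_vector:
  "bij_betw kernel_vector (bal_components \<Upsilon> A \<rightarrow>\<^sub>E {-1, 0, 1}) (signed_kernel A)"
  unfolding bij_betw_def
proof
  let ?X = "verts \<Upsilon> - unbal_verts \<Upsilon> A"
  show "inj_on kernel_vector (bal_components \<Upsilon> A \<rightarrow>\<^sub>E {-1, 0, 1})"
  proof (rule inj_onI)
    fix f g assume fg: "f \<in> bal_components \<Upsilon> A \<rightarrow>\<^sub>E {-1, 0, 1}" "g \<in> bal_components \<Upsilon> A \<rightarrow>\<^sub>E {-1, 0, 1}"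
      and eq: "kernel_vector f = kernel_vector g"
    show "f = g"
    proof (rule PiE_ext[OF fg])
      fix B assume "B \<in> bal_components \<Upsilon> A"
      then obtain v where v: "v \<in> ?X" "B = {w. joined_in \<Upsilon> A v w}" using bal_components_iff[OF A] by blast
      then show "f B = g B"
        using fun_cong[OF eq, of v] potential_values[OF v(1)] by (auto simp: kernel_vector_def)
    qed
  qed
  show "kernel_vector ` (bal_components \<Upsilon> A \<rightarrow>\<^sub>E {-1, 0, 1}) = signed_kernel A"
  proof
    show "kernel_vector ` (bal_components \<Upsilon> A \<rightarrow>\<^sub>E {-1, 0, 1}) \<subseteq> signed_kernel A"
      using kernel_vector_in_kernel by (auto simp: PiE_iff)
    show "signed_kernel A \<subseteq> kernel_vector ` (bal_components \<Upsilon> A \<rightarrow>\<^sub>E {-1, 0, 1})"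
    proof
      fix x assume x: "x \<in> signed_kernel A"
      \<comment> \<open>Signs are their own inverses, so multiplying by \<open>\<zeta>\<close>
        recovers the coefficient of \<open>x\<close>; it is the same at every representative of the
        component.\<close>
      define f where "f = (\<lambda>B\<in>bal_components \<Upsilon> A. x (SOME v. v \<in> B) * \<zeta> (SOME v. v \<in> B))"
      have fv: "f {w. joined_in \<Upsilon> A v w} = x v * \<zeta> v" if v: "v \<in> ?X" for v
      proof -
        have "joined_in \<Upsilon> A v (SOME w. w \<in> {w. joined_in \<Upsilon> A v w})"
          unfolding mem_Collect_eq by (rule someI, rule joined_in_refl) (use v in blast)
        moreover have "{w. joined_in \<Upsilon> A v w} \<in> bal_components \<Upsilon> A"
          using v bal_components_iff[OF A] by blast
        ultimately show ?thesis
          using signed_kernel_potential_const[OF x _ v] by (simp add: f_def)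
      qed
      have "f \<in> bal_components \<Upsilon> A \<rightarrow>\<^sub>E {-1, 0, 1}"
      proof (rule PiE_I)
        fix B assume "B \<in> bal_components \<Upsilon> A"
        then obtain v where v: "v \<in> ?X" "B = {w. joined_in \<Upsilon> A v w}" using bal_components_iff[OF A] by blast
        then show "f B \<in> {-1, 0, 1}"
          using fv[OF v(1)] signed_kernel_values[OF x, of v] potential_values[OF v(1)] by auto
      qed (simp add: f_def)
      moreover have "x = kernel_vector f"
      proof
        fix v
        show "x v = kernel_vector f v"
        proof (cases "v \<in> ?X")
          case True
          then show ?thesis using fv[OF True] potential_values[OF True] by (auto simp: kernel_vector_def)
        next
          case False
          then have "x v = 0"
            using signed_kernel_unbal[OF A x, of v] x by (auto simp: signed_kernel_def dest: spec[of _ v])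
          then show ?thesis by (simp only: kernel_vector_def False if_False)
        qed
      qed
      ultimately show "x \<in> kernel_vector ` (bal_components \<Upsilon> A \<rightarrow>\<^sub>E {-1, 0, 1})" by blast
    qed
  qed
qed

lemma frame_span_eq:
  "frame_span A = induced \<Upsilon> (edges \<Upsilon>) (unbal_verts \<Upsilon> A)
    \<union> induced_part \<Upsilon> (sign_edges \<Upsilon> (verts \<Upsilon> - unbal_verts \<Upsilon> A) \<zeta>) (bal_components \<Upsilon> A)
    \<union> loose_edges \<Upsilon>" (is "_ = ?U \<union> ?B \<union> _")
proof (intro equalityI subsetI)
  fix e assume e: "e \<in> frame_span A"
  have eE: "e \<in> edges \<Upsilon>" and ker: "\<And>x. x \<in> signed_kernel A \<Longrightarrow> signed_form x e = 0"
    using e by (auto simp: frame_span_def)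
  show "e \<in> ?U \<union> ?B \<union> loose_edges \<Upsilon>"
  proof (cases "ends \<Upsilon> e = [] \<or> set (ends \<Upsilon> e) \<subseteq> unbal_verts \<Upsilon> A")
    case True
    then show ?thesis using eE by (auto simp: induced_def loose_edges_def)
  next
    case False
    then obtain v where v: "v \<in> set (ends \<Upsilon> e)" "v \<in> verts \<Upsilon> - unbal_verts \<Upsilon> A"
      using ends_in_verts[OF eE] by blast
    let ?B = "{w. joined_in \<Upsilon> A v w}"
    \<comment> \<open>The test vector that decides the question: the potential on the component of
      \<open>v\<close>, zero elsewhere.\<close>
    let ?x = "kernel_vector (\<lambda>C. of_bool (C = ?B))"
    have form: "signed_form ?x e = 0" by (intro ker kernel_vector_in_kernel) auto
    have x1: "?x w = \<zeta> w \<and> \<zeta> w \<in> {1, -1}" if "w \<in> ?B" for w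
    proof -
      have w: "w \<in> verts \<Upsilon> - unbal_verts \<Upsilon> A" using bal_verts_joined[OF A _ v(2)] that by blast
      have "{x. joined_in \<Upsilon> A w x} = ?B" using component_class_eq that by auto
      then show ?thesis using w potential_values[OF w] by (simp add: kernel_vector_def)
    qed
    have x0: "?x w = 0" if w: "w \<notin> ?B" for w
    proof (cases "w \<in> verts \<Upsilon> - unbal_verts \<Upsilon> A")
      case True
      have "w \<in> {x. joined_in \<Upsilon> A w x}" using True joined_in_refl by auto
      then have "{x. joined_in \<Upsilon> A w x} \<noteq> ?B" using w by blast
      then show ?thesis by (simp add: kernel_vector_def)
    next
      case False
      then show ?thesis by (simp only: kernel_vector_def if_False)
    qed
    have vB: "v \<in> ?B" using v joined_in_refl by auto
    from eE show ?thesis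
    proof (cases rule: edge_cases)
      case 1
      then show ?thesis by blast
    next
      case 2
      obtain y where y: "ends \<Upsilon> e = [y]" using ends_half_edge[OF 2] by blast
      have "orient \<Upsilon> e 0 \<noteq> 0" using 2 orient_values[OF eE, of 0] by (auto simp: half_edges_def)
      then have "?x v = 0" using form v(1) y unfolding signed_form_half[OF 2] by simp
      then show ?thesis using x1[OF vB] by auto
    next
      case 3
      obtain a b where ab: "ends \<Upsilon> e = [a, b]"
        using 3 by (auto simp: links_loops_def numeral_2_eq_2 length_Suc_conv)
      have eq: "?x a = edge_sign \<Upsilon> e * ?x b"
        using form ab unfolding signed_form_link_zero_iff[OF 3] by simp
      have s: "edge_sign \<Upsilon> e \<in> {1, -1}" by (rule edge_sign_values[OF eE])
      have "v = a \<or> v = b" using v(1) ab by auto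
      \<comment> \<open>The test vector is nonzero exactly on \<open>?B\<close>, and
        \<open>eq\<close> makes its values at both ends zero or both nonzero. One end is
        \<open>v\<close>, hence both lie in \<open>?B\<close>.\<close>
      moreover have nz: "w \<in> ?B \<longleftrightarrow> ?x w \<noteq> 0" for w using x1[of w] x0[of w] by fastforce
      moreover have "?x a \<noteq> 0 \<longleftrightarrow> ?x b \<noteq> 0" using eq s by auto
      ultimately have both: "a \<in> ?B" "b \<in> ?B" using vB by metis+
      then have "edge_sign \<Upsilon> e = \<zeta> a * \<zeta> b" using eq x1[OF both(1)] x1[OF both(2)] s by auto
      moreover have "{a, b} \<subseteq> verts \<Upsilon> - unbal_verts \<Upsilon> A" using both bal_verts_joined[OF A _ v(2)] by blast
      ultimately have "e \<in> induced \<Upsilon> (sign_edges \<Upsilon> (verts \<Upsilon> - unbal_verts \<Upsilon> A) \<zeta>) ?B"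
        using 3 ab both by (auto simp: induced_def sign_edges_def)
      moreover have "?B \<in> bal_components \<Upsilon> A" using v(2) bal_components_iff[OF A] by blast
      ultimately show ?thesis unfolding induced_part_def by blast
    qed
  qed
next
  fix e assume e: "e \<in> ?U \<union> ?B \<union> loose_edges \<Upsilon>"
  have eE: "e \<in> edges \<Upsilon>"
    using e links_loops_subset by (auto simp: induced_def induced_part_def sign_edges_def loose_edges_def)
  have "signed_form x e = 0" if x: "x \<in> signed_kernel A" for x
    using e
  proof (elim UnE)
    assume "e \<in> ?U"
    then have "x (ends \<Upsilon> e ! i) = 0" if "i < length (ends \<Upsilon> e)" for i
      using signed_kernel_unbal[OF A x] nth_mem[OF that] by (auto simp: induced_def)
    then show ?thesis by (simp add: signed_form_def)
  next
    assume "e \<in> ?B"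
    then obtain B where B: "B \<in> bal_components \<Upsilon> A" "set (ends \<Upsilon> e) \<subseteq> B" and eL: "e \<in> links_loops \<Upsilon>"
      and es: "edge_sign \<Upsilon> e = \<zeta> (ends \<Upsilon> e ! 0) * \<zeta> (ends \<Upsilon> e ! 1)"
      by (auto simp: induced_part_def induced_def sign_edges_def)
    obtain v where v: "v \<in> verts \<Upsilon> - unbal_verts \<Upsilon> A" "B = {w. joined_in \<Upsilon> A v w}"
      using B(1) bal_components_iff[OF A] by blast
    obtain a b where ab: "ends \<Upsilon> e = [a, b]"
      using eL by (auto simp: links_loops_def numeral_2_eq_2 length_Suc_conv)
    have j: "joined_in \<Upsilon> A v a" "joined_in \<Upsilon> A v b" using B(2) v(2) ab by auto
    have "x a * \<zeta> a = x b * \<zeta> b"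
      using signed_kernel_potential_const[OF x j(1) v(1)] signed_kernel_potential_const[OF x j(2) v(1)] by simp
    moreover have "\<zeta> a \<in> {1, -1}" "\<zeta> b \<in> {1, -1}"
      using potential_values bal_verts_joined[OF A _ v(1)] j by blast+
    ultimately show ?thesis unfolding signed_form_link_zero_iff[OF eL] es using ab by auto
  next
    assume "e \<in> loose_edges \<Upsilon>"
    then show ?thesis by (rule signed_form_loose)
  qed
  then show "e \<in> frame_span A" using eE by (simp add: frame_span_def)
qed

text \<open>The pieces of \<open>frame_span_eq\<close> supply the circuits: unbalanced ends reach
  negative figures, inside a balanced component a path closes up with \<open>e\<close>, and a loose
  edge is a circuit by itself.\<close>

lemma frame_span_circuit:
  assumes e: "e \<in> frame_span A" "e \<notin> A"
  obtains C where "sign_circuit \<Upsilon> C" "e \<in> C" "C \<subseteq> insert e A"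
proof -
  have eE: "e \<in> edges \<Upsilon>" using e(1) by (simp add: frame_span_def)
  from e(1)[unfolded frame_span_eq] show thesis
  proof (elim UnE)
    assume U: "e \<in> induced \<Upsilon> (edges \<Upsilon>) (unbal_verts \<Upsilon> A)"
    have unb: "\<exists>N x. negative_figure \<Upsilon> N \<and> N \<subseteq> A \<and> x \<in> verts_of \<Upsilon> N \<and> joined_in \<Upsilon> A v x"
      if "v \<in> set (ends \<Upsilon> e)" for v
      using that U unbal_verts_iff[OF A] by (auto simp: induced_def)
    from eE show thesis
    proof (cases rule: edge_cases)
      case 1
      then show ?thesis using U by (auto simp: induced_def loose_edges_def)
    next
      case 2
      let ?v = "ends \<Upsilon> e ! 0"
      have v: "?v \<in> set (ends \<Upsilon> e)" using 2 by (auto simp: half_edges_def)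
      then obtain N x where "negative_figure \<Upsilon> N" "N \<subseteq> A" "x \<in> verts_of \<Upsilon> N" "joined_in \<Upsilon> A ?v x"
        using unb by blast
      then show thesis by (rule half_edge_circuit[OF 2 e(2) v _ _ _ _ that])
    next
      case 3
      let ?d = "(e, 0::nat)"
      have d: "walk \<Upsilon> (step_tail \<Upsilon> ?d) [?d] (step_head \<Upsilon> ?d)" by (rule walk_single[OF 3]) simp
      have ends: "set (ends \<Upsilon> e) = {step_tail \<Upsilon> ?d, step_head \<Upsilon> ?d}" using ends_link_loop[of ?d] 3 by simp
      obtain N x where N: "negative_figure \<Upsilon> N" "N \<subseteq> A" "x \<in> verts_of \<Upsilon> N" "joined_in \<Upsilon> A (step_head \<Upsilon> ?d) x"
        using unb ends by blast
      obtain M y where M: "negative_figure \<Upsilon> M" "M \<subseteq> A" "y \<in> verts_of \<Upsilon> M" "joined_in \<Upsilon> A (step_tail \<Upsilon> ?d) y"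
        using unb ends by blast
      show thesis
        by (rule edge_circuit_unbalanced[OF d _ N M]) (use e(2) that in auto)
    qed
  next
    assume "e \<in> induced_part \<Upsilon> (sign_edges \<Upsilon> (verts \<Upsilon> - unbal_verts \<Upsilon> A) \<zeta>) (bal_components \<Upsilon> A)"
    then obtain B where B: "B \<in> bal_components \<Upsilon> A" "set (ends \<Upsilon> e) \<subseteq> B" and eL: "e \<in> links_loops \<Upsilon>"
      and es: "edge_sign \<Upsilon> e = \<zeta> (ends \<Upsilon> e ! 0) * \<zeta> (ends \<Upsilon> e ! 1)"
      by (auto simp: induced_part_def induced_def sign_edges_def)
    obtain v where v: "v \<in> verts \<Upsilon> - unbal_verts \<Upsilon> A" "B = {w. joined_in \<Upsilon> A v w}"
      using B(1) bal_components_iff[OF A] by blast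
    let ?d = "(e, 0::nat)"
    let ?a = "step_tail \<Upsilon> ?d" and ?b = "step_head \<Upsilon> ?d"
    have d: "walk \<Upsilon> ?a [?d] ?b" by (rule walk_single[OF eL]) simp
    have j: "joined_in \<Upsilon> A v ?a" "joined_in \<Upsilon> A v ?b"
      using B(2) v(2) ends_link_loop[of ?d] eL by auto
    have ba: "joined_in \<Upsilon> A ?b ?a" by (rule joined_in_trans[OF joined_in_sym[OF j(2)] j(1)])
    obtain p a where pa: "is_path \<Upsilon> ?b p a" "walk_edges p \<subseteq> A"
      "set (walk_verts \<Upsilon> ?b p) \<inter> {?a} = {a}"
      by (rule joined_first_hit[OF ba singletonI])
    have "a \<in> {?a}" using pa(3) by blast
    then have p: "is_path \<Upsilon> ?b p ?a" "walk_edges p \<subseteq> A" using pa by simp_all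
    have bX: "?b \<in> verts \<Upsilon> - unbal_verts \<Upsilon> A" by (rule bal_verts_joined[OF A j(2) v(1)])
    have "\<zeta> ?b = walk_sign \<Upsilon> p * \<zeta> ?a"
      using potential_walk[OF _ p(2) bX] p(1) by (simp add: is_path_def)
    moreover have "edge_sign \<Upsilon> e = \<zeta> ?a * \<zeta> ?b" using es by (simp add: step_tail.simps step_head.simps)
    moreover have "\<zeta> ?a \<in> {1, -1}" by (rule potential_values[OF bal_verts_joined[OF A j(1) v(1)]])
    moreover have "walk_sign \<Upsilon> p \<in> {1, -1}"
      using p(1) walk_sign_values unfolding is_path_def by blast
    \<comment> \<open>The edge and the path both have sign \<open>\<zeta> ?a * \<zeta> ?b\<close>,
      so the product is 1, which excludes the negative alternative of
      \<open>path_edge_circle_cases\<close>.\<close>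
    ultimately have "edge_sign \<Upsilon> e * walk_sign \<Upsilon> p \<noteq> -1" by auto
    moreover have "fst ?d \<notin> walk_edges p" using p(2) e(2) by auto
    ultimately have "positive_circle \<Upsilon> (insert e (walk_edges p))"
      using path_edge_circle_cases[OF p(1) d] by auto
    then show thesis using p(2) by (intro that[of "insert e (walk_edges p)"]) (auto simp: sign_circuit_def)
  next
    assume "e \<in> loose_edges \<Upsilon>"
    then show thesis by (intro that[of "{e}"]) (auto simp: sign_circuit_def)
  qed
qed

end

end

section \<open>Closures\<close>

context gain_signed_graph
begin

lemma finite_bal_components: "finite (bal_components \<Upsilon> A)"
  unfolding bal_components_def components_eq using finite_verts by simp

lemma card_signed_kernel:
  assumes A: "A \<subseteq> edges \<Upsilon>"
  shows "card (signed_kernel A) = 3 ^ card (bal_components \<Upsilon> A)"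
proof -
  obtain \<zeta> where \<zeta>: "sign_potential \<Upsilon> (verts \<Upsilon> - unbal_verts \<Upsilon> A) \<zeta>
      (induced \<Upsilon> A (verts \<Upsilon> - unbal_verts \<Upsilon> A))"
    by (rule sign_potential_exists[OF A])
  have "card (signed_kernel A) = card (bal_components \<Upsilon> A \<rightarrow>\<^sub>E {-1, 0, 1::int})"
    using bij_betw_same_card[OF bij_kernel_vector[OF A \<zeta>]] by simp
  also have "\<dots> = 3 ^ card (bal_components \<Upsilon> A)"
    by (simp add: card_funcsetE finite_bal_components eval_nat_numeral)
  finally show ?thesis .
qed

text \<open>The two kernels are nested finite sets, so equal size means equality, and equality means
  that the form of \<open>e\<close> vanishes on the old kernel.\<close>

lemma card_bal_components_insert:
  assumes A: "A \<subseteq> edges \<Upsilon>" and e: "e \<in> edges \<Upsilon>"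
  shows "card (bal_components \<Upsilon> (insert e A)) \<le> card (bal_components \<Upsilon> A)"
    "card (bal_components \<Upsilon> (insert e A)) = card (bal_components \<Upsilon> A) \<longleftrightarrow> e \<in> frame_span A"
proof -
  have A': "insert e A \<subseteq> edges \<Upsilon>" using A e by simp
  have fin: "finite (signed_kernel A)"
    using card_signed_kernel[OF A] by (intro card_ge_0_finite) simp
  have sub: "signed_kernel (insert e A) \<subseteq> signed_kernel A" by (intro signed_kernel_antimono) auto
  have "(3::nat) ^ card (bal_components \<Upsilon> (insert e A)) \<le> 3 ^ card (bal_components \<Upsilon> A)"
    using card_mono[OF fin sub] card_signed_kernel[OF A] card_signed_kernel[OF A'] by simp
  then show "card (bal_components \<Upsilon> (insert e A)) \<le> card (bal_components \<Upsilon> A)" by simp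
  have "card (bal_components \<Upsilon> (insert e A)) = card (bal_components \<Upsilon> A)
      \<longleftrightarrow> card (signed_kernel (insert e A)) = card (signed_kernel A)"
    unfolding card_signed_kernel[OF A] card_signed_kernel[OF A'] by simp
  also have "\<dots> \<longleftrightarrow> signed_kernel (insert e A) = signed_kernel A"
    using card_subset_eq[OF fin sub] by auto
  also have "\<dots> \<longleftrightarrow> e \<in> frame_span A"
    using e by (auto simp: frame_span_def signed_kernel_def)
  finally show "card (bal_components \<Upsilon> (insert e A)) = card (bal_components \<Upsilon> A) \<longleftrightarrow> e \<in> frame_span A" .
qed

lemma subset_frame_span: "A \<subseteq> edges \<Upsilon> \<Longrightarrow> A \<subseteq> frame_span A"
  by (auto simp: frame_span_def signed_kernel_def)

lemma clos_frame_eq: "A \<subseteq> edges \<Upsilon> \<Longrightarrow> clos_frame \<Upsilon> A = frame_span A"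
  using card_bal_components_insert(2)
  by (auto simp: clos_frame_def matroid_closure_def frame_rank_def) (auto simp: frame_span_def)

lemma switched_gain_shift:
  "switched_gain \<Upsilon> (\<lambda>v. \<theta> v + t * of_int (x v)) e
    = switched_gain \<Upsilon> \<theta> e + t * of_int (signed_form x e)"
  by (simp add: switched_gain_def signed_form_def algebra_simps sum.distrib sum_distrib_left)

text \<open>The bridge from the integers to \<open>'k\<close>. At most two ends with entries in
  \<open>{-1, 0, 1}\<close> give absolute value at most 2, and neither 1 nor 2 is zero in
  \<open>'k\<close>; larger entries could produce a multiple of the characteristic.\<close>

lemma signed_form_char_not_2:
  assumes "(2::'k) \<noteq> 0" "e \<in> edges \<Upsilon>" "x \<in> signed_kernel A" "of_int (signed_form x e) = (0::'k)"
  shows "signed_form x e = 0"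
proof -
  have o: "orient \<Upsilon> e i \<in> {1, -1}" if "i < length (ends \<Upsilon> e)" for i by (rule orient_values[OF assms(2) that])
  have "signed_form x e \<in> {-2, -1, 0, 1, 2}"
    using assms(2)
  proof (cases rule: edge_cases)
    case 1
    then show ?thesis by (simp add: signed_form_loose)
  next
    case 2
    then show ?thesis
      using o[of 0] signed_kernel_values[OF assms(3), of "ends \<Upsilon> e ! 0"] signed_form_half[OF 2, of x]
      by (auto simp: half_edges_def)
  next
    case 3
    then have "length (ends \<Upsilon> e) = 2" by (simp add: links_loops_def)
    then show ?thesis
      using o[of 0] o[of 1] signed_kernel_values[OF assms(3), of "ends \<Upsilon> e ! 0"]
        signed_kernel_values[OF assms(3), of "ends \<Upsilon> e ! 1"] signed_form_link[OF 3, of x]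
      by auto
  qed
  then show ?thesis using assms(1,4) by auto
qed

lemma hyperbalanced_mono: "hyperbalanced \<Upsilon> B \<Longrightarrow> A \<subseteq> B \<Longrightarrow> hyperbalanced \<Upsilon> A"
  unfolding hyperbalanced_def by blast

lemma span_circuit:
  assumes "A \<subseteq> edges \<Upsilon>" "e \<in> frame_span A" "e \<notin> A"
  obtains C where "sign_circuit \<Upsilon> C" "e \<in> C" "C \<subseteq> insert e A"
proof -
  obtain \<zeta> where \<zeta>: "sign_potential \<Upsilon> (verts \<Upsilon> - unbal_verts \<Upsilon> A) \<zeta>
      (induced \<Upsilon> A (verts \<Upsilon> - unbal_verts \<Upsilon> A))"
    by (rule sign_potential_exists[OF assms(1)])
  show thesis by (rule frame_span_circuit[OF assms(1) \<zeta> assms(2,3) that])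
qed

text \<open>One circuit through \<open>e\<close> already determines its gain relative to
  \<open>\<theta>\<close>, and \<open>e\<close> in the frame span guarantees one. In the other
  direction, all gains vanish after switching.\<close>

lemma hyperbalanced_insert_iff:
  assumes "(2::'k) \<noteq> 0" "A \<subseteq> edges \<Upsilon>" "A \<subseteq> gain_edges \<Upsilon> \<theta>" "e \<in> frame_span A"
  shows "hyperbalanced \<Upsilon> (insert e A) \<longleftrightarrow> e \<in> gain_edges \<Upsilon> \<theta>"
proof
  assume hyp: "hyperbalanced \<Upsilon> (insert e A)"
  show "e \<in> gain_edges \<Upsilon> \<theta>"
  proof (cases "e \<in> A")
    case True
    then show ?thesis using assms(3) by blast
  next
    case False
    obtain C where C: "sign_circuit \<Upsilon> C" "e \<in> C" "C \<subseteq> insert e A"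
      by (rule span_circuit[OF assms(2,4) False])
    then have "neutral_circuit \<Upsilon> C" using hyp by (simp add: hyperbalanced_def)
    then show ?thesis by (rule neutral_circuit_switched[OF assms(1,3) _ C(2,3)])
  qed
next
  assume "e \<in> gain_edges \<Upsilon> \<theta>"
  then show "hyperbalanced \<Upsilon> (insert e A)"
    using assms(3) by (intro hyperbalanced_if_switched[OF assms(1)]) auto
qed

text \<open>An edge outside the frame span of \<open>A\<close> can be made neutral by moving the gain switcher along a
  kernel vector of \<open>A\<close>, which leaves the gains on \<open>A\<close> unchanged.\<close>

lemma hyperbalanced_switched:
  assumes two: "(2::'k) \<noteq> 0" and "S \<subseteq> edges \<Upsilon>" "hyperbalanced \<Upsilon> S"
  obtains \<theta> where "S \<subseteq> gain_edges \<Upsilon> \<theta>"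
proof -
  have "finite S" using assms(2) finite_edges finite_subset by blast
  then have "\<exists>\<theta>. S \<subseteq> gain_edges \<Upsilon> \<theta>" using assms(2,3)
  proof (induction S rule: finite_induct)
    case empty
    then show ?case by simp
  next
    case (insert e A)
    have A: "A \<subseteq> edges \<Upsilon>" and e: "e \<in> edges \<Upsilon>" using insert.prems by auto
    have "hyperbalanced \<Upsilon> A" by (rule hyperbalanced_mono[OF insert.prems(2)]) blast
    then obtain \<theta> where \<theta>: "A \<subseteq> gain_edges \<Upsilon> \<theta>" using insert.IH A by blast
    show ?case
    proof (cases "e \<in> frame_span A")
      case True
      then have "e \<in> gain_edges \<Upsilon> \<theta>"
        using hyperbalanced_insert_iff[OF two A \<theta> True] insert.prems(2) by blast
      then show ?thesis using \<theta> by blast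
    next
      case False
      then obtain x where x: "x \<in> signed_kernel A" "signed_form x e \<noteq> 0"
        using e by (auto simp: frame_span_def)
      have ne: "of_int (signed_form x e) \<noteq> (0::'k)" using signed_form_char_not_2[OF two e x(1)] x(2) by blast
      \<comment> \<open>The solution of the linear equation that makes the shifted gain of
        \<open>e\<close> zero.\<close>
      let ?t = "- switched_gain \<Upsilon> \<theta> e / of_int (signed_form x e)"
      have "insert e A \<subseteq> gain_edges \<Upsilon> (\<lambda>v. \<theta> v + ?t * of_int (x v))"
        unfolding gain_edges_def switched_gain_shift
        using e A \<theta> x(1) ne by (auto simp: gain_edges_def signed_kernel_def)
      then show ?thesis by blast
    qed
  qed
  with that show thesis by blast
qed

text \<open>Switching by a kernel vector \<open>x\<close> does not change the circuit gain, so the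
  form of the circuit vanishes on the values \<open>signed_form x\<close>. These are zero on
  \<open>C\<close> except possibly at \<open>e\<close>, and full support makes them zero there
  too.\<close>

lemma circuit_in_frame_span:
  assumes two: "(2::'k) \<noteq> 0" and C: "sign_circuit \<Upsilon> C" "e \<in> C" "C \<subseteq> insert e A"
  shows "e \<in> frame_span A"
proof -
  have CE: "C \<subseteq> edges \<Upsilon>" by (rule sign_circuit_subset[OF C(1)])
  have eE: "e \<in> edges \<Upsilon>" using CE C(2) by blast
  obtain g where g: "circuit_gain \<Upsilon> C g" by (rule sign_circuit_has_gain[OF C(1)])
  obtain L where L: "support_form C L" "\<And>\<theta>. L (switched_gain \<Upsilon> \<theta>) = g"
    using circuit_gain_form[OF two g] by blast
  have add: "L (\<lambda>f. \<phi> f + \<psi> f) = L \<phi> + L \<psi>" for \<phi> \<psi>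
    using L(1) by (auto simp: support_form_def distrib_left sum.distrib)
  have "finite C" using CE finite_edges finite_subset by blast
  then obtain k where k: "k \<noteq> 0" "\<And>\<phi>. (\<And>f. f \<in> C \<Longrightarrow> f \<noteq> e \<Longrightarrow> \<phi> f = 0) \<Longrightarrow> L \<phi> = k * \<phi> e"
    using support_form_isolate[OF L(1) C(2)] by metis
  have "signed_form x e = 0" if x: "x \<in> signed_kernel A" for x
  proof -
    \<comment> \<open>The zeros and ones are the shape of \<open>switched_gain_shift\<close> for the
      trivial switcher and step 1.\<close>
    have "switched_gain \<Upsilon> (\<lambda>v. 0 + 1 * of_int (x v))
        = (\<lambda>f. switched_gain \<Upsilon> (\<lambda>_. 0) f + 1 * of_int (signed_form x f))"
      by (rule ext, rule switched_gain_shift)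
    then have "L (\<lambda>f. 1 * of_int (signed_form x f)) = 0"
      using L(2) add[of "switched_gain \<Upsilon> (\<lambda>_. 0)"] by (metis add_cancel_left_right)
    moreover have "L (\<lambda>f. 1 * of_int (signed_form x f)) = k * (1 * of_int (signed_form x e))"
      using x C(3) by (intro k(2)) (auto simp: signed_kernel_def)
    ultimately have "of_int (signed_form x e) = (0::'k)" using k(1) by simp
    then show ?thesis by (rule signed_form_char_not_2[OF two eE x])
  qed
  then show ?thesis using eE by (simp add: frame_span_def)
qed

lemma bal_closure_eq:
  assumes two: "(2::'k) \<noteq> 0" and S: "S \<subseteq> edges \<Upsilon>" "S \<subseteq> gain_edges \<Upsilon> \<theta>"
  shows "bal_closure \<Upsilon> S = frame_span S \<inter> gain_edges \<Upsilon> \<theta>"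
proof (intro equalityI subsetI)
  fix e assume "e \<in> bal_closure \<Upsilon> S"
  then consider "e \<in> S" | C where "neutral_circuit \<Upsilon> C" "e \<in> C" "C \<subseteq> insert e S"
    unfolding bal_closure_def by blast
  then show "e \<in> frame_span S \<inter> gain_edges \<Upsilon> \<theta>"
  proof cases
    case 1
    then show ?thesis using S subset_frame_span by blast
  next
    case 2
    then show ?thesis
      using circuit_in_frame_span[OF two, of C e S] neutral_circuit_switched[OF two S(2)]
      by (auto simp: neutral_circuit_def)
  qed
next
  fix e assume e: "e \<in> frame_span S \<inter> gain_edges \<Upsilon> \<theta>"
  show "e \<in> bal_closure \<Upsilon> S"
  proof (cases "e \<in> S")
    case True
    then show ?thesis by (simp add: bal_closure_def)
  next
    case False
    have es: "e \<in> frame_span S" using e by blast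
    obtain C where C: "sign_circuit \<Upsilon> C" "e \<in> C" "C \<subseteq> insert e S"
      by (rule span_circuit[OF S(1) es False])
    have "hyperbalanced \<Upsilon> (insert e S)" using hyperbalanced_insert_iff[OF two S es] e by blast
    then have "neutral_circuit \<Upsilon> C" using C by (simp add: hyperbalanced_def)
    then show ?thesis using C False e unfolding bal_closure_def frame_span_def by blast
  qed
qed

lemma clos_gsg_hyperbalanced:
  assumes two: "(2::'k) \<noteq> 0" and S: "S \<subseteq> edges \<Upsilon>" "S \<subseteq> gain_edges \<Upsilon> \<theta>"
  shows "clos_gsg \<Upsilon> S = frame_span S \<inter> gain_edges \<Upsilon> \<theta>"
proof -
  have hyp: "hyperbalanced \<Upsilon> S" by (rule hyperbalanced_if_switched[OF two S(2)])
  have "gsg_rank \<Upsilon> (insert e S) = gsg_rank \<Upsilon> S \<longleftrightarrow> e \<in> frame_span S \<and> e \<in> gain_edges \<Upsilon> \<theta>"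
    if e: "e \<in> edges \<Upsilon>" for e
  proof -
    \<comment> \<open>Both contributions to the rank can only grow: the number of balanced
      components does not increase, and the last summand starts at 0. Equality therefore holds in
      each of them.\<close>
    have "gsg_rank \<Upsilon> (insert e S) = gsg_rank \<Upsilon> S \<longleftrightarrow>
        card (bal_components \<Upsilon> (insert e S)) = card (bal_components \<Upsilon> S) \<and> hyperbalanced \<Upsilon> (insert e S)"
      using card_bal_components_insert(1)[OF S(1) e] hyp by (auto simp: gsg_rank_def)
    then show ?thesis
      using card_bal_components_insert(2)[OF S(1) e] hyperbalanced_insert_iff[OF two S] by blast
  qed
  then show ?thesis by (auto simp: clos_gsg_def matroid_closure_def frame_span_def)
qed

text \<open>The extra 1 is present before and after adding an edge, so only the frame rank
  decides.\<close>

lemma clos_gsg_hyperfrustrated: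
  assumes S: "S \<subseteq> edges \<Upsilon>" "hyperfrustrated \<Upsilon> S"
  shows "clos_gsg \<Upsilon> S = frame_span S"
proof -
  have "hyperfrustrated \<Upsilon> (insert e S)" for e using S(2) hyperbalanced_mono[of "insert e S" S] by blast
  then have "clos_gsg \<Upsilon> S = clos_frame \<Upsilon> S"
    using S(2) by (simp add: clos_gsg_def clos_frame_def matroid_closure_def gsg_rank_def frame_rank_def)
  then show ?thesis using clos_frame_eq[OF S(1)] by simp
qed

lemma frame_span_inter_gain_edges:
  assumes S: "S \<subseteq> edges \<Upsilon>"
    and \<zeta>: "sign_potential \<Upsilon> (verts \<Upsilon> - unbal_verts \<Upsilon> S) \<zeta> (induced \<Upsilon> S (verts \<Upsilon> - unbal_verts \<Upsilon> S))"
  shows "frame_span S \<inter> gain_edges \<Upsilon> \<theta> =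
    induced \<Upsilon> (gain_edges \<Upsilon> \<theta>) (unbal_verts \<Upsilon> S) \<union>
    induced_part \<Upsilon> (gain_sign_edges \<Upsilon> \<theta> (verts \<Upsilon> - unbal_verts \<Upsilon> S) \<zeta>) (bal_components \<Upsilon> S) \<union>
    neutral_loose_edges \<Upsilon>"
proof -
  have "induced \<Upsilon> (edges \<Upsilon>) X \<inter> gain_edges \<Upsilon> \<theta> = induced \<Upsilon> (gain_edges \<Upsilon> \<theta>) X" for X
    by (auto simp: induced_def gain_edges_def)
  moreover have "induced_part \<Upsilon> (sign_edges \<Upsilon> X \<zeta>) P \<inter> gain_edges \<Upsilon> \<theta>
      = induced_part \<Upsilon> (gain_sign_edges \<Upsilon> \<theta> X \<zeta>) P" for X P
    by (auto simp: induced_part_def induced_def gain_sign_edges_def)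
  moreover have "loose_edges \<Upsilon> \<inter> gain_edges \<Upsilon> \<theta> = neutral_loose_edges \<Upsilon>"
    by (auto simp: neutral_loose_edges_def loose_edges_def gain_edges_def switched_gain_def)
  ultimately show ?thesis unfolding frame_span_eq[OF S \<zeta>] Int_Un_distrib2 by simp
qed

section \<open>Adjoining the non-neutral loose edge\<close>

lemma add_infinity_gain_signed_graph: "gain_signed_graph (add_infinity \<Upsilon>)"
proof
  fix e assume e: "e \<in> edges (add_infinity \<Upsilon>)"
  show "length (ends (add_infinity \<Upsilon>) e) \<le> 2"
    using e length_ends by (auto simp: add_infinity_def)
  show "set (ends (add_infinity \<Upsilon>) e) \<subseteq> verts (add_infinity \<Upsilon>)"
    using e ends_in_verts by (auto simp: add_infinity_def)
  show "edge_sign (add_infinity \<Upsilon>) e \<in> {1, -1}"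
    using e edge_sign_values by (fastforce simp: add_infinity_def)
  show "edge_sign (add_infinity \<Upsilon>) e = -1" if "length (ends (add_infinity \<Upsilon>) e) = 1"
    using e that half_edge_negative by (auto simp: add_infinity_def)
  show "edge_sign (add_infinity \<Upsilon>) e = 1" if "length (ends (add_infinity \<Upsilon>) e) = 0"
    using e that loose_edge_positive by (auto simp: add_infinity_def)
  show "orient (add_infinity \<Upsilon>) e i \<in> {1, -1}" if "i < length (ends (add_infinity \<Upsilon>) e)" for i
    using e that orient_values by (fastforce simp: add_infinity_def)
  show "orient (add_infinity \<Upsilon>) e 0 * orient (add_infinity \<Upsilon>) e 1 = - edge_sign (add_infinity \<Upsilon>) e"
    if "length (ends (add_infinity \<Upsilon>) e) = 2"
    using e that orient_sign by (auto simp: add_infinity_def)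
qed (use finite_verts finite_edges in \<open>simp_all add: add_infinity_def\<close>)

text \<open>The new edge has no ends, so its form is zero and lies in every frame span, and the
  kernel of \<open>S\<close> is unchanged.\<close>

lemma frame_span_add_infinity:
  "gain_signed_graph.frame_span (add_infinity \<Upsilon>) (Some ` S) = insert None (Some ` frame_span S)"
proof -
  interpret I: gain_signed_graph "add_infinity \<Upsilon>" by (rule add_infinity_gain_signed_graph)
  have Some: "I.signed_form x (Some e) = signed_form x e" for x e
    unfolding I.signed_form_def signed_form_def by (simp add: add_infinity_def)
  have None: "I.signed_form x None = 0" for x
    unfolding I.signed_form_def by (simp add: add_infinity_def)
  have "I.signed_kernel (Some ` S) = signed_kernel S"
    unfolding I.signed_kernel_def signed_kernel_def ball_simps(9) Some by (simp add: add_infinity_def)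
  moreover have "edges (add_infinity \<Upsilon>) = insert None (Some ` edges \<Upsilon>)" by (simp add: add_infinity_def)
  ultimately show ?thesis by (auto simp: I.frame_span_def frame_span_def Some None)
qed

text \<open>Switching cannot change the gain 1 of the edge without ends; hence \<open>None\<close>
  never becomes neutral.\<close>

lemma gain_edges_add_infinity: "gain_edges (add_infinity \<Upsilon>) \<theta> = Some ` gain_edges \<Upsilon> \<theta>"
  by (auto simp: gain_edges_def switched_gain_def add_infinity_def)

text \<open>Instead of matching the circuits of the two graphs, both sides are compared through the
  existence of a switcher that makes \<open>S\<close> neutral.\<close>

lemma hyperbalanced_add_infinity:
  assumes two: "(2::'k) \<noteq> 0" and S: "S \<subseteq> edges \<Upsilon>"
  shows "hyperbalanced (add_infinity \<Upsilon>) (Some ` S) \<longleftrightarrow> hyperbalanced \<Upsilon> S"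
proof -
  interpret I: gain_signed_graph "add_infinity \<Upsilon>" by (rule add_infinity_gain_signed_graph)
  have S': "Some ` S \<subseteq> edges (add_infinity \<Upsilon>)" using S by (auto simp: add_infinity_def)
  have sub: "Some ` S \<subseteq> gain_edges (add_infinity \<Upsilon>) \<theta> \<longleftrightarrow> S \<subseteq> gain_edges \<Upsilon> \<theta>" for \<theta>
    unfolding gain_edges_add_infinity by auto
  show ?thesis
    using hyperbalanced_switched[OF two S] hyperbalanced_if_switched[OF two]
      I.hyperbalanced_switched[OF two S'] I.hyperbalanced_if_switched[OF two] sub by metis
qed

text \<open>\<open>None\<close> is in the frame span but not among the neutral edges, so the
  intersection removes it.\<close>

lemma clos_inf_hyperbalanced:
  assumes two: "(2::'k) \<noteq> 0" and S: "S \<subseteq> edges \<Upsilon>" "S \<subseteq> gain_edges \<Upsilon> \<theta>"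
  shows "clos_inf \<Upsilon> (Some ` S) = Some ` clos_gsg \<Upsilon> S"
proof -
  interpret I: gain_signed_graph "add_infinity \<Upsilon>" by (rule add_infinity_gain_signed_graph)
  have S': "Some ` S \<subseteq> edges (add_infinity \<Upsilon>)" "Some ` S \<subseteq> gain_edges (add_infinity \<Upsilon>) \<theta>"
    using S unfolding gain_edges_add_infinity by (auto simp: add_infinity_def)
  have "clos_inf \<Upsilon> (Some ` S) = clos_gsg (add_infinity \<Upsilon>) (Some ` S)"
    by (simp add: clos_inf_def clos_gsg_def)
  then show ?thesis
    unfolding I.clos_gsg_hyperbalanced[OF two S'] clos_gsg_hyperbalanced[OF two S]
      frame_span_add_infinity gain_edges_add_infinity by auto
qed

lemma clos_inf_hyperfrustrated:
  assumes two: "(2::'k) \<noteq> 0" and S: "S \<subseteq> edges \<Upsilon>" "hyperfrustrated \<Upsilon> S"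
  shows "clos_inf \<Upsilon> (Some ` S) = insert None (Some ` clos_gsg \<Upsilon> S)"
proof -
  interpret I: gain_signed_graph "add_infinity \<Upsilon>" by (rule add_infinity_gain_signed_graph)
  have S': "Some ` S \<subseteq> edges (add_infinity \<Upsilon>)" using S by (auto simp: add_infinity_def)
  have "hyperfrustrated (add_infinity \<Upsilon>) (Some ` S)" using hyperbalanced_add_infinity[OF two S(1)] S(2) by simp
  moreover have "clos_inf \<Upsilon> (Some ` S) = clos_gsg (add_infinity \<Upsilon>) (Some ` S)"
    by (simp add: clos_inf_def clos_gsg_def)
  ultimately show ?thesis
    using I.clos_gsg_hyperfrustrated[OF S'] clos_gsg_hyperfrustrated[OF S] frame_span_add_infinity by simp
qed

end

theorem theorem5p2:
  fixes \<Upsilon> :: "('v, 'e, 'k::field) gsgraph" and S :: "'e set"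
  assumes "gain_signed_graph \<Upsilon>" and "CHAR('k) \<noteq> 2" and "S \<subseteq> edges \<Upsilon>"
  shows
    "(hyperbalanced \<Upsilon> S \<longrightarrow>
        clos_gsg \<Upsilon> S = bal_closure \<Upsilon> S \<and>
        (\<forall>\<zeta> \<theta>.
           sign_potential \<Upsilon> (verts \<Upsilon> - unbal_verts \<Upsilon> S) \<zeta>
             (induced \<Upsilon> S (verts \<Upsilon> - unbal_verts \<Upsilon> S)) \<and>
           gain_potential \<Upsilon> (\<lambda>v. - \<theta> v) S \<longrightarrow>
           bal_closure \<Upsilon> S =
             induced \<Upsilon> (gain_edges \<Upsilon> \<theta>) (unbal_verts \<Upsilon> S) \<union>
             induced_part \<Upsilon> (gain_sign_edges \<Upsilon> \<theta> (verts \<Upsilon> - unbal_verts \<Upsilon> S) \<zeta>)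
               (bal_components \<Upsilon> S) \<union>
             neutral_loose_edges \<Upsilon>) \<and>
        hyperbalanced \<Upsilon> (clos_gsg \<Upsilon> S) \<and>
        clos_inf \<Upsilon> (Some ` S) = Some ` clos_gsg \<Upsilon> S) \<and>
     (hyperfrustrated \<Upsilon> S \<longrightarrow>
        clos_gsg \<Upsilon> S = clos_frame \<Upsilon> S \<and>
        (\<forall>\<zeta>.
           sign_potential \<Upsilon> (verts \<Upsilon> - unbal_verts \<Upsilon> S) \<zeta>
             (induced \<Upsilon> S (verts \<Upsilon> - unbal_verts \<Upsilon> S)) \<longrightarrow>
           clos_frame \<Upsilon> S =
             induced \<Upsilon> (edges \<Upsilon>) (unbal_verts \<Upsilon> S) \<union>
             induced_part \<Upsilon> (sign_edges \<Upsilon> (verts \<Upsilon> - unbal_verts \<Upsilon> S) \<zeta>)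
               (bal_components \<Upsilon> S) \<union>
             loose_edges \<Upsilon>) \<and>
        clos_inf \<Upsilon> (Some ` S) = insert None (Some ` clos_gsg \<Upsilon> S))"
proof -
  interpret gain_signed_graph \<Upsilon> by (rule assms(1))
  have two: "(2::'k) \<noteq> 0"
  proof
    assume "(2::'k) = 0"
    \<comment> \<open>A characteristic dividing 2 is 1 or 2, and 1 is impossible.\<close>
    then have "CHAR('k) dvd 2" using of_nat_eq_0_iff_char_dvd[where 'a = 'k, of 2] by simp
    moreover have "CHAR('k) \<noteq> 1" using CHAR_not_1 by auto
    ultimately show False using assms(2) prime_nat_iff[of 2] by auto
  qed
  note S = assms(3)
  show ?thesis
  proof (intro conjI impI allI; (elim conjE)?)
    assume hyp: "hyperbalanced \<Upsilon> S"
    \<comment> \<open>The next three claims mention no switcher, so any one that neutralizes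
      \<open>S\<close> will do.\<close>
    obtain \<theta> where \<theta>: "S \<subseteq> gain_edges \<Upsilon> \<theta>" by (rule hyperbalanced_switched[OF two S hyp])
    show "clos_gsg \<Upsilon> S = bal_closure \<Upsilon> S"
      using clos_gsg_hyperbalanced[OF two S \<theta>] bal_closure_eq[OF two S \<theta>] by simp
    show "hyperbalanced \<Upsilon> (clos_gsg \<Upsilon> S)"
      unfolding clos_gsg_hyperbalanced[OF two S \<theta>] by (intro hyperbalanced_if_switched[OF two]) blast
    show "clos_inf \<Upsilon> (Some ` S) = Some ` clos_gsg \<Upsilon> S"
      by (rule clos_inf_hyperbalanced[OF two S \<theta>])
  next
    fix \<zeta> \<theta>
    assume \<zeta>: "sign_potential \<Upsilon> (verts \<Upsilon> - unbal_verts \<Upsilon> S) \<zeta>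
        (induced \<Upsilon> S (verts \<Upsilon> - unbal_verts \<Upsilon> S))"
      and "gain_potential \<Upsilon> (\<lambda>v. - \<theta> v) S"
    \<comment> \<open>A gain potential neutralizes by its negative, so the two minus signs cancel
      and \<open>\<theta>\<close> itself is the switcher.\<close>
    then have "S \<subseteq> gain_edges \<Upsilon> \<theta>" by (simp add: gain_potential_def)
    from bal_closure_eq[OF two S this] frame_span_inter_gain_edges[OF S \<zeta>]
    show "bal_closure \<Upsilon> S =
        induced \<Upsilon> (gain_edges \<Upsilon> \<theta>) (unbal_verts \<Upsilon> S) \<union>
        induced_part \<Upsilon> (gain_sign_edges \<Upsilon> \<theta> (verts \<Upsilon> - unbal_verts \<Upsilon> S) \<zeta>)
          (bal_components \<Upsilon> S) \<union>
        neutral_loose_edges \<Upsilon>" by simp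
  next
    assume hyp: "hyperfrustrated \<Upsilon> S"
    show "clos_gsg \<Upsilon> S = clos_frame \<Upsilon> S"
      using clos_gsg_hyperfrustrated[OF S hyp] clos_frame_eq[OF S] by simp
    show "clos_inf \<Upsilon> (Some ` S) = insert None (Some ` clos_gsg \<Upsilon> S)"
      by (rule clos_inf_hyperfrustrated[OF two S hyp])
  next
    fix \<zeta>
    assume \<zeta>: "sign_potential \<Upsilon> (verts \<Upsilon> - unbal_verts \<Upsilon> S) \<zeta>
        (induced \<Upsilon> S (verts \<Upsilon> - unbal_verts \<Upsilon> S))"
    show "clos_frame \<Upsilon> S =
        induced \<Upsilon> (edges \<Upsilon>) (unbal_verts \<Upsilon> S) \<union>
        induced_part \<Upsilon> (sign_edges \<Upsilon> (verts \<Upsilon> - unbal_verts \<Upsilon> S) \<zeta>)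
          (bal_components \<Upsilon> S) \<union>
        loose_edges \<Upsilon>"
      using clos_frame_eq[OF S] frame_span_eq[OF S \<zeta>] by simp
  qed
qed

end
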